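(* Let $1<\alpha<2$, $0\le r\le 1$, let $\beta\in[\alpha-1,1]$ be determined by $r=\frac{\sin(\pi\beta)}{\sin(\pi(\alpha-\beta))+\sin(\pi\beta)}$, let $0<K_m\le K(x)\le K_M<\infty$ on $(0,1)$, and let $s\in\mathbb N_0=\mathbb N\cup\{0\}$. For $f\in H^s_{\omega^{(\beta,\alpha-\beta)}}(0,1)$ and $1/K\in W^{s+1}_\infty(0,1)$, let $u$ be the solution of $$L_r^\alpha u(x)=f_1(x)-A f_2(x),\quad x\in(0,1),\qquad u(0)=u(1)=0,$$ where $f_1(x)=\frac1{K(x)}\int_0^xf(y)\,dy$ and $f_2(x)=\frac1{K(x)}$, and let $u_N$ be its spectral approximation (defined in the context). Then there exists $C>0$, independent of $N$, such that $$\|u-u_N\|_{L^2(0,1)}\le\frac{C\,\|1/K\|_{W^{s+1}_\infty}}{(N+1)^{\alpha+s}}\big(\|f\|_{s,\omega^{(\beta,\alpha-\beta)}}+1\big).$$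
   Context: Weights and spaces: $\omega^{(a,b)}(x)=(1-x)^a x^b$ on $(0,1)$; $(g,h)_\omega=\int_0^1\omega\,g\,h\,dx$, $\|g\|_\omega=(g,g)_\omega^{1/2}$, $L^2_\omega(0,1)=\{g:\|g\|_\omega<\infty\}$. For $m\in\mathbb N_0$, $H^m_{\omega^{(a,b)}}(0,1)=\{v:\|v\|_{m,\omega^{(a,b)}}^2=\sum_{j=0}^m\|D^jv\|_{\omega^{(a+j,b+j)}}^2<\infty\}$. $W^m_\infty$ is the standard Sobolev space on $(0,1)$ with its norm. Fractional integrals for $0<\sigma<1$: ${}_0I_x^\sigma w(x)=\frac1{\Gamma(\sigma)}\int_0^x w(s)(x-s)^{\sigma-1}ds$ and ${}_xI_1^\sigma w(x)=\frac1{\Gamma(\sigma)}\int_x^1 w(s)(s-x)^{\sigma-1}ds$. $D$ is the first derivative. Operator: $L_r^\alpha u=-\big(r\,{}_0I_x^{2-\alpha}+(1-r)\,{}_xI_1^{2-\alpha}\big)Du$. In the problem, $A$ is the constant (depending on $u$) $A=K(0)\big[\big(r\,{}_0I_x^{2-\alpha}+(1-r)\,{}_xI_1^{2-\alpha}\big)Du(x)\big]\big|_{x=0}$, which is formally what the equation gives when multiplied by $K$ and evaluated at $x=0$; thus one seeks $u$ together with the constant $A$. Jacobi polynomials on $(0,1)$: $G_n^{(a,b)}(x)=P_n^{(a,b)}(2x-1)$, with $P_n^{(a,b)}$ the standard Jacobi polynomials on $[-1,1]$ (orthogonal for $(1-x)^a(1+x)^b$). Solution and its approximation: the problem has a unique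 solution $u\in L^2_{\omega^{(-(\alpha-\beta),-\beta)}}(0,1)$, namely $$u=\omega^{(\alpha-\beta,\beta)}\sum_{j=0}^\infty c_jG_j^{(\alpha-\beta,\beta)},\qquad c_j=\frac{-f_{1,j+1}+A f_{2,j+1}}{\lambda_j},$$ where $f_{i,j}=\dfrac{(f_i,G_j^{(\beta-1,\alpha-\beta-1)})_{\omega^{(\beta-1,\alpha-\beta-1)}}}{\|G_j^{(\beta-1,\alpha-\beta-1)}\|^2_{\omega^{(\beta-1,\alpha-\beta-1)}}}$ for $i=1,2$, $A=\dfrac{(f_1,1)_{\omega^{(\beta-1,\alpha-\beta-1)}}}{(f_2,1)_{\omega^{(\beta-1,\alpha-\beta-1)}}}$, and $\lambda_j=\dfrac{\sin(\pi\alpha)}{\sin(\pi(\alpha-\beta))+\sin(\pi\beta)}\dfrac{\Gamma(j+\alpha)}{j!}$. The spectral approximation is the truncation $u_N=\omega^{(\alpha-\beta,\beta)}\sum_{j=0}^Nc_jG_j^{(\alpha-\beta,\beta)}$. *)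

theory Defs
  imports "HOL-Analysis.Analysis" "HOL-Probability.Essential_Supremum"
begin

text \<open>All function spaces live on the interval $(0,1)$. Their elements are represented by total
  functions on the reals, of which only the values on $(0,1)$ matter (up to null sets).\<close>

section \<open>Weights and weighted $L^2$ spaces\<close>

definition wgt :: "real \<Rightarrow> real \<Rightarrow> real \<Rightarrow> real" where
  "wgt a b x = (1 - x) powr a * x powr b"

definition wip :: "real \<Rightarrow> real \<Rightarrow> (real \<Rightarrow> real) \<Rightarrow> (real \<Rightarrow> real) \<Rightarrow> real" where
  "wip a b g h = (LINT x:{0<..<1}|lebesgue. wgt a b x * g x * h x)"

definition wnorm :: "real \<Rightarrow> real \<Rightarrow> (real \<Rightarrow> real) \<Rightarrow> real" where
  "wnorm a b g = sqrt (wip a b g g)"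

text \<open>The Bochner integral of a non-integrable function is 0, so finiteness of the norm has to
  be expressed by integrability.\<close>

definition in_wL2 :: "real \<Rightarrow> real \<Rightarrow> (real \<Rightarrow> real) \<Rightarrow> bool" where
  "in_wL2 a b g \<longleftrightarrow> set_borel_measurable lebesgue {0<..<1} g \<and>
     set_integrable lebesgue {0<..<1} (\<lambda>x. wgt a b x * (g x)\<^sup>2)"

definition L2_norm :: "(real \<Rightarrow> real) \<Rightarrow> real" where
  "L2_norm g = sqrt (LINT x:{0<..<1}|lebesgue. (g x)\<^sup>2)"

section \<open>Weak derivatives and Sobolev spaces\<close>

definition locally_integrable :: "(real \<Rightarrow> real) \<Rightarrow> bool" where
  "locally_integrable g \<longleftrightarrow> (\<forall>a b. 0 < a \<longrightarrow> b < 1 \<longrightarrow> set_integrable lebesgue {a..b} g)"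

text \<open>The space $C_c^\infty(0,1)$.\<close>

definition test_fun :: "(real \<Rightarrow> real) \<Rightarrow> bool" where
  "test_fun \<phi> \<longleftrightarrow> (\<forall>k x. (deriv ^^ k) \<phi> field_differentiable (at x)) \<and>
     (\<exists>a b. 0 < a \<and> b < 1 \<and> (\<forall>x. x \<notin> {a..b} \<longrightarrow> \<phi> x = 0))"

definition has_weak_deriv :: "nat \<Rightarrow> (real \<Rightarrow> real) \<Rightarrow> (real \<Rightarrow> real) \<Rightarrow> bool" where
  "has_weak_deriv j v g \<longleftrightarrow> locally_integrable v \<and> locally_integrable g \<and>
     (\<forall>\<phi>. test_fun \<phi> \<longrightarrow>
        (LINT x:{0<..<1}|lebesgue. v x * (deriv ^^ j) \<phi> x) =
        (-1) ^ j * (LINT x:{0<..<1}|lebesgue. g x * \<phi> x))"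

text \<open>A weak derivative is unique up to null sets; the choice of a representative is immaterial
  because it is only used below integrals and essential suprema.\<close>

definition weak_deriv :: "nat \<Rightarrow> (real \<Rightarrow> real) \<Rightarrow> real \<Rightarrow> real" where
  "weak_deriv j v = (SOME g. has_weak_deriv j v g)"

definition in_wH :: "nat \<Rightarrow> real \<Rightarrow> real \<Rightarrow> (real \<Rightarrow> real) \<Rightarrow> bool" where
  "in_wH m a b v \<longleftrightarrow>
     (\<forall>j\<le>m. \<exists>g. has_weak_deriv j v g \<and> in_wL2 (a + real j) (b + real j) g)"

definition wH_norm :: "nat \<Rightarrow> real \<Rightarrow> real \<Rightarrow> (real \<Rightarrow> real) \<Rightarrow> real" where
  "wH_norm m a b v = sqrt (\<Sum>j\<le>m. (wnorm (a + real j) (b + real j) (weak_deriv j v))\<^sup>2)"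

definition Linf_norm :: "(real \<Rightarrow> real) \<Rightarrow> real" where
  "Linf_norm g = real_of_ereal (esssup (lebesgue_on {0<..<1}) (\<lambda>x. ereal \<bar>g x\<bar>))"

definition in_Winf :: "nat \<Rightarrow> (real \<Rightarrow> real) \<Rightarrow> bool" where
  "in_Winf m v \<longleftrightarrow>
     (\<forall>j\<le>m. \<exists>g. has_weak_deriv j v g \<and> (\<exists>B. AE x in lebesgue_on {0<..<1}. \<bar>g x\<bar> \<le> B))"

definition Winf_norm :: "nat \<Rightarrow> (real \<Rightarrow> real) \<Rightarrow> real" where
  "Winf_norm m v = Max ((\<lambda>j. Linf_norm (weak_deriv j v)) ` {..m})"

section \<open>The fractional boundary value problem\<close>

definition frac_int_left :: "real \<Rightarrow> (real \<Rightarrow> real) \<Rightarrow> real \<Rightarrow> real" where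
  "frac_int_left \<sigma> w x =
     1 / Gamma \<sigma> * (LINT t:{0<..<x}|lebesgue. w t * (x - t) powr (\<sigma> - 1))"

definition frac_int_right :: "real \<Rightarrow> (real \<Rightarrow> real) \<Rightarrow> real \<Rightarrow> real" where
  "frac_int_right \<sigma> w x =
     1 / Gamma \<sigma> * (LINT t:{x<..<1}|lebesgue. w t * (t - x) powr (\<sigma> - 1))"

definition frac_op :: "real \<Rightarrow> real \<Rightarrow> (real \<Rightarrow> real) \<Rightarrow> real \<Rightarrow> real" where
  "frac_op \<alpha> r u x =
     - (r * frac_int_left (2 - \<alpha>) (weak_deriv 1 u) x
        + (1 - r) * frac_int_right (2 - \<alpha>) (weak_deriv 1 u) x)"

definition rhs1 :: "(real \<Rightarrow> real) \<Rightarrow> (real \<Rightarrow> real) \<Rightarrow> real \<Rightarrow> real" where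
  "rhs1 K f x = 1 / K x * (LINT y:{0<..<x}|lebesgue. f y)"

definition rhs2 :: "(real \<Rightarrow> real) \<Rightarrow> real \<Rightarrow> real" where
  "rhs2 K x = 1 / K x"

text \<open>The unknowns are the function \<open>u\<close> and the constant \<open>A\<close>. Continuity on $[0,1]$ gives the
  boundary values a meaning, and integrability of \<open>Du\<close> makes both fractional integrals exist
  almost everywhere, so that the equation is not about junk values of divergent integrals.\<close>

definition is_solution ::
  "real \<Rightarrow> real \<Rightarrow> real \<Rightarrow> (real \<Rightarrow> real) \<Rightarrow> (real \<Rightarrow> real) \<Rightarrow> (real \<Rightarrow> real) \<Rightarrow> real \<Rightarrow> bool" where
  "is_solution \<alpha> r \<beta> K f u A \<longleftrightarrow>
     in_wL2 (- (\<alpha> - \<beta>)) (- \<beta>) u \<and>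
     continuous_on {0..1} u \<and> u 0 = 0 \<and> u 1 = 0 \<and>
     (\<exists>g. has_weak_deriv 1 u g \<and> set_integrable lebesgue {0<..<1} g) \<and>
     (AE x in lebesgue_on {0<..<1}. frac_op \<alpha> r u x = rhs1 K f x - A * rhs2 K x)"

section \<open>Jacobi polynomials and the spectral approximation\<close>

text \<open>Jacobi polynomials on $[-1,1]$ in the standard normalisation
  $P_n^{(a,b)}(1) = {n+a \choose n}$.\<close>

definition jacobi :: "nat \<Rightarrow> real \<Rightarrow> real \<Rightarrow> real \<Rightarrow> real" where
  "jacobi n a b t =
     (\<Sum>k\<le>n. ((real n + a) gchoose (n - k)) * ((real n + b) gchoose k)
             * ((t - 1) / 2) ^ k * ((t + 1) / 2) ^ (n - k))"

definition jacobi01 :: "nat \<Rightarrow> real \<Rightarrow> real \<Rightarrow> real \<Rightarrow> real" where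
  "jacobi01 n a b x = jacobi n a b (2 * x - 1)"

definition jac_coeff :: "real \<Rightarrow> real \<Rightarrow> (real \<Rightarrow> real) \<Rightarrow> nat \<Rightarrow> real" where
  "jac_coeff a b g j = wip a b g (jacobi01 j a b) / (wnorm a b (jacobi01 j a b))\<^sup>2"

definition eig :: "real \<Rightarrow> real \<Rightarrow> nat \<Rightarrow> real" where
  "eig \<alpha> \<beta> j = sin (pi * \<alpha>) / (sin (pi * (\<alpha> - \<beta>)) + sin (pi * \<beta>))
               * (Gamma (real j + \<alpha>) / fact j)"

definition const_A :: "real \<Rightarrow> real \<Rightarrow> (real \<Rightarrow> real) \<Rightarrow> (real \<Rightarrow> real) \<Rightarrow> real" where
  "const_A \<alpha> \<beta> K f = wip (\<beta> - 1) (\<alpha> - \<beta> - 1) (rhs1 K f) (\<lambda>_. 1)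
                   / wip (\<beta> - 1) (\<alpha> - \<beta> - 1) (rhs2 K) (\<lambda>_. 1)"

definition sol_coeff ::
  "real \<Rightarrow> real \<Rightarrow> (real \<Rightarrow> real) \<Rightarrow> (real \<Rightarrow> real) \<Rightarrow> nat \<Rightarrow> real" where
  "sol_coeff \<alpha> \<beta> K f j =
     (- jac_coeff (\<beta> - 1) (\<alpha> - \<beta> - 1) (rhs1 K f) (j + 1)
      + const_A \<alpha> \<beta> K f * jac_coeff (\<beta> - 1) (\<alpha> - \<beta> - 1) (rhs2 K) (j + 1)) / eig \<alpha> \<beta> j"

definition spectral_approx ::
  "real \<Rightarrow> real \<Rightarrow> (real \<Rightarrow> real) \<Rightarrow> (real \<Rightarrow> real) \<Rightarrow> nat \<Rightarrow> real \<Rightarrow> real" where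
  "spectral_approx \<alpha> \<beta> K f N x =
     wgt (\<alpha> - \<beta>) \<beta> x * (\<Sum>j\<le>N. sol_coeff \<alpha> \<beta> K f j * jacobi01 j (\<alpha> - \<beta>) \<beta> x)"

end

theory Submission
  imports Defs
begin

text \<open>Write $\gamma = \alpha - \beta$ and $\omega^{(a,b)}$ for \<open>wgt a b\<close>. The theorem is a statement about one
  solution: \<open>C\<close> may depend on everything but \<open>N\<close>, so what has to be shown is the rate
  $(N+1)^{-(\alpha+s)}$ together with the positivity of the norm of $1/K$ (\<open>Winf_norm_pos\<close>).

  The operator integrates $Du$ against a multiple of the kernel \<open>abel_ker\<close>, which is
  $|x-t|^{1-\alpha}$ with one constant for $t<x$ and another for $t>x$. The relation between $r$ and
  $\beta$ is exactly what makes the integral of this kernel against $\omega^{(\beta-1,\gamma-1)}$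
  independent of $x$ (\<open>abel_ker_weight\<close>). Two consequences carry the proof. First, Fubini can be
  applied to every integrable $Du$ (\<open>abel_swap\<close>). Second, the kernel maps $\omega^{(\beta-1,\gamma-1)}$
  times a polynomial to a polynomial of at most the same degree, and, as its transpose is the same
  kernel with $\beta$ and $\gamma$ exchanged, it maps $\omega^{(\beta-1,\gamma-1)}G_m^{(\beta-1,\gamma-1)}$
  to a multiple of $G_m^{(\gamma-1,\beta-1)}$ (\<open>abel_transform_jpoly\<close>).

  Let $g = f_1 - A f_2$. Testing the equation with $\omega^{(\beta-1,\gamma-1)}G_m^{(\beta-1,\gamma-1)}$
  and integrating by parts once expresses the coefficient of $g$ of index $m$ by the coefficient of
  $u/\omega^{(\gamma,\beta)}$ of index $m-1$ (\<open>jinner_g_Suc\<close>); for $m=0$ it says that $A$ is the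
  constant \<open>const_A\<close>. Hence $u_N$ is $\omega^{(\gamma,\beta)}$ times the orthogonal projection of
  $u/\omega^{(\gamma,\beta)}$ onto the polynomials of degree at most $N$ (\<open>spectral_approx_eq\<close>).

  By completeness of the polynomials the error is a tail of squared, normalised coefficients, called
  energies below (\<open>residual_le_tail\<close>). The energies of $u/\omega^{(\gamma,\beta)}$ are at most those of
  $g$ divided by $\lambda_j^2$, which yields $N^{-2(\alpha-1)}$. The energies of $g$ decay because
  Rodrigues' formula moves derivatives to $g$: each of the $s+1$ derivatives that $g$ has
  in the weighted spaces gains a factor $m^{-2}$ (\<open>energy_tail\<close>). The product is
  $N^{-2(\alpha-1)-2(s+1)} = N^{-2(\alpha+s)}$.

  Weak derivatives enter through the lemma of du Bois-Reymond: a function with a locally integrable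
  weak derivative is, up to a null set, an indefinite integral of it (\<open>weak_deriv_primitive\<close>). For
  indefinite integrals the product rule is Fubini's theorem on a triangle (\<open>primitive_mult\<close>), and this
  is the only form of integration by parts that is used.\<close>
section \<open>Indefinite integrals on the unit interval\<close>

text \<open>Local absolute continuity on $(0,1)$, stated as the fundamental theorem of calculus. Only \<open>v\<close> is
  determined pointwise; \<open>g\<close> matters up to null sets.\<close>

definition primitive :: "(real \<Rightarrow> real) \<Rightarrow> (real \<Rightarrow> real) \<Rightarrow> bool" where
  "primitive v g \<longleftrightarrow> (\<forall>p q. 0 < p \<longrightarrow> p \<le> q \<longrightarrow> q < 1 \<longrightarrow>
     set_integrable lebesgue {p..q} g \<and> v q - v p = (LINT x:{p..q}|lebesgue. g x))"

lemma primitiveD: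
  assumes "primitive v g" "0 < p" "p \<le> q" "q < 1"
  shows "set_integrable lebesgue {p..q} g" "v q - v p = (LINT x:{p..q}|lebesgue. g x)"
  using assms unfolding primitive_def by auto

lemma primitive_continuous:
  assumes "primitive v g" shows "continuous_on {0<..<1} v"
proof -
  have "isCont v x" if x: "x \<in> {0<..<1}" for x
  proof -
    define p q where "p = x / 2" and "q = (x + 1) / 2"
    have pq: "0 < p" "p < x" "x < q" "q < 1" using x by (auto simp: p_def q_def)
    have abs: "g absolutely_integrable_on {p..q}"
      using primitiveD[OF assms, of p q] pq by auto
    have int: "g integrable_on {p..q}"
      using abs set_lebesgue_integral_eq_integral(1) by blast
    have "continuous_on {p..q} (\<lambda>y. v p + integral {p..y} g)"
      by (intro continuous_intros indefinite_integral_continuous_1 int)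
    moreover have "v p + integral {p..y} g = v y" if "y \<in> {p..q}" for y
    proof -
      have "g absolutely_integrable_on {p..y}"
        using primitiveD[OF assms, of p y] pq that by auto
      then have "(LINT x:{p..y}|lebesgue. g x) = integral {p..y} g"
        by (rule set_lebesgue_integral_eq_integral(2))
      then show ?thesis
        using primitiveD(2)[OF assms, of p y] pq that by simp
    qed
    ultimately have "continuous_on {p..q} v" by (rule continuous_on_eq)
    then show ?thesis using continuous_on_interior[of "{p..q}" v x] pq by auto
  qed
  then show ?thesis by (simp add: continuous_at_imp_continuous_on)
qed

lemma primitive_continuous_Icc:
  assumes "primitive v g" "0 < p" "q < 1" shows "continuous_on {p..q} v"
  by (rule continuous_on_subset[OF primitive_continuous[OF assms(1)]]) (use assms in auto)

lemma continuous_times_integrable: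
  fixes v g :: "real \<Rightarrow> real"
  assumes "continuous_on {p..q} v" "set_integrable lebesgue {p..q} g"
  shows "set_integrable lebesgue {p..q} (\<lambda>x. v x * g x)"
proof -
  have "v \<in> borel_measurable (lebesgue_on {p..q})"
    by (rule continuous_imp_measurable_on_sets_lebesgue[OF assms(1)]) auto
  moreover have "bounded (v ` {p..q})"
    by (rule compact_imp_bounded[OF compact_continuous_image[OF assms(1)]]) auto
  ultimately show ?thesis
    using absolutely_integrable_bounded_measurable_product_real[OF _ _ _ assms(2), of v] by auto
qed

text \<open>Insert $w(x) = w(p) + \int_p^x h$ and $v(x) = v(q) - \int_x^q g$. Both integrals then become
  integrals of $g(x)h(y)$ over the triangle $p \le y \le x \le q$, taken in the two possible orders.\<close>

lemma primitive_mult: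
  assumes v: "primitive v g" and w: "primitive w h"
  shows "primitive (\<lambda>x. v x * w x) (\<lambda>x. g x * w x + v x * h x)"
  unfolding primitive_def
proof (intro allI impI conjI)
  fix p q :: real assume pq: "0 < p" "p \<le> q" "q < 1"
  note vD = primitiveD[OF v] and wD = primitiveD[OF w]
  have g: "set_integrable lebesgue {p..q} g" and h: "set_integrable lebesgue {p..q} h"
    using vD wD pq by auto
  have gw: "set_integrable lebesgue {p..q} (\<lambda>x. g x * w x)"
    using continuous_times_integrable[OF primitive_continuous_Icc[OF w] g] pq by (simp add: mult.commute)
  have vh: "set_integrable lebesgue {p..q} (\<lambda>x. v x * h x)"
    using continuous_times_integrable[OF primitive_continuous_Icc[OF v] h] pq by (simp add: mult.commute)
  show "set_integrable lebesgue {p..q} (\<lambda>x. g x * w x + v x * h x)"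
    by (rule set_integral_add(1)[OF gw vh])
  define M where "M = lebesgue_on {p..q}"
  interpret M: finite_measure M unfolding M_def by (rule finite_measure_lebesgue_on) auto
  interpret P: pair_sigma_finite M M by standard
  have iM: "set_integrable lebesgue S f \<longleftrightarrow> integrable M (\<lambda>x. indicator S x * f x)"
       "(LINT x:S|lebesgue. f x) = (LINT x|M. indicator S x * f x)"
    if "S \<subseteq> {p..q}" "S \<in> sets lebesgue" for S and f :: "real \<Rightarrow> real"
  proof -
    have *: "indicat_real {p..q} x * (indicat_real S x * f x) = indicat_real S x * f x" for x
      using that by (auto simp: indicator_def)
    show "set_integrable lebesgue S f \<longleftrightarrow> integrable M (\<lambda>x. indicator S x * f x)"
      unfolding M_def set_integrable_def by (subst integrable_restrict_space) (auto simp: *)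
    show "(LINT x:S|lebesgue. f x) = (LINT x|M. indicator S x * f x)"
      unfolding M_def set_lebesgue_integral_def by (subst integral_restrict_space) (auto simp: *)
  qed
  have spM: "space M = {p..q}" by (simp add: M_def)
  have full: "set_integrable lebesgue {p..q} f \<longleftrightarrow> integrable M f"
       "(LINT x:{p..q}|lebesgue. f x) = (LINT x|M. f x)" for f :: "real \<Rightarrow> real"
  proof -
    have *: "indicat_real {p..q} x * f x = f x" if "x \<in> space M" for x
      using that by (simp add: spM)
    show "set_integrable lebesgue {p..q} f \<longleftrightarrow> integrable M f"
      using iM(1)[of "{p..q}" f] Bochner_Integration.integrable_cong[OF refl *, of M] by simp
    show "(LINT x:{p..q}|lebesgue. f x) = (LINT x|M. f x)"
      using iM(2)[of "{p..q}" f] Bochner_Integration.integral_cong[OF refl *, of M] by simp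
  qed
  have gM: "integrable M g" and hM: "integrable M h" using g h full by auto
  have [measurable]: "g \<in> borel_measurable M" "h \<in> borel_measurable M"
    using gM hM by auto
  have [measurable]: "(\<lambda>x. x) \<in> borel_measurable M" unfolding M_def
    by (rule continuous_imp_measurable_on_sets_lebesgue) auto
  define T where "T = (\<lambda>z::real\<times>real. indicator {z. snd z \<le> fst z} z * g (fst z) * h (snd z))"
  have Tm: "T \<in> borel_measurable (M \<Otimes>\<^sub>M M)"
    unfolding T_def indicator_def by measurable
  have prod: "integrable (M \<Otimes>\<^sub>M M) (\<lambda>z. g (fst z) * h (snd z))"
    by (rule P.Fubini_integrable) (use gM hM in \<open>auto simp: abs_mult\<close>)
  have Ti: "integrable (M \<Otimes>\<^sub>M M) T"
    by (rule Bochner_Integration.integrable_bound[OF prod Tm]) (auto simp: T_def indicator_def)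
  have "(LINT x|M. LINT y|M. T (x, y)) = (LINT y|M. LINT x|M. T (x, y))"
    using P.Fubini_integral[of "\<lambda>x y. T (x, y)"] Ti by simp
  moreover have "(LINT x|M. LINT y|M. T (x, y)) = (LINT x|M. g x * (w x - w p))"
  proof (rule Bochner_Integration.integral_cong[OF refl])
    fix x assume "x \<in> space M"
    then have x: "p \<le> x" "x \<le> q" by (auto simp: spM)
    have "(LINT y|M. T (x, y)) = (LINT y|M. g x * (indicator {p..x} y * h y))"
      by (rule Bochner_Integration.integral_cong[OF refl]) (auto simp: T_def indicator_def spM)
    also have "\<dots> = g x * (LINT y:{p..x}|lebesgue. h y)"
      using iM(2)[of "{p..x}" h] x by simp
    also have "(LINT y:{p..x}|lebesgue. h y) = w x - w p" using wD(2)[of p x] x pq by simp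
    finally show "(LINT y|M. T (x, y)) = g x * (w x - w p)" .
  qed
  moreover have "(LINT y|M. LINT x|M. T (x, y)) = (LINT y|M. (v q - v y) * h y)"
  proof (rule Bochner_Integration.integral_cong[OF refl])
    fix y assume "y \<in> space M"
    then have y: "p \<le> y" "y \<le> q" by (auto simp: spM)
    have "(LINT x|M. T (x, y)) = (LINT x|M. (indicator {y..q} x * g x) * h y)"
      by (rule Bochner_Integration.integral_cong[OF refl]) (auto simp: T_def indicator_def spM)
    also have "\<dots> = (LINT x:{y..q}|lebesgue. g x) * h y"
      using iM(2)[of "{y..q}" g] y by simp
    also have "(LINT x:{y..q}|lebesgue. g x) = v q - v y" using vD(2)[of y q] y pq by simp
    finally show "(LINT x|M. T (x, y)) = (v q - v y) * h y" .
  qed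
  moreover have "(LINT x|M. g x * (w x - w p)) = (LINT x|M. g x * w x) - (v q - v p) * w p"
  proof -
    have "(LINT x|M. g x * (w x - w p)) = (LINT x|M. g x * w x - g x * w p)"
      by (simp add: algebra_simps)
    also have "\<dots> = (LINT x|M. g x * w x) - (LINT x|M. g x * w p)"
      using gw gM full by (intro Bochner_Integration.integral_diff) auto
    finally show ?thesis using vD(2)[OF pq] full by simp
  qed
  moreover have "(LINT y|M. (v q - v y) * h y) = v q * (w q - w p) - (LINT x|M. v x * h x)"
  proof -
    have "(LINT y|M. (v q - v y) * h y) = (LINT x|M. v q * h x - v x * h x)"
      by (simp add: algebra_simps)
    also have "\<dots> = (LINT x|M. v q * h x) - (LINT x|M. v x * h x)"
      using vh hM full by (intro Bochner_Integration.integral_diff) auto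
    finally show ?thesis using wD(2)[OF pq] full by simp
  qed
  moreover have "(LINT x:{p..q}|lebesgue. g x * w x + v x * h x) = (LINT x|M. g x * w x) + (LINT x|M. v x * h x)"
    unfolding full using gw vh full by (intro Bochner_Integration.integral_add) auto
  ultimately show "v q * w q - v p * w p = (LINT x:{p..q}|lebesgue. g x * w x + v x * h x)"
    by (simp add: algebra_simps)
qed

lemma primitive_of_derivative:
  assumes "\<And>x. x \<in> {0<..<1} \<Longrightarrow> (v has_real_derivative g x) (at x)" "continuous_on {0<..<1} g"
  shows "primitive v g"
  unfolding primitive_def
proof (intro allI impI)
  fix p q :: real assume pq: "0 < p" "p \<le> q" "q < 1"
  have "continuous_on {p..q} g" by (rule continuous_on_subset[OF assms(2)]) (use pq in auto)
  then have abs: "g absolutely_integrable_on {p..q}" by (rule absolutely_integrable_continuous_real)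
  have "(g has_integral (v q - v p)) {p..q}"
  proof (rule fundamental_theorem_of_calculus[OF pq(2)])
    fix x assume "x \<in> {p..q}"
    then show "(v has_vector_derivative g x) (at x within {p..q})"
      using assms(1)[of x] pq by (auto simp: has_real_derivative_iff_has_vector_derivative[symmetric] intro: DERIV_subset)
  qed
  then show "set_integrable lebesgue {p..q} g \<and> v q - v p = (LINT x:{p..q}|lebesgue. g x)"
    using abs set_lebesgue_integral_eq_integral(2)[OF abs] by (simp add: integral_unique)
qed

lemma primitive_add:
  assumes "primitive v g" "primitive w h"
  shows "primitive (\<lambda>x. v x + w x) (\<lambda>x. g x + h x)"
  unfolding primitive_def
proof (intro allI impI)
  fix p q :: real assume pq: "0 < p" "p \<le> q" "q < 1"
  note D = primitiveD[OF assms(1) pq] primitiveD[OF assms(2) pq]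
  show "set_integrable lebesgue {p..q} (\<lambda>x. g x + h x) \<and>
      v q + w q - (v p + w p) = (LINT x:{p..q}|lebesgue. g x + h x)"
    using set_integral_add[OF D(1) D(3)] D(2,4) by linarith
qed

lemma primitive_const: "primitive (\<lambda>x. c) (\<lambda>x. 0)"
  by (rule primitive_of_derivative) auto

lemma primitive_cong_AE:
  assumes "primitive v g" "AE x in lebesgue_on {0<..<1}. g x = h x" "locally_integrable h"
  shows "primitive v h"
  unfolding primitive_def
proof (intro allI impI)
  fix p q :: real assume pq: "0 < p" "p \<le> q" "q < 1"
  have h: "set_integrable lebesgue {p..q} h" using assms(3) pq unfolding locally_integrable_def by auto
  have g: "set_integrable lebesgue {p..q} g" using primitiveD[OF assms(1) pq] by auto
  have "AE x in lebesgue. x \<in> {0<..<1} \<longrightarrow> g x = h x"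
    using assms(2) by (subst (asm) AE_restrict_space_iff) auto
  then have ae: "AE x \<in> {p..q} in lebesgue. g x = h x" by eventually_elim (use pq in auto)
  have "(LINT x:{p..q}|lebesgue. g x) = (LINT x:{p..q}|lebesgue. h x)"
    unfolding set_lebesgue_integral_def
  proof (rule integral_cong_AE)
    show "AE x in lebesgue. indicator {p..q} x *\<^sub>R g x = indicator {p..q} x *\<^sub>R h x"
      using ae by eventually_elim (simp add: indicator_def)
  qed (use g h in \<open>simp_all add: set_integrable_def borel_measurable_integrable\<close>)
  then show "set_integrable lebesgue {p..q} h \<and> v q - v p = (LINT x:{p..q}|lebesgue. h x)"
    using h primitiveD[OF assms(1) pq] by auto
qed

lemma primitive_locally_integrable: "primitive v g \<Longrightarrow> locally_integrable g"
  unfolding locally_integrable_def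
proof (intro allI impI)
  fix a b :: real assume "primitive v g" "0 < a" "b < 1"
  then show "set_integrable lebesgue {a..b} g"
    using primitiveD(1)[of v g a b] by (cases "a \<le> b") (simp_all add: set_integrable_def)
qed

abbreviation shrink :: "nat \<Rightarrow> real" where
  "shrink n \<equiv> inverse (real (Suc (Suc n)))"

lemma unit_interval_exhaust:
  shows "incseq (\<lambda>n. {shrink n .. 1 - shrink n})"
    and "(\<Union>n. {shrink n .. 1 - shrink n}) = {0<..<1}"
proof -
  show "incseq (\<lambda>n. {shrink n .. 1 - shrink n})"
    by (rule incseq_SucI) (auto simp: field_simps)
  show "(\<Union>n. {shrink n .. 1 - shrink n}) = {0<..<1}"
  proof (intro equalityI subsetI)
    fix x :: real assume "x \<in> {0<..<1}"
    then have "0 < min x (1 - x)" by auto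
    then obtain n where n: "inverse (real (Suc n)) < min x (1 - x)" using reals_Archimedean by blast
    have "shrink n \<le> inverse (real (Suc n))" by (simp add: field_simps)
    then have "shrink n \<le> x" "x \<le> 1 - shrink n"
      using n by linarith+
    then have "x \<in> {shrink n .. 1 - shrink n}" by auto
    then show "x \<in> (\<Union>n. {shrink n .. 1 - shrink n})" by blast
  next
    fix x :: real
    assume "x \<in> (\<Union>n. {shrink n .. 1 - shrink n})"
    then obtain n where n: "shrink n \<le> x" "x \<le> 1 - shrink n" by auto
    have "0 < shrink n" by simp
    then have "0 < x" "x < 1" using n by linarith+
    then show "x \<in> {0<..<1}" by simp
  qed
qed

lemma locally_integrable_measurable:
  assumes "locally_integrable g"
  shows "g \<in> borel_measurable (lebesgue_on {0<..<1})"
proof -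
  let ?J = "\<lambda>n. {shrink n .. 1 - shrink n}"
  have "(\<lambda>x. indicator (?J n) x *\<^sub>R g x) \<in> borel_measurable lebesgue" for n
  proof -
    have "set_integrable lebesgue (?J n) g"
      using assms unfolding locally_integrable_def by (metis inverse_positive_iff_positive of_nat_0_less_iff zero_less_Suc diff_less_eq less_add_same_cancel1)
    then show ?thesis unfolding set_integrable_def by auto
  qed
  moreover have "(\<lambda>n. indicator (?J n) x *\<^sub>R g x) \<longlonglongrightarrow> indicator {0<..<1} x *\<^sub>R g x" for x
    using LIMSEQ_indicator_incseq[OF unit_interval_exhaust(1), of x]
    unfolding unit_interval_exhaust(2) by (intro tendsto_scaleR tendsto_const)
  ultimately have "(\<lambda>x. indicator {0<..<1} x *\<^sub>R g x) \<in> borel_measurable lebesgue"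
    by (rule borel_measurable_LIMSEQ_real[rotated])
  then show ?thesis by (subst borel_measurable_restrict_space_iff) auto
qed

lemma integral_unit_interval_limit:
  fixes g :: "real \<Rightarrow> real"
  assumes "set_integrable lebesgue {0<..<1} g"
  shows "(\<lambda>n. LINT x:{shrink n .. 1 - shrink n}|lebesgue. g x)
           \<longlonglongrightarrow> (LINT x:{0<..<1}|lebesgue. g x)"
  using set_integral_cont_up[OF _ unit_interval_exhaust(1), of lebesgue g]
  unfolding unit_interval_exhaust(2) using assms by auto

lemma primitive_integral_boundary:
  assumes "primitive v g" "set_integrable lebesgue {0<..<1} g"
    and "(v \<longlongrightarrow> 0) (at_right 0)" "(v \<longlongrightarrow> 0) (at_left 1)"
  shows "(LINT x:{0<..<1}|lebesgue. g x) = 0"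
proof -
  let ?e = "\<lambda>n. shrink n"
  have e0: "?e \<longlonglongrightarrow> 0" using LIMSEQ_inverse_real_of_nat LIMSEQ_Suc by blast
  have "filterlim ?e (at_right 0) sequentially"
    unfolding filterlim_at using e0 by auto
  then have 1: "(\<lambda>n. v (?e n)) \<longlonglongrightarrow> 0" by (rule filterlim_compose[OF assms(3)])
  have "(\<lambda>n. 1 - ?e n) \<longlonglongrightarrow> 1 - 0" by (intro tendsto_intros e0)
  then have "filterlim (\<lambda>n. 1 - ?e n) (at_left 1) sequentially"
    unfolding filterlim_at by auto
  then have 2: "(\<lambda>n. v (1 - ?e n)) \<longlonglongrightarrow> 0" by (rule filterlim_compose[OF assms(4)])
  have "(\<lambda>n. v (1 - ?e n) - v (?e n)) \<longlonglongrightarrow> 0 - 0" by (intro tendsto_diff 1 2)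
  moreover have "v (1 - ?e n) - v (?e n) = (LINT x:{?e n .. 1 - ?e n}|lebesgue. g x)" for n
    by (rule primitiveD(2)[OF assms(1)]) (auto simp: field_simps)
  ultimately show ?thesis using integral_unit_interval_limit[OF assms(2)] LIMSEQ_unique by fastforce
qed

section \<open>Test functions\<close>

definition smooth :: "(real \<Rightarrow> real) \<Rightarrow> bool" where
  "smooth f \<longleftrightarrow> (\<forall>k x. (deriv ^^ k) f field_differentiable (at x))"

text \<open>To compute \<open>deriv\<close> of a sum or a product one has to know first that the derivatives exist. The recursive
  form exhibits a derivative in each step, which makes the closure properties simple inductions.\<close>

primrec diff_upto :: "nat \<Rightarrow> (real \<Rightarrow> real) \<Rightarrow> bool" where
  "diff_upto 0 f \<longleftrightarrow> True"
| "diff_upto (Suc n) f \<longleftrightarrow> (\<exists>f'. (\<forall>x. (f has_real_derivative f' x) (at x)) \<and> diff_upto n f')"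

lemma diff_upto_SucI:
  "(\<And>x. (f has_real_derivative f' x) (at x)) \<Longrightarrow> diff_upto n f' \<Longrightarrow> diff_upto (Suc n) f"
  by auto

lemma diff_upto_Suc_deriv:
  "diff_upto (Suc n) f \<longleftrightarrow> (\<forall>x. f field_differentiable (at x)) \<and> diff_upto n (deriv f)"
proof
  assume "diff_upto (Suc n) f"
  then obtain f' where f': "\<And>x. (f has_real_derivative f' x) (at x)" "diff_upto n f'" by auto
  then have "f' = deriv f" by (metis DERIV_imp_deriv ext)
  then show "(\<forall>x. f field_differentiable (at x)) \<and> diff_upto n (deriv f)"
    using f' by (auto simp: field_differentiable_def)
next
  assume "(\<forall>x. f field_differentiable (at x)) \<and> diff_upto n (deriv f)"
  then show "diff_upto (Suc n) f"
    by (intro diff_upto_SucI[of f "deriv f"]) (auto simp: DERIV_deriv_iff_field_differentiable)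
qed

lemma smooth_iff_diff_upto: "smooth f \<longleftrightarrow> (\<forall>n. diff_upto n f)"
proof -
  have "(\<forall>n. diff_upto n f) \<longleftrightarrow> (\<forall>n. diff_upto (Suc n) f)"
    by (metis diff_upto.simps(1) not0_implies_Suc)
  have *: "diff_upto n f \<longleftrightarrow> (\<forall>k<n. \<forall>x. (deriv ^^ k) f field_differentiable (at x))" for n f
  proof (induction n arbitrary: f)
    case (Suc n)
    have "(\<forall>k<Suc n. \<forall>x. (deriv ^^ k) f field_differentiable (at x)) \<longleftrightarrow>
        (\<forall>x. f field_differentiable (at x)) \<and> (\<forall>k<n. \<forall>x. (deriv ^^ Suc k) f field_differentiable (at x))"
      unfolding All_less_Suc2 by simp
    then show ?case unfolding diff_upto_Suc_deriv Suc.IH by (simp add: funpow_swap1)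
  qed simp
  show ?thesis unfolding smooth_def * by blast
qed

lemma diff_upto_SucD: "diff_upto (Suc n) f \<Longrightarrow> diff_upto n f"
proof (induction n arbitrary: f)
  case (Suc n)
  then obtain f' where "\<And>x. (f has_real_derivative f' x) (at x)" "diff_upto (Suc n) f'"
    using diff_upto.simps(2)[of "Suc n" f] by blast
  then show ?case using Suc.IH[of f'] diff_upto.simps(2)[of n f] by blast
qed simp

lemma diff_upto_add: "diff_upto n f \<Longrightarrow> diff_upto n g \<Longrightarrow> diff_upto n (\<lambda>x. f x + g x)"
proof (induction n arbitrary: f g)
  case (Suc n)
  then obtain f' g' where "\<And>x. (f has_real_derivative f' x) (at x)" "diff_upto n f'"
      "\<And>x. (g has_real_derivative g' x) (at x)" "diff_upto n g'" by auto
  then show ?case using Suc.IH[of f' g']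
    by (auto intro!: exI[of _ "\<lambda>x. f' x + g' x"] derivative_intros)
qed simp

lemma diff_upto_mult: "diff_upto n f \<Longrightarrow> diff_upto n g \<Longrightarrow> diff_upto n (\<lambda>x. f x * g x)"
proof (induction n arbitrary: f g)
  case (Suc n)
  then obtain f' g' where D: "\<And>x. (f has_real_derivative f' x) (at x)" "diff_upto n f'"
      "\<And>x. (g has_real_derivative g' x) (at x)" "diff_upto n g'" by auto
  have "diff_upto n (\<lambda>x. f' x * g x + f x * g' x)"
    by (intro diff_upto_add Suc.IH D diff_upto_SucD[OF Suc.prems(1)] diff_upto_SucD[OF Suc.prems(2)])
  moreover have "((\<lambda>x. f x * g x) has_real_derivative f' x * g x + f x * g' x) (at x)" for x
    using D by (auto intro!: derivative_eq_intros)
  ultimately show ?case by (intro diff_upto_SucI)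
qed simp

lemma diff_upto_const: "diff_upto n (\<lambda>x. c)"
proof (induction n arbitrary: c)
  case (Suc n)
  have "((\<lambda>x. c) has_real_derivative 0) (at x)" for x by simp
  then show ?case using Suc[of 0] by (rule diff_upto_SucI)
qed simp

lemma diff_upto_affine: "diff_upto n f \<Longrightarrow> diff_upto n (\<lambda>x. f (c * x + d))"
proof (induction n arbitrary: f)
  case (Suc n)
  then obtain f' where D: "\<And>x. (f has_real_derivative f' x) (at x)" "diff_upto n f'" by auto
  have "((\<lambda>x. f (c * x + d)) has_real_derivative f' (c * x + d) * c) (at x)" for x
    by (rule DERIV_chain2[OF D(1)]) (auto intro!: derivative_eq_intros)
  moreover have "diff_upto n (\<lambda>x. f' (c * x + d) * c)"
    by (intro diff_upto_mult diff_upto_const Suc.IH D)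
  ultimately show ?case by (intro diff_upto_SucI)
qed simp

lemma smooth_add: "smooth f \<Longrightarrow> smooth g \<Longrightarrow> smooth (\<lambda>x. f x + g x)"
  and smooth_mult: "smooth f \<Longrightarrow> smooth g \<Longrightarrow> smooth (\<lambda>x. f x * g x)"
  and smooth_const: "smooth (\<lambda>x. c)"
  and smooth_affine: "smooth f \<Longrightarrow> smooth (\<lambda>x. f (c * x + d))"
  by (auto simp: smooth_iff_diff_upto diff_upto_add diff_upto_mult diff_upto_const diff_upto_affine)

lemma smooth_derivative:
  assumes "smooth f"
  shows "(f has_real_derivative deriv f x) (at x)" "smooth (deriv f)"
proof -
  have "f field_differentiable (at x)" using assms unfolding smooth_def by (metis funpow_0)
  then show "(f has_real_derivative deriv f x) (at x)" by (rule field_differentiable_derivI)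
  have "(deriv ^^ k) (deriv f) field_differentiable (at x)" for k x
    using assms unfolding smooth_def by (metis funpow_swap1 funpow.simps(2) o_apply)
  then show "smooth (deriv f)" unfolding smooth_def by blast
qed

lemma smooth_antiderivative:
  assumes "smooth g" "\<And>x. (f has_real_derivative g x) (at x)"
  shows "smooth f" "deriv f = g"
proof -
  show "smooth f"
    using assms diff_upto_SucD unfolding smooth_iff_diff_upto
    by (metis diff_upto.simps(2))
  show "deriv f = g" using assms(2) by (metis DERIV_imp_deriv ext)
qed

lemma smooth_continuous: "smooth f \<Longrightarrow> continuous_on S f"
  by (meson DERIV_isCont continuous_at_imp_continuous_on smooth_derivative(1))

text \<open>Differentiation leads from $e^{-1/x}$ to products with polynomials in $1/x$. The family of these products
  is closed under differentiation, so its smoothness follows by induction.\<close>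

definition flat :: "real poly \<Rightarrow> real \<Rightarrow> real" where
  "flat P x = (if 0 < x then poly P (1 / x) * exp (- 1 / x) else 0)"

lemma poly_exp_tendsto_0: "((\<lambda>t::real. poly Q t * exp (- t)) \<longlongrightarrow> 0) at_top"
proof -
  have "((\<lambda>t::real. \<Sum>i\<le>degree Q. coeff Q i * (t ^ i / exp t)) \<longlongrightarrow> (\<Sum>i\<le>degree Q. coeff Q i * 0)) at_top"
    by (intro tendsto_intros tendsto_power_div_exp_0)
  then show ?thesis
    by (simp add: poly_altdef exp_minus sum_distrib_right divide_inverse mult.assoc)
qed

lemma flat_derivative:
  "(flat P has_real_derivative flat ([:0, 0, 1:] * (P - pderiv P)) x) (at x)"
proof -
  consider "x > 0" | "x < 0" | "x = 0" by linarith
  then show ?thesis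
  proof cases
    case 1
    have "((\<lambda>x. poly P (1 / x) * exp (- 1 / x)) has_real_derivative
            poly ([:0, 0, 1:] * (P - pderiv P)) (1 / x) * exp (- 1 / x)) (at x)"
      using 1 by (auto intro!: derivative_eq_intros simp: field_simps power2_eq_square)
    moreover have "eventually (\<lambda>y. y \<in> {0<..}) (nhds x)" using 1 by (intro eventually_nhds_in_open) auto
    then have ev: "eventually (\<lambda>y. poly P (1 / y) * exp (- 1 / y) = flat P y) (nhds x)"
      by eventually_elim (simp add: flat_def)
    ultimately have "(flat P has_real_derivative
        poly ([:0, 0, 1:] * (P - pderiv P)) (1 / x) * exp (- 1 / x)) (at x)"
      unfolding DERIV_cong_ev[OF refl ev refl] by simp
    then show ?thesis using 1 by (simp add: flat_def)
  next
    case 2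
    have "eventually (\<lambda>y. y \<in> {..<0}) (nhds x)" using 2 by (intro eventually_nhds_in_open) auto
    then have "eventually (\<lambda>y. flat P y = 0) (nhds x)"
      by eventually_elim (simp add: flat_def)
    then show ?thesis using 2 by (subst DERIV_cong_ev[OF refl _ refl]) (auto simp: flat_def)
  next
    case 3
    have "((\<lambda>y. flat P y / y) \<longlongrightarrow> 0) (at_right 0)"
    proof -
      have "filterlim (\<lambda>y::real. inverse y) at_top (at_right 0)" by (rule filterlim_inverse_at_top_right)
      from filterlim_compose[OF poly_exp_tendsto_0[of "[:0,1:] * P"] this]
      have "((\<lambda>y. poly ([:0,1:] * P) (inverse y) * exp (- inverse y)) \<longlongrightarrow> 0) (at_right 0)" by simp
      moreover have "eventually (\<lambda>y. poly ([:0,1:] * P) (inverse y) * exp (- inverse y) = flat P y / y) (at_right (0::real))"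
        unfolding eventually_at_right_field by (intro exI[of _ 1]) (auto simp: flat_def field_simps)
      ultimately show ?thesis by (rule Lim_transform_eventually)
    qed
    moreover have "((\<lambda>y. flat P y / y) \<longlongrightarrow> 0) (at_left 0)"
      by (rule Lim_transform_eventually[OF tendsto_const])
         (auto simp: eventually_at_left_field flat_def intro!: exI[of _ "-1"])
    ultimately have "((\<lambda>y. flat P y / y) \<longlongrightarrow> 0) (at 0)" by (simp add: filterlim_split_at)
    then show ?thesis using 3 unfolding has_field_derivative_iff by (simp add: flat_def)
  qed
qed

lemma smooth_flat: "smooth (flat P)"
proof -
  have "diff_upto n (flat P)" for n
    by (induction n arbitrary: P) (auto intro!: exI flat_derivative)
  then show ?thesis by (simp add: smooth_iff_diff_upto)
qed

text \<open>No normalisation is required: as \<open>n\<close> grows, $e^{-1/(ny)}$ tends to 1 for each $y > 0$, and the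
  product of the two factors tends boundedly to the indicator function of $(p,q)$.\<close>

definition plateau :: "real \<Rightarrow> real \<Rightarrow> nat \<Rightarrow> real \<Rightarrow> real" where
  "plateau p q n x = flat 1 (real n * (x - p)) * flat 1 (real n * (q - x))"

lemma flat_1_bounds: "0 \<le> flat 1 x" "flat 1 x \<le> 1"
  by (auto simp: flat_def)

lemma plateau_bounds: "0 \<le> plateau p q n x" "plateau p q n x \<le> 1"
  using flat_1_bounds by (auto simp: plateau_def intro!: mult_le_one)

lemma plateau_eq_0: "x \<notin> {p..q} \<Longrightarrow> plateau p q n x = 0"
  by (auto simp: plateau_def flat_def zero_less_mult_iff)

lemma flat_1_tendsto: "0 < y \<Longrightarrow> (\<lambda>n. flat 1 (real n * y)) \<longlonglongrightarrow> 1"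
proof -
  assume y: "0 < y"
  have "(\<lambda>n. exp (- 1 / y * inverse (real n))) \<longlonglongrightarrow> exp (- 1 / y * 0)"
    by (intro tendsto_intros lim_inverse_n)
  moreover have "eventually (\<lambda>n. exp (- 1 / y * inverse (real n)) = flat 1 (real n * y)) sequentially"
    using eventually_gt_at_top[of 0] by eventually_elim (use y in \<open>simp add: flat_def field_simps\<close>)
  ultimately show ?thesis using Lim_transform_eventually by fastforce
qed

lemma plateau_tendsto: "(\<lambda>n. plateau p q n x) \<longlonglongrightarrow> indicator {p<..<q} x"
proof (cases "x \<in> {p<..<q}")
  case True
  have "(\<lambda>n. plateau p q n x) \<longlonglongrightarrow> 1 * 1"
    unfolding plateau_def by (intro tendsto_mult flat_1_tendsto) (use True in auto)
  then show ?thesis using True by simp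
next
  case False
  then have "plateau p q n x = 0" for n by (auto simp: plateau_def flat_def zero_less_mult_iff)
  then show ?thesis using False by simp
qed

lemma smooth_plateau: "smooth (plateau p q n)"
proof -
  have "smooth (\<lambda>x. flat 1 (real n * x + (- real n * p)) * flat 1 (- real n * x + real n * q))"
    by (intro smooth_mult smooth_affine smooth_flat)
  then show ?thesis by (simp add: plateau_def[abs_def] algebra_simps)
qed

lemma test_fun_iff: "test_fun \<phi> \<longleftrightarrow> smooth \<phi> \<and> (\<exists>a b. 0 < a \<and> b < 1 \<and> (\<forall>x. x \<notin> {a..b} \<longrightarrow> \<phi> x = 0))"
  by (auto simp: test_fun_def smooth_def)

lemma test_fun_plateau: "0 < p \<Longrightarrow> q < 1 \<Longrightarrow> test_fun (plateau p q n)"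
  unfolding test_fun_iff using smooth_plateau plateau_eq_0 by blast

lemma test_fun_deriv:
  assumes "test_fun \<phi>" shows "test_fun (deriv \<phi>)"
proof -
  obtain a b where ab: "0 < a" "b < 1" "\<And>x. x \<notin> {a..b} \<Longrightarrow> \<phi> x = 0"
    using assms unfolding test_fun_iff by blast
  have "deriv \<phi> x = 0" if "x \<notin> {a..b}" for x
  proof -
    have "eventually (\<lambda>y. y \<in> - {a..b}) (nhds x)" using that by (intro eventually_nhds_in_open) auto
    then have "eventually (\<lambda>y. \<phi> y = 0) (nhds x)" by eventually_elim (use ab in auto)
    then have "deriv \<phi> x = deriv (\<lambda>y. 0) x" by (intro deriv_cong_ev) auto
    then show ?thesis by simp
  qed
  then show ?thesis using assms ab smooth_derivative(2) unfolding test_fun_iff by blast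
qed

lemma test_fun_times_integrable:
  assumes "test_fun \<phi>" "locally_integrable f"
  shows "set_integrable lebesgue {0<..<1} (\<lambda>x. f x * \<phi> x)"
proof -
  obtain a b where ab: "0 < a" "b < 1" "\<And>x. x \<notin> {a..b} \<Longrightarrow> \<phi> x = 0"
    using assms unfolding test_fun_iff by blast
  have "set_integrable lebesgue {a..b} (\<lambda>x. \<phi> x * f x)"
    by (rule continuous_times_integrable)
       (use assms ab in \<open>auto simp: test_fun_iff smooth_continuous locally_integrable_def\<close>)
  moreover have "indicator {a..b} x *\<^sub>R (\<phi> x * f x) = indicator {0<..<1} x *\<^sub>R (f x * \<phi> x)" for x
    using ab(3)[of x] ab(1,2) by (cases "x \<in> {a..b}") auto
  ultimately show ?thesis unfolding set_integrable_def by (simp only:)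
qed

lemma test_fun_limits:
  assumes "test_fun \<phi>"
  shows "((\<lambda>x. v x * \<phi> x) \<longlongrightarrow> 0) (at_right 0)" "((\<lambda>x. v x * \<phi> x) \<longlongrightarrow> 0) (at_left 1)"
proof -
  obtain a b where ab: "0 < a" "b < 1" "\<And>x. x \<notin> {a..b} \<Longrightarrow> \<phi> x = 0"
    using assms unfolding test_fun_iff by blast
  show "((\<lambda>x. v x * \<phi> x) \<longlongrightarrow> 0) (at_right 0)"
    by (rule Lim_transform_eventually[OF tendsto_const])
       (use ab in \<open>auto simp: eventually_at_right_field intro!: exI[of _ a]\<close>)
  show "((\<lambda>x. v x * \<phi> x) \<longlongrightarrow> 0) (at_left 1)"
    by (rule Lim_transform_eventually[OF tendsto_const])
       (use ab in \<open>auto simp: eventually_at_left_field intro!: exI[of _ b]\<close>)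
qed

lemma continuous_locally_integrable:
  "continuous_on {0<..<1} f \<Longrightarrow> locally_integrable f"
  unfolding locally_integrable_def
  by (intro allI impI absolutely_integrable_continuous_real)
     (rule continuous_on_subset, auto)

text \<open>The product \<open>v * \<phi>\<close> is an indefinite integral and vanishes near both end points.\<close>

lemma primitive_weak_deriv:
  assumes "primitive v g" "test_fun \<phi>"
  shows "(LINT x:{0<..<1}|lebesgue. v x * deriv \<phi> x) = - (LINT x:{0<..<1}|lebesgue. g x * \<phi> x)"
proof -
  have sm: "smooth \<phi>" "smooth (deriv \<phi>)"
    using assms(2) smooth_derivative(2) by (auto simp: test_fun_iff)
  have "primitive \<phi> (deriv \<phi>)"
    by (rule primitive_of_derivative) (use sm smooth_derivative smooth_continuous in auto)
  from primitive_mult[OF assms(1) this]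
  have p: "primitive (\<lambda>x. v x * \<phi> x) (\<lambda>x. g x * \<phi> x + v x * deriv \<phi> x)" .
  have i1: "set_integrable lebesgue {0<..<1} (\<lambda>x. g x * \<phi> x)"
    by (rule test_fun_times_integrable[OF assms(2) primitive_locally_integrable[OF assms(1)]])
  have i2: "set_integrable lebesgue {0<..<1} (\<lambda>x. v x * deriv \<phi> x)"
    by (intro test_fun_times_integrable test_fun_deriv assms(2) continuous_locally_integrable
          primitive_continuous[OF assms(1)])
  have "(LINT x:{0<..<1}|lebesgue. g x * \<phi> x + v x * deriv \<phi> x) = 0"
    by (rule primitive_integral_boundary[OF p set_integral_add(1)[OF i1 i2] test_fun_limits[OF assms(2)]])
  then show ?thesis using set_integral_add(2)[OF i1 i2] by simp
qed

section \<open>Weak derivatives are indefinite integrals\<close>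

lemma locally_integrable_lift:
  assumes "locally_integrable w" "0 < p" "q < 1"
  shows "integrable lebesgue (\<lambda>x. indicator {p<..<q} x * w x)"
proof -
  have "set_integrable lebesgue {p..q} w" using assms by (auto simp: locally_integrable_def)
  then have "set_integrable lebesgue {p<..<q} w" by (rule set_integrable_subset) auto
  then show ?thesis by (simp add: set_integrable_def)
qed

lemma integral_plateau_limit:
  assumes "locally_integrable w" "0 < p" "q < 1"
  shows "(\<lambda>n. LINT x:{0<..<1}|lebesgue. w x * plateau p q n x) \<longlonglongrightarrow> (LINT x:{p<..<q}|lebesgue. w x)"
proof -
  have pl: "integrable lebesgue (\<lambda>x. indicator {0<..<1} x * (w x * plateau p q n x))" for n
    using test_fun_times_integrable[OF test_fun_plateau[OF assms(2,3)] assms(1), of n]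
    by (simp add: set_integrable_def)
  have i: "set_integrable lebesgue {p..q} w" using assms by (auto simp: locally_integrable_def)
  have "(\<lambda>n. LINT x|lebesgue. indicator {0<..<1} x * (w x * plateau p q n x))
     \<longlonglongrightarrow> (LINT x|lebesgue. indicator {p<..<q} x * w x)"
  proof (rule integral_dominated_convergence[where w = "\<lambda>x. \<bar>indicator {p..q} x * w x\<bar>"])
    show "(\<lambda>x. indicator {p<..<q} x * w x) \<in> borel_measurable lebesgue"
      using locally_integrable_lift[OF assms] by auto
    show "(\<lambda>x. indicator {0<..<1} x * (w x * plateau p q n x)) \<in> borel_measurable lebesgue" for n
      using pl[of n] by auto
    show "integrable lebesgue (\<lambda>x. \<bar>indicator {p..q} x * w x\<bar>)"
      using i by (simp add: set_integrable_def)
    show "AE x in lebesgue. (\<lambda>n. indicator {0<..<1} x * (w x * plateau p q n x)) \<longlonglongrightarrow> indicator {p<..<q} x * w x"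
    proof (rule AE_I2)
      fix x
      have "(\<lambda>n. indicator {0<..<1} x * (w x * plateau p q n x))
          \<longlonglongrightarrow> indicator {0<..<1} x * (w x * indicator {p<..<q} x)"
        by (intro tendsto_intros plateau_tendsto)
      then show "(\<lambda>n. indicator {0<..<1} x * (w x * plateau p q n x)) \<longlonglongrightarrow> indicator {p<..<q} x * w x"
        using assms(2,3) by (cases "x \<in> {p<..<q}") auto
    qed
    show "AE x in lebesgue. norm (indicator {0<..<1} x * (w x * plateau p q n x)) \<le> \<bar>indicator {p..q} x * w x\<bar>" for n
    proof (rule AE_I2)
      fix x
      show "norm (indicator {0<..<1} x * (w x * plateau p q n x)) \<le> \<bar>indicator {p..q} x * w x\<bar>"
        using plateau_bounds[of p q n x] plateau_eq_0[of x p q n]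
        by (cases "x \<in> {p..q}") (auto simp: abs_mult indicator_def mult_left_le)
    qed
  qed
  then show ?thesis by (simp add: set_lebesgue_integral_def)
qed

text \<open>The Borel sets on which \<open>g\<close> has integral 0 form a Dynkin system that contains the intervals, hence
  they are all Borel sets. In particular the sets where a Borel version of \<open>g\<close> is positive or negative
  are null sets.\<close>

lemma AE_eq_0_of_interval_integrals:
  fixes g :: "real \<Rightarrow> real"
  assumes g: "integrable lebesgue g"
    and zero: "\<And>p q. (LINT x:{p<..<q}|lebesgue. g x) = 0" and tot: "(LINT x|lebesgue. g x) = 0"
  shows "AE x in lebesgue. g x = 0"
proof -
  have si: "set_integrable lebesgue B g" if "B \<in> sets lebesgue" for B
    using g that integrable_mult_indicator[of B lebesgue g] by (simp add: set_integrable_def)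
  have borel: "(LINT x:B|lebesgue. g x) = 0" if "B \<in> sets borel" for B
  proof -
    have gen: "sets (borel :: real measure) = sigma_sets UNIV (range (\<lambda>(a, b). {a <..< b :: real}))"
      unfolding borel_eq_box box_real by (rule sets_measure_of) simp
    have stable: "Int_stable (range (\<lambda>(a, b). {a <..< b :: real}))"
    proof (rule Int_stableI)
      fix A B :: "real set" assume "A \<in> range (\<lambda>(a, b). {a <..< b})" "B \<in> range (\<lambda>(a, b). {a <..< b})"
      then obtain a b c d where "A = {a<..<b}" "B = {c<..<d}" by auto
      then have "A \<inter> B = {max a c<..<min b d}" by auto
      then show "A \<inter> B \<in> range (\<lambda>(a, b). {a <..< b})" by auto
    qed
    show ?thesis
    proof (rule sigma_sets_induct_disjoint[OF stable _ that[unfolded gen]])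
      show "(LINT x:{}|lebesgue. g x) = 0" by (simp add: set_lebesgue_integral_def)
      show "(LINT x:A|lebesgue. g x) = 0" if "A \<in> range (\<lambda>(a, b). {a <..< b})" for A
        using that zero by auto
    next
      fix A :: "real set"
      assume A: "A \<in> sigma_sets UNIV (range (\<lambda>(a, b). {a <..< b}))" and IH: "(LINT x:A|lebesgue. g x) = 0"
      then have A: "A \<in> sets lebesgue" using gen by auto
      have "(LINT x:A \<union> (UNIV - A)|lebesgue. g x) = (LINT x:A|lebesgue. g x) + (LINT x:UNIV - A|lebesgue. g x)"
        by (rule set_integral_Un) (use A in \<open>auto intro!: si\<close>)
      then show "(LINT x:UNIV - A|lebesgue. g x) = 0" using IH tot by (simp add: set_lebesgue_integral_def)
    next
      fix A :: "nat \<Rightarrow> real set"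
      assume d: "disjoint_family A" and A: "range A \<subseteq> sigma_sets UNIV (range (\<lambda>(a, b). {a <..< b}))"
        and IH: "\<And>i. (LINT x:A i|lebesgue. g x) = 0"
      have "A i \<in> sets borel" for i unfolding gen using A by blast
      then have Am: "\<And>i. A i \<in> sets lebesgue" by simp
      then have "set_integrable lebesgue (\<Union>i. A i) g" by (intro si) auto
      then have "(LINT x:(\<Union>i. A i)|lebesgue. g x) = (\<Sum>i. (LINT x:(A i)|lebesgue. g x))"
        using d Am by (intro lebesgue_integral_countable_add) (auto simp: disjoint_family_on_def)
      then show "(LINT x:(\<Union>i. A i)|lebesgue. g x) = 0" using IH by simp
    qed simp
  qed
  obtain h where h: "h \<in> borel_measurable lborel" "AE x in lborel. g x = h x"
    using completion_ex_borel_measurable_real[of g lborel] g by auto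
  then have hm: "h \<in> borel_measurable lebesgue" "h \<in> borel_measurable borel" 
    by (auto simp: measurable_completion)
  have ae: "AE x in lebesgue. g x = h x" using h(2) AE_completion by auto
  have hi: "integrable lebesgue h"
    using integrable_cong_AE[OF _ hm(1) ae] g by auto
  have hz: "(LINT x:B|lebesgue. h x) = 0" if B: "B \<in> sets borel" for B
  proof -
    have "(LINT x:B|lebesgue. h x) = (LINT x:B|lebesgue. g x)"
      by (rule set_lebesgue_integral_cong_AE) (use B hm g ae in auto)
    then show ?thesis using borel[OF B] by simp
  qed
  have "{x. h x > 0} \<in> null_sets lebesgue"
  proof (rule null_if_pos_func_has_zero_int[OF hi])
    have "{x. h x > 0} \<in> sets borel" using hm(2) by measurable
    then show "{x. h x > 0} \<in> sets lebesgue" "(LINT x:{x. h x > 0}|lebesgue. h x) = 0"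
      using hz by auto
  qed auto
  moreover have "{x. - h x > 0} \<in> null_sets lebesgue"
  proof (rule null_if_pos_func_has_zero_int[of lebesgue "\<lambda>x. - h x"])
    have "{x. - h x > 0} \<in> sets borel" using hm(2) by measurable
    then show "{x. - h x > 0} \<in> sets lebesgue" "(LINT x:{x. - h x > 0}|lebesgue. - h x) = 0"
      using hz by (auto simp: set_lebesgue_integral_def)
  qed (use hi in auto)
  ultimately have "AE x in lebesgue. x \<notin> {x. h x > 0}" "AE x in lebesgue. x \<notin> {x. - h x > 0}"
    by (blast intro: AE_not_in)+
  with ae show ?thesis by eventually_elim auto
qed

lemma unit_interval_AE_iff:
  "(AE x in lebesgue_on {0<..<1::real}. P x) \<longleftrightarrow> (AE x in lebesgue. x \<in> {0<..<1} \<longrightarrow> P x)"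
  by (subst AE_restrict_space_iff) auto

text \<open>Testing with plateaus shows that \<open>w\<close> has integral 0 over every interval with closure in $(0,1)$.\<close>

lemma fundamental_lemma:
  assumes w: "locally_integrable w"
    and z: "\<And>\<phi>. test_fun \<phi> \<Longrightarrow> (LINT x:{0<..<1}|lebesgue. w x * \<phi> x) = 0"
  shows "AE x in lebesgue_on {0<..<1}. w x = 0"
proof -
  have int0: "(LINT x:{p<..<q}|lebesgue. w x) = 0" if "0 < p" "q < 1" for p q
    using integral_plateau_limit[OF w that] z[OF test_fun_plateau[OF that]]
    by (simp add: LIMSEQ_const_iff)
  let ?J = "\<lambda>n. {shrink n <..< 1 - shrink n}"
  have "AE x in lebesgue. indicator (?J n) x * w x = 0" for n
  proof (rule AE_eq_0_of_interval_integrals)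
    have J: "0 < shrink n" "1 - shrink n < 1" by simp_all
    show "integrable lebesgue (\<lambda>x. indicator (?J n) x * w x)"
      by (rule locally_integrable_lift[OF w J])
    show "(LINT x|lebesgue. indicator (?J n) x * w x) = 0"
      using int0[OF J] by (simp add: set_lebesgue_integral_def)
    fix p q :: real
    let ?e = "shrink n"
    have "(LINT x:{p<..<q}|lebesgue. indicator (?J n) x * w x) = (LINT x:{max p ?e<..<min q (1 - ?e)}|lebesgue. w x)"
      unfolding set_lebesgue_integral_def
      by (rule Bochner_Integration.integral_cong) (auto simp: indicator_def)
    also have "\<dots> = 0" using J by (intro int0) (simp_all only: less_max_iff_disj min_less_iff_disj simp_thms)
    finally show "(LINT x:{p<..<q}|lebesgue. indicator (?J n) x * w x) = 0" .
  qed
  then have "AE x in lebesgue. \<forall>n. indicator (?J n) x * w x = 0" by (subst AE_all_countable) blast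
  then have "AE x in lebesgue. x \<in> {0<..<1} \<longrightarrow> w x = 0"
  proof (eventually_elim, intro impI)
    fix x :: real assume *: "\<forall>n. indicator (?J n) x * w x = 0" and x: "x \<in> {0<..<1}"
    then have "0 < min x (1 - x)" by auto
    then obtain n where n: "inverse (real (Suc n)) < min x (1 - x)" using reals_Archimedean by blast
    have "shrink n < inverse (real (Suc n))" by (simp add: field_simps)
    then have "shrink n < x" "x < 1 - shrink n"
      using n by linarith+
    then have "x \<in> ?J n" by auto
    then show "w x = 0" using *[rule_format, of n] by simp
  qed
  then show ?thesis by (simp add: unit_interval_AE_iff)
qed

lemma locally_integrable_combine:
  assumes "locally_integrable f" "locally_integrable g"
  shows "locally_integrable (\<lambda>x. f x + c * g x)"
  unfolding locally_integrable_def
proof (intro allI impI)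
  fix a b :: real assume "0 < a" "b < 1"
  then have "set_integrable lebesgue {a..b} f" "set_integrable lebesgue {a..b} g"
    using assms by (simp_all add: locally_integrable_def)
  then show "set_integrable lebesgue {a..b} (\<lambda>x. f x + c * g x)"
    by (intro set_integral_add(1) set_integrable_mult_right)
qed

lemma has_weak_derivD:
  assumes "has_weak_deriv j v g"
  shows "locally_integrable v" "locally_integrable g"
    and "test_fun \<phi> \<Longrightarrow> (LINT x:{0<..<1}|lebesgue. v x * (deriv ^^ j) \<phi> x) =
           (-1) ^ j * (LINT x:{0<..<1}|lebesgue. g x * \<phi> x)"
  using assms unfolding has_weak_deriv_def by blast+

lemma weak_deriv_0_AE:
  assumes "has_weak_deriv 0 v g"
  shows "AE x in lebesgue_on {0<..<1}. g x = v x"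
proof -
  note l = has_weak_derivD(1,2)[OF assms]
  have "AE x in lebesgue_on {0<..<1}. v x + (-1) * g x = 0"
  proof (rule fundamental_lemma[OF locally_integrable_combine[OF l]])
    fix \<phi> assume t: "test_fun \<phi>"
    have "(LINT x:{0<..<1}|lebesgue. v x * \<phi> x) = (LINT x:{0<..<1}|lebesgue. g x * \<phi> x)"
      using has_weak_derivD(3)[OF assms t] by simp
    then show "(LINT x:{0<..<1}|lebesgue. (v x + (-1) * g x) * \<phi> x) = 0"
      using set_integral_diff(2)[OF test_fun_times_integrable[OF t l(1)] test_fun_times_integrable[OF t l(2)]]
      by (simp add: algebra_simps)
  qed
  then show ?thesis by eventually_elim simp
qed

lemma weak_deriv_unique:
  assumes "has_weak_deriv j v g" "has_weak_deriv j v h"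
  shows "AE x in lebesgue_on {0<..<1}. g x = h x"
proof -
  have "(LINT x:{0<..<1}|lebesgue. h x * \<phi> x) = (LINT x:{0<..<1}|lebesgue. g x * \<phi> x)"
    if "test_fun \<phi>" for \<phi>
  proof -
    have "(-1) ^ j * (LINT x:{0<..<1}|lebesgue. h x * \<phi> x) = (-1) ^ j * (LINT x:{0<..<1}|lebesgue. g x * \<phi> x)"
      using has_weak_derivD(3)[OF assms(1) that] has_weak_derivD(3)[OF assms(2) that] by simp
    then show ?thesis by simp
  qed
  then have "has_weak_deriv 0 h g"
    using has_weak_derivD(2)[OF assms(1)] has_weak_derivD(2)[OF assms(2)]
    unfolding has_weak_deriv_def by simp
  then show ?thesis by (rule weak_deriv_0_AE)
qed

lemma has_weak_deriv_weak_deriv: "has_weak_deriv j v g \<Longrightarrow> has_weak_deriv j v (weak_deriv j v)"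
  unfolding weak_deriv_def by (rule someI[where P = "has_weak_deriv j v"])

lemma primitive_exists:
  assumes g: "locally_integrable g"
  shows "\<exists>V. primitive V g"
proof -
  define V where "V = (\<lambda>x. (LINT y:{1/2..x}|lebesgue. g y) - (LINT y:{x..1/2}|lebesgue. g y))"
  have si: "set_integrable lebesgue {p..q} g" if "0 < p" "q < 1" for p q
    using g that by (auto simp: locally_integrable_def)
  have comb: "(LINT y:{p..r}|lebesgue. g y) = (LINT y:{p..q}|lebesgue. g y) + (LINT y:{q..r}|lebesgue. g y)"
    if "0 < p" "p \<le> q" "q \<le> r" "r < 1" for p q r
  proof -
    have *: "(LINT y:{a..b}|lebesgue. g y) = integral {a..b} g" if "0 < a" "b < 1" for a b
      using si[OF that] by (rule set_lebesgue_integral_eq_integral(2))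
    have "g integrable_on {p..r}" using si[of p r] that set_lebesgue_integral_eq_integral(1) by auto
    then show ?thesis using * that Henstock_Kurzweil_Integration.integral_combine[of p q r g] by simp
  qed
  have pt: "(LINT y:{p..p}|lebesgue. g y) = 0" if "0 < p" "p < 1" for p using comb[of p p p] that by simp
  have em: "(LINT y:{p..q}|lebesgue. g y) = 0" if "q \<le> p" "0 < q" "p < 1" for p q
    using that pt[of p] by (cases "p = q") (auto simp: set_lebesgue_integral_def)
  have "primitive V g"
    unfolding primitive_def
  proof (intro allI impI conjI si)
    fix p q :: real assume pq: "0 < p" "p \<le> q" "q < 1"
    consider "1/2 \<le> p" | "q \<le> 1/2" | "p < 1/2" "1/2 < q" by linarith
    then show "V q - V p = (LINT x:{p..q}|lebesgue. g x)"
    proof cases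
      case 1
      then have "(LINT y:{q..1/2}|lebesgue. g y) = 0" "(LINT y:{p..1/2}|lebesgue. g y) = 0"
        using pq by (auto intro!: em)
      then show ?thesis using comb[of "1/2" p q] pq 1 unfolding V_def by linarith
    next
      case 2
      then have "(LINT y:{1/2..q}|lebesgue. g y) = 0" "(LINT y:{1/2..p}|lebesgue. g y) = 0"
        using pq by (auto intro!: em)
      then show ?thesis using comb[of p q "1/2"] pq 2 unfolding V_def by linarith
    next
      case 3
      then have "(LINT y:{q..1/2}|lebesgue. g y) = 0" "(LINT y:{1/2..p}|lebesgue. g y) = 0"
        using pq by (intro em; simp)+
      then show ?thesis using comb[of p "1/2" q] pq 3 unfolding V_def by linarith
    qed
  qed auto
  then show ?thesis by blast
qed

text \<open>The integral from the left vanishes to the left of the support, and to the right of it because the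
  total integral is 0.\<close>

lemma test_fun_antiderivative:
  assumes t: "test_fun \<theta>" and z: "(LINT x:{0<..<1}|lebesgue. \<theta> x) = 0"
  shows "\<exists>\<Phi>. test_fun \<Phi> \<and> deriv \<Phi> = \<theta>"
proof -
  obtain a b where ab: "0 < a" "b < 1" "\<And>x. x \<notin> {a..b} \<Longrightarrow> \<theta> x = 0" and sm: "smooth \<theta>"
    using t unfolding test_fun_iff by blast
  define \<Phi> where "\<Phi> x = integral {-1..x} \<theta>" for x
  have \<Phi>0: "\<Phi> x = 0" if "x < a" for x
  proof -
    have "\<Phi> x = integral {-1..x} (\<lambda>_. 0 :: real)" unfolding \<Phi>_def
      by (rule Henstock_Kurzweil_Integration.integral_cong) (use ab that in auto)
    then show ?thesis by simp
  qed
  have D: "(\<Phi> has_real_derivative \<theta> x) (at x)" for x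
  proof (cases "x < a")
    case True
    have "eventually (\<lambda>y. y \<in> {..<a}) (nhds x)" using True by (intro eventually_nhds_in_open) auto
    then have "eventually (\<lambda>y. \<Phi> y = 0) (nhds x)" by eventually_elim (use \<Phi>0 in auto)
    then have "(\<Phi> has_real_derivative 0) (at x)" by (subst DERIV_cong_ev[OF refl _ refl]) auto
    then show ?thesis using ab(3)[of x] True by simp
  next
    case False
    have "(\<Phi> has_real_derivative \<theta> x) (at x within {-1..x+1})"
      unfolding \<Phi>_def by (rule integral_has_real_derivative) (use False ab sm smooth_continuous in auto)
    moreover have "at x within {-1..x+1} = at x"
      by (rule at_within_interior) (use False ab in auto)
    ultimately show ?thesis by simp
  qed
  have ti: "set_integrable lebesgue {0<..<1} \<theta>"
    using test_fun_times_integrable[OF t continuous_locally_integrable[of "\<lambda>_. 1"]] by simp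
  have "\<Phi> x = 0" if x: "x > b" for x
  proof -
    have "(\<theta> has_integral 0) {0<..<1}"
      using has_integral_set_lebesgue[OF ti] z by simp
    then have "(\<theta> has_integral 0) UNIV"
      by (rule has_integral_on_superset) (use ab in auto)
    moreover have "(\<theta> has_integral \<Phi> x) {-1..x}" unfolding \<Phi>_def
      by (intro integrable_integral integrable_continuous_real smooth_continuous sm)
    then have "(\<theta> has_integral \<Phi> x) UNIV"
      by (rule has_integral_on_superset) (use ab x in auto)
    ultimately show ?thesis using has_integral_unique by blast
  qed
  then have "\<And>x. x \<notin> {a..b} \<Longrightarrow> \<Phi> x = 0" using \<Phi>0 by force
  moreover have "smooth \<Phi>" "deriv \<Phi> = \<theta>" using smooth_antiderivative[OF sm D] by auto
  ultimately show ?thesis unfolding test_fun_iff using ab by blast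
qed

text \<open>Fix a test function \<open>\<psi>\<close> with nonzero integral. Every test function \<open>\<phi>\<close> is a multiple of
  \<open>\<psi>\<close> plus the derivative of a test function, so \<open>w\<close> acts on \<open>\<phi>\<close> like the constant by which it
  acts on \<open>\<psi>\<close>.\<close>

lemma du_Bois_Reymond:
  assumes w: "locally_integrable w"
    and z: "\<And>\<phi>. test_fun \<phi> \<Longrightarrow> (LINT x:{0<..<1}|lebesgue. w x * deriv \<phi> x) = 0"
  shows "\<exists>c. AE x in lebesgue_on {0<..<1}. w x = c"
proof -
  let ?I = "\<lambda>f. (LINT x:{0<..<1}|lebesgue. f x)"
  have one: "locally_integrable (\<lambda>_. 1)" by (rule continuous_locally_integrable) auto
  have I1: "set_integrable lebesgue {0<..<1} \<phi>" if "test_fun \<phi>" for \<phi>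
    using test_fun_times_integrable[OF that one] by simp
  have "(\<lambda>n. ?I (plateau (1/4) (3/4) n)) \<longlonglongrightarrow> 1/2"
    using integral_plateau_limit[OF one, of "1/4" "3/4"] by (simp add: set_lebesgue_integral_def)
  then have "eventually (\<lambda>n. ?I (plateau (1/4) (3/4) n) > 0) sequentially"
    by (rule order_tendstoD) simp
  then obtain n where n: "?I (plateau (1/4) (3/4) n) > 0"
    by (auto simp: eventually_sequentially)
  define \<psi> where "\<psi> = plateau (1/4) (3/4) n"
  have t\<psi>: "test_fun \<psi>" unfolding \<psi>_def by (rule test_fun_plateau) auto
  have \<psi>0: "?I \<psi> \<noteq> 0" using n by (simp add: \<psi>_def less_imp_neq)
  define c where "c = ?I (\<lambda>x. w x * \<psi> x) / ?I \<psi>"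
  have "AE x in lebesgue_on {0<..<1}. w x + (- c) * 1 = 0"
  proof (rule fundamental_lemma[OF locally_integrable_combine[OF w one]])
    fix \<phi> assume t: "test_fun \<phi>"
    define k where "k = ?I \<phi> / ?I \<psi>"
    define \<theta> where "\<theta> = (\<lambda>x. \<phi> x + (- k) * \<psi> x)"
    obtain a b a' b' where ab: "0 < a" "b < 1" "\<And>x. x \<notin> {a..b} \<Longrightarrow> \<phi> x = 0"
        "0 < a'" "b' < 1" "\<And>x. x \<notin> {a'..b'} \<Longrightarrow> \<psi> x = 0"
      using t t\<psi> unfolding test_fun_iff by blast
    have "smooth \<theta>" unfolding \<theta>_def
      by (intro smooth_add smooth_mult smooth_const) (use t t\<psi> in \<open>auto simp: test_fun_iff\<close>)
    moreover have "\<theta> x = 0" if "x \<notin> {min a a'..max b b'}" for x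
    proof -
      have "x \<notin> {a..b}" "x \<notin> {a'..b'}" using that by auto
      then show ?thesis using ab(3)[of x] ab(6)[of x] by (simp add: \<theta>_def)
    qed
    ultimately have t\<theta>: "test_fun \<theta>" unfolding test_fun_iff using ab
      by (intro conjI exI[of _ "min a a'"] exI[of _ "max b b'"]) auto
    have "?I \<theta> = ?I \<phi> + (- k) * ?I \<psi>" unfolding \<theta>_def
      using set_integral_add(2)[OF I1[OF t] set_integrable_mult_right[OF I1[OF t\<psi>]], of "-k"] I1[OF t\<psi>]
      by (simp only: set_integral_mult_right)
    then have "?I \<theta> = 0" using \<psi>0 by (simp add: k_def)
    then obtain \<Phi> where \<Phi>: "test_fun \<Phi>" "deriv \<Phi> = \<theta>" using test_fun_antiderivative[OF t\<theta>] by blast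
    have "?I (\<lambda>x. w x * \<theta> x) = 0" using z[OF \<Phi>(1)] \<Phi>(2) by simp
    moreover have "?I (\<lambda>x. w x * \<theta> x) = ?I (\<lambda>x. w x * \<phi> x) - k * ?I (\<lambda>x. w x * \<psi> x)"
    proof -
      have "?I (\<lambda>x. w x * \<phi> x - k * (w x * \<psi> x)) = ?I (\<lambda>x. w x * \<phi> x) - ?I (\<lambda>x. k * (w x * \<psi> x))"
        by (rule set_integral_diff(2)[OF test_fun_times_integrable[OF t w]
              set_integrable_mult_right[OF test_fun_times_integrable[OF t\<psi> w]]])
      then show ?thesis by (simp add: \<theta>_def algebra_simps)
    qed
    moreover have "k * ?I (\<lambda>x. w x * \<psi> x) = c * ?I \<phi>" by (simp add: k_def c_def)
    moreover have "?I (\<lambda>x. (w x + (- c) * 1) * \<phi> x) = ?I (\<lambda>x. w x * \<phi> x) - c * ?I \<phi>"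
    proof -
      have "?I (\<lambda>x. w x * \<phi> x - c * \<phi> x) = ?I (\<lambda>x. w x * \<phi> x) - ?I (\<lambda>x. c * \<phi> x)"
        by (rule set_integral_diff(2)[OF test_fun_times_integrable[OF t w]
              set_integrable_mult_right[OF I1[OF t]]])
      then show ?thesis by (simp add: algebra_simps)
    qed
    ultimately show "?I (\<lambda>x. (w x + (- c) * 1) * \<phi> x) = 0" by simp
  qed
  then have "AE x in lebesgue_on {0<..<1}. w x = c" by eventually_elim simp
  then show ?thesis by blast
qed

text \<open>Any indefinite integral of \<open>g\<close> has the same weak derivative as \<open>v\<close>, so the difference of the two is
  constant almost everywhere.\<close>

lemma weak_deriv_primitive:
  assumes "has_weak_deriv 1 v g"
  shows "\<exists>V. primitive V g \<and> (AE x in lebesgue_on {0<..<1}. v x = V x)"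
proof -
  note l = has_weak_derivD(1,2)[OF assms]
  obtain V where V: "primitive V g" using primitive_exists[OF l(2)] by blast
  have lV: "locally_integrable V" by (rule continuous_locally_integrable[OF primitive_continuous[OF V]])
  have "\<exists>c. AE x in lebesgue_on {0<..<1}. v x + (-1) * V x = c"
  proof (rule du_Bois_Reymond[OF locally_integrable_combine[OF l(1) lV]])
    fix \<phi> assume t: "test_fun \<phi>"
    have "(LINT x:{0<..<1}|lebesgue. v x * deriv \<phi> x) = - (LINT x:{0<..<1}|lebesgue. g x * \<phi> x)"
      using has_weak_derivD(3)[OF assms t] by simp
    then show "(LINT x:{0<..<1}|lebesgue. (v x + (-1) * V x) * deriv \<phi> x) = 0"
      using primitive_weak_deriv[OF V t]
       set_integral_diff(2)[OF test_fun_times_integrable[OF test_fun_deriv[OF t] l(1)] test_fun_times_integrable[OF test_fun_deriv[OF t] lV]]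
      by (simp add: algebra_simps)
  qed
  then obtain c where c: "AE x in lebesgue_on {0<..<1}. v x + (-1) * V x = c" ..
  then have "AE x in lebesgue_on {0<..<1}. v x = V x + c" by eventually_elim simp
  moreover have "primitive (\<lambda>x. V x + c) g" using primitive_add[OF V primitive_const[of c]] by simp
  ultimately show ?thesis by blast
qed

section \<open>Vanishing boundary terms\<close>

abbreviation U01 :: "real measure" where "U01 \<equiv> lebesgue_on {0<..<1}"

lemma finite_measure_U01: "finite_measure U01"
  by (rule finite_measure_lebesgue_on) auto

lemma set_integrable_U01: "set_integrable lebesgue {0<..<1} f \<longleftrightarrow> integrable U01 (f :: real \<Rightarrow> real)"
  unfolding set_integrable_def by (subst integrable_restrict_space) auto

lemma set_integral_U01: "(LINT x:{0<..<1}|lebesgue. f x) = (LINT x|U01. (f x :: real))"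
  unfolding set_lebesgue_integral_def by (subst integral_restrict_space) auto

lemma set_measurable_U01: "set_borel_measurable lebesgue {0<..<1} (f :: real \<Rightarrow> real) \<longleftrightarrow> f \<in> borel_measurable U01"
  unfolding set_borel_measurable_def by (subst borel_measurable_restrict_space_iff) auto

lemma continuous_measurable_U01: "continuous_on {0<..<1} f \<Longrightarrow> f \<in> borel_measurable U01"
  by (rule continuous_imp_measurable_on_sets_lebesgue) auto

lemma ident_measurable_U01: "(\<lambda>x. x) \<in> borel_measurable U01"
  by (rule continuous_measurable_U01) auto

lemma borel_measurable_U01: "f \<in> borel_measurable borel \<Longrightarrow> f \<in> borel_measurable U01"
  using measurable_compose[OF ident_measurable_U01] by auto

lemma integrable_U01_bound:
  assumes "integrable U01 g" "f \<in> borel_measurable U01" "\<And>x. 0 < x \<Longrightarrow> x < 1 \<Longrightarrow> \<bar>f x\<bar> \<le> \<bar>g x :: real\<bar>"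
  shows "integrable U01 (f :: real \<Rightarrow> real)"
  by (rule Bochner_Integration.integrable_bound[OF assms(1,2)]) (use assms(3) in \<open>auto intro!: AE_I2\<close>)

lemma integral_U01_cong:
  "(\<And>x. 0 < x \<Longrightarrow> x < 1 \<Longrightarrow> f x = (g x :: real)) \<Longrightarrow> (LINT x|U01. f x) = (LINT x|U01. g x)"
  by (rule Bochner_Integration.integral_cong) auto

lemma integrable_U01_cong:
  "(\<And>x. 0 < x \<Longrightarrow> x < 1 \<Longrightarrow> f x = (g x :: real)) \<Longrightarrow> integrable U01 f \<longleftrightarrow> integrable U01 g"
  by (rule Bochner_Integration.integrable_cong) auto

lemma primitive_bounded:
  assumes p: "primitive w g" and i: "integrable U01 g"
  shows "\<exists>B. \<forall>x. 0 < x \<longrightarrow> x < 1 \<longrightarrow> \<bar>w x\<bar> \<le> B"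
proof -
  let ?C = "LINT x|U01. \<bar>g x\<bar>"
  have *: "\<bar>w q - w p\<bar> \<le> ?C" if "0 < p" "p \<le> q" "q < 1" for p q
  proof -
    have gi: "set_integrable lebesgue {p..q} g" by (rule primitiveD(1)[OF p that])
    have "\<bar>LINT x:{p..q}|lebesgue. g x\<bar> \<le> (LINT x:{p..q}|lebesgue. \<bar>g x\<bar>)"
      using set_integral_norm_bound[OF gi] by simp
    also have "\<dots> \<le> (LINT x:{0<..<1}|lebesgue. \<bar>g x\<bar>)"
      unfolding set_lebesgue_integral_def
    proof (rule integral_mono)
      show "integrable lebesgue (\<lambda>x. indicator {p..q} x *\<^sub>R \<bar>g x\<bar>)"
        using set_integrable_abs[OF gi] by (simp add: set_integrable_def)
      have "set_integrable lebesgue {0<..<1} g" using i by (simp add: set_integrable_U01)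
      then show "integrable lebesgue (\<lambda>x. indicator {0<..<1} x *\<^sub>R \<bar>g x\<bar>)"
        using set_integrable_abs by (fastforce simp: set_integrable_def)
    qed (use that in \<open>auto simp: indicator_def\<close>)
    finally show ?thesis using primitiveD(2)[OF p that] by (simp add: set_integral_U01)
  qed
  have "\<bar>w x\<bar> \<le> \<bar>w (1/2)\<bar> + ?C" if "0 < x" "x < 1" for x
    using *[of x "1/2"] *[of "1/2" x] that by (cases "x \<le> 1/2") auto
  then show ?thesis by blast
qed

text \<open>An indefinite integral \<open>w\<close> of an integrable function is bounded and has limits at the end points. If
  $w(x)/(x(1-x))$ is integrable, these limits can only be 0. To treat both end points at once,
  multiply by $(x(1-x))^\varepsilon$: the product vanishes at the boundary, the derivative of the factor
  is at most $\varepsilon/(x(1-x))$ and contributes $O(\varepsilon)$, and the factor tends to 1.\<close>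

lemma integral_derivative_eq_0:
  assumes p: "primitive w g" and g: "integrable U01 g" and w: "integrable U01 (\<lambda>x. w x / (x * (1 - x)))"
  shows "(LINT x|U01. g x) = 0"
proof -
  obtain B where B: "\<And>x. 0 < x \<Longrightarrow> x < 1 \<Longrightarrow> \<bar>w x\<bar> \<le> B" using primitive_bounded[OF p g] by blast
  define cut where "cut n x = (x * (1 - x)) powr (1 / real (Suc n))" for n and x :: real
  define cut' where "cut' n x = 1 / real (Suc n) * (x * (1 - x)) powr (1 / real (Suc n) - 1) * (1 - 2 * x)" for n and x :: real
  have pos: "0 < x * (1 - x)" "x * (1 - x) \<le> 1" if "0 < x" "x < 1" for x :: real
    using that by (auto intro: mult_le_one)
  have cut_01: "0 \<le> cut n x" "cut n x \<le> 1" if "0 < x" "x < 1" for n x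
    using pos[OF that] by (auto simp: cut_def intro: powr_le1)
  have D: "(cut n has_real_derivative cut' n x) (at x)" if "0 < x" "x < 1" for n x
    unfolding cut_def cut'_def using pos(1)[OF that] by (auto intro!: derivative_eq_intros simp: algebra_simps)
  have cont: "continuous_on {0<..<1} (cut n)" "continuous_on {0<..<1} (cut' n)" for n
    unfolding cut_def cut'_def using pos by (auto intro!: continuous_intros)
  have cut'_le: "\<bar>cut' n x\<bar> \<le> 1 / real (Suc n) * (1 / (x * (1 - x)))" if x: "0 < x" "x < 1" for n x
  proof -
    have "(x * (1 - x)) powr (1 / real (Suc n) - 1) \<le> (x * (1 - x)) powr (- 1)"
      by (rule powr_mono') (use pos[OF x] in auto)
    also have "\<dots> = 1 / (x * (1 - x))" using pos[OF x] by (simp add: powr_minus_divide)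
    finally have "(x * (1 - x)) powr (1 / real (Suc n) - 1) * \<bar>1 - 2 * x\<bar> \<le> 1 / (x * (1 - x)) * 1"
      using x pos[OF x] by (intro mult_mono) auto
    then have "1 / real (Suc n) * ((x * (1 - x)) powr (1 / real (Suc n) - 1) * \<bar>1 - 2 * x\<bar>)
        \<le> 1 / real (Suc n) * (1 / (x * (1 - x)))"
      by (intro mult_left_mono) auto
    then show ?thesis by (simp add: cut'_def abs_mult)
  qed
  have wc: "w \<in> borel_measurable U01" by (rule continuous_measurable_U01[OF primitive_continuous[OF p]])
  have cut_meas: "cut n \<in> borel_measurable U01" "cut' n \<in> borel_measurable U01" for n
    by (intro continuous_measurable_U01 cont)+
  have i1: "integrable U01 (\<lambda>x. g x * cut n x)" for n
    by (rule integrable_U01_bound[OF g])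
       (use g cut_meas cut_01 in \<open>auto simp: abs_mult intro!: mult_left_le\<close>)
  have wb: "\<bar>w x * cut' n x\<bar> \<le> 1 / real (Suc n) * \<bar>w x / (x * (1 - x))\<bar>" if "0 < x" "x < 1" for n x
    using mult_left_mono[OF cut'_le[OF that, of n], of "\<bar>w x\<bar>"] pos[OF that] that by (simp add: abs_mult abs_divide)
  have i2: "integrable U01 (\<lambda>x. w x * cut' n x)" for n
    by (rule integrable_U01_bound[where g = "\<lambda>x. 1 / real (Suc n) * \<bar>w x / (x * (1 - x))\<bar>"])
       (use integrable_mult_right[OF integrable_abs[OF w], of "1 / real (Suc n)"] wb wc cut_meas
        in \<open>auto intro!: borel_measurable_times order_trans[OF wb] simp del: of_nat_Suc\<close>)
  have eq: "(LINT x|U01. g x * cut n x) = - (LINT x|U01. w x * cut' n x)" for n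
  proof -
    have "primitive (cut n) (cut' n)" by (rule primitive_of_derivative) (use D cont in auto)
    from primitive_mult[OF p this]
    have pr: "primitive (\<lambda>x. w x * cut n x) (\<lambda>x. g x * cut n x + w x * cut' n x)" .
    have lim: "((\<lambda>x. w x * cut n x) \<longlongrightarrow> 0) (at c within {0<..<1})" if "c = 0 \<or> c = 1" for c
    proof (rule Lim_null_comparison)
      show "eventually (\<lambda>x. norm (w x * cut n x) \<le> B * cut n x) (at c within {0<..<1})"
        unfolding eventually_at_filter
        by (rule always_eventually) (use B cut_01 in \<open>auto simp: abs_mult intro!: mult_right_mono\<close>)
      have "((\<lambda>x. x * (1 - x)) \<longlongrightarrow> c * (1 - c)) (at c within {0<..<1})" by (intro tendsto_intros)
      then have "((\<lambda>x. x * (1 - x)) \<longlongrightarrow> 0) (at c within {0<..<1})" using that by auto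
      then have "((\<lambda>x. (x * (1 - x)) powr (1 / real (Suc n))) \<longlongrightarrow> 0 powr (1 / real (Suc n))) (at c within {0<..<1})"
        by (rule tendsto_powr2)
           (auto intro!: tendsto_const simp: eventually_at_filter)
      then have "((\<lambda>x. B * cut n x) \<longlongrightarrow> B * 0) (at c within {0<..<1})"
        unfolding cut_def by (intro tendsto_intros) simp
      then show "((\<lambda>x. B * cut n x) \<longlongrightarrow> 0) (at c within {0<..<1})" by simp
    qed
    have "(LINT x:{0<..<1}|lebesgue. g x * cut n x + w x * cut' n x) = 0"
    proof (rule primitive_integral_boundary[OF pr])
      show "set_integrable lebesgue {0<..<1} (\<lambda>x. g x * cut n x + w x * cut' n x)"
        unfolding set_integrable_U01 by (intro Bochner_Integration.integrable_add i1 i2)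
      have "at (0::real) within {0<..<1} = at_right 0" by (rule at_within_nhd[of _ "{-1<..<1}"]) auto
      then show "((\<lambda>x. w x * cut n x) \<longlongrightarrow> 0) (at_right 0)" using lim[of 0] by simp
      have "at (1::real) within {0<..<1} = at_left 1" by (rule at_within_nhd[of _ "{0<..<2}"]) auto
      then show "((\<lambda>x. w x * cut n x) \<longlongrightarrow> 0) (at_left 1)" using lim[of 1] by simp
    qed
    then show ?thesis using Bochner_Integration.integral_add[OF i1 i2] by (simp add: set_integral_U01)
  qed
  have inv0: "(\<lambda>n. 1 / real (Suc n)) \<longlonglongrightarrow> 0" using lim_1_over_n LIMSEQ_Suc by blast
  have "(\<lambda>n. LINT x|U01. g x * cut n x) \<longlonglongrightarrow> (LINT x|U01. g x)"
  proof (rule integral_dominated_convergence[where w = "\<lambda>x. \<bar>g x\<bar>"])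
    show "AE x in U01. (\<lambda>n. g x * cut n x) \<longlonglongrightarrow> g x"
    proof (rule AE_I2)
      fix x assume "x \<in> space U01"
      then have x01: "0 < x" "x < 1" and x: "0 < x * (1 - x)" using pos by auto
      have "(\<lambda>n. g x * (x * (1 - x)) powr (1 / real (Suc n))) \<longlonglongrightarrow> g x * (x * (1 - x)) powr 0"
        using x by (intro tendsto_intros inv0) auto
      then show "(\<lambda>n. g x * cut n x) \<longlonglongrightarrow> g x" using x01 by (simp add: cut_def)
    qed
    show "AE x in U01. norm (g x * cut n x) \<le> \<bar>g x\<bar>" for n
      by (rule AE_I2) (use cut_01 in \<open>auto simp: abs_mult intro!: mult_left_le\<close>)
  qed (use g i1 in auto)
  moreover have "(\<lambda>n. LINT x|U01. g x * cut n x) \<longlonglongrightarrow> 0"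
  proof (rule Lim_null_comparison[OF always_eventually])
    show "\<forall>n. norm (LINT x|U01. g x * cut n x) \<le> 1 / real (Suc n) * (LINT x|U01. \<bar>w x / (x * (1 - x))\<bar>)"
    proof
      fix n
      have "norm (LINT x|U01. g x * cut n x) = \<bar>LINT x|U01. w x * cut' n x\<bar>" by (simp add: eq)
      also have "\<dots> \<le> (LINT x|U01. \<bar>w x * cut' n x\<bar>)" by (rule integral_abs_bound)
      also have "\<dots> \<le> (LINT x|U01. 1 / real (Suc n) * \<bar>w x / (x * (1 - x))\<bar>)"
        by (rule integral_mono[OF integrable_abs[OF i2] integrable_mult_right[OF integrable_abs[OF w]]])
           (use wb in simp)
      also have "\<dots> = 1 / real (Suc n) * (LINT x|U01. \<bar>w x / (x * (1 - x))\<bar>)"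
        by (rule integral_mult_right_zero)
      finally show "norm (LINT x|U01. g x * cut n x) \<le> 1 / real (Suc n) * (LINT x|U01. \<bar>w x / (x * (1 - x))\<bar>)" .
    qed
    show "(\<lambda>n. 1 / real (Suc n) * (LINT x|U01. \<bar>w x / (x * (1 - x))\<bar>)) \<longlonglongrightarrow> 0"
      using tendsto_mult_right[OF inv0] by auto
  qed
  ultimately show ?thesis using LIMSEQ_unique by blast
qed

section \<open>Jacobi weights\<close>

lemma wgt_nonneg: "0 \<le> wgt a b x" by (simp add: wgt_def)

lemma wgt_pos: "0 < x \<Longrightarrow> x < 1 \<Longrightarrow> 0 < wgt a b x" by (simp add: wgt_def)

lemma wgt_add: "wgt a b x * wgt c d x = wgt (a + c) (b + d) x"
  by (simp add: wgt_def powr_add)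

lemma wgt_1_1: "0 < x \<Longrightarrow> x < 1 \<Longrightarrow> wgt (a + 1) (b + 1) x = wgt a b x * (x * (1 - x))"
  by (simp add: wgt_def powr_add)

lemma wgt_measurable [measurable]: "wgt a b \<in> borel_measurable borel"
  unfolding wgt_def[abs_def] by measurable

lemma wgt_continuous: "continuous_on {0<..<1} (wgt a b)"
  unfolding wgt_def[abs_def] by (intro continuous_intros) auto

lemma wgt_has_integral:
  assumes "-1 < a" "-1 < b"
  shows "(wgt a b has_integral Beta (b + 1) (a + 1)) {0<..<1}"
proof -
  have "((\<lambda>t. t powr b * (1 - t) powr a) has_integral Beta (b + 1) (a + 1)) {0..1}"
    using has_integral_Beta_real[of "b+1" "a+1"] assms by simp
  then show ?thesis unfolding has_integral_Icc_iff_Ioo by (simp add: wgt_def[abs_def] mult.commute)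
qed

lemma wgt_integrable:
  assumes "-1 < a" "-1 < b"
  shows "integrable U01 (wgt a b)" "(LINT x|U01. wgt a b x) = Beta (b + 1) (a + 1)"
proof -
  have "wgt a b absolutely_integrable_on {0<..<1}"
    using wgt_has_integral[OF assms]
    by (intro nonnegative_absolutely_integrable_1) (auto simp: wgt_nonneg has_integral_iff)
  then show "integrable U01 (wgt a b)" "(LINT x|U01. wgt a b x) = Beta (b + 1) (a + 1)"
    using has_integral_set_lebesgue[of "{0<..<1}" "wgt a b"] wgt_has_integral[OF assms]
      has_integral_unique
    by (auto simp: set_integrable_U01 set_integral_U01)
qed

definition jac_measure :: "real \<Rightarrow> real \<Rightarrow> real measure" where
  "jac_measure a b = density U01 (\<lambda>x. ennreal (wgt a b x))"

lemma jac_measure_simps [simp, measurable_cong]: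
  "sets (jac_measure a b) = sets U01" "space (jac_measure a b) = {0<..<1}"
  by (auto simp: jac_measure_def)

lemma jac_measure_measurable: "f \<in> borel_measurable (jac_measure a b) \<longleftrightarrow> f \<in> borel_measurable U01"
  by (auto cong: measurable_cong_sets)

lemma jac_measure_integral:
  assumes "f \<in> borel_measurable U01"
  shows "(LINT x|jac_measure a b. f x) = (LINT x|U01. wgt a b x * f x)"
  unfolding jac_measure_def
  by (rule integral_real_density) (use assms in \<open>auto simp: wgt_nonneg borel_measurable_U01\<close>)

lemma jac_measure_integrable:
  assumes "f \<in> borel_measurable U01"
  shows "integrable (jac_measure a b) f \<longleftrightarrow> integrable U01 (\<lambda>x. wgt a b x * f x)"
  unfolding jac_measure_def
  by (rule integrable_real_density) (use assms in \<open>auto simp: wgt_nonneg borel_measurable_U01\<close>)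

lemma jac_measure_AE:
  "(AE x in U01. P x) \<Longrightarrow> (AE x in jac_measure a b. P x)"
  unfolding jac_measure_def by (subst AE_density) (auto simp: borel_measurable_U01)

lemma jac_measure_finite: "-1 < a \<Longrightarrow> -1 < b \<Longrightarrow> finite_measure (jac_measure a b)"
proof
  assume "-1 < a" "-1 < b"
  then have "integrable (jac_measure a b) (\<lambda>_. 1 :: real)"
    by (subst jac_measure_integrable) (auto simp: wgt_integrable)
  then show "emeasure (jac_measure a b) (space (jac_measure a b)) \<noteq> \<infinity>"
    using integrable_iff_bounded[of "jac_measure a b" "\<lambda>_. 1 :: real"] by auto
qed

lemma wip_eq:
  assumes "g \<in> borel_measurable U01" "h \<in> borel_measurable U01"
  shows "wip a b g h = (LINT x|jac_measure a b. g x * h x)"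
  unfolding wip_def set_integral_U01
  by (subst jac_measure_integral) (use assms in \<open>auto simp: mult.assoc\<close>)

text \<open>Square integrability in terms of the measure with density \<open>wgt a b\<close>, for which the general lemmas on
  integrable functions are available; see \<open>in_wL2_iff\<close>.\<close>

definition sq_int :: "real \<Rightarrow> real \<Rightarrow> (real \<Rightarrow> real) \<Rightarrow> bool" where
  "sq_int a b g \<longleftrightarrow> g \<in> borel_measurable U01 \<and> integrable (jac_measure a b) (\<lambda>x. (g x)\<^sup>2)"

lemma in_wL2_iff: "in_wL2 a b g \<longleftrightarrow> sq_int a b g"
proof -
  have "g \<in> borel_measurable U01 \<Longrightarrow> (\<lambda>x. (g x)\<^sup>2) \<in> borel_measurable U01"
    by (rule borel_measurable_power)
  then show ?thesis unfolding in_wL2_def sq_int_def set_measurable_U01 set_integrable_U01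
    using jac_measure_integrable by blast
qed

lemma wnorm_eq:
  assumes "g \<in> borel_measurable U01" shows "(wnorm a b g)\<^sup>2 = (LINT x|jac_measure a b. (g x)\<^sup>2)"
proof -
  have "wip a b g g = (LINT x|jac_measure a b. (g x)\<^sup>2)"
    using wip_eq[OF assms assms] by (simp add: power2_eq_square)
  then show ?thesis by (simp add: wnorm_def)
qed

lemma sq_int_mult_integrable:
  assumes "sq_int a b g" "sq_int a b h"
  shows "integrable (jac_measure a b) (\<lambda>x. g x * h x)"
proof (rule Bochner_Integration.integrable_bound)
  show "integrable (jac_measure a b) (\<lambda>x. (g x)\<^sup>2 + (h x)\<^sup>2)" using assms by (auto simp: sq_int_def)
  show "(\<lambda>x. g x * h x) \<in> borel_measurable (jac_measure a b)"
    using assms unfolding sq_int_def jac_measure_measurable by (auto intro: borel_measurable_times)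
  show "AE x in jac_measure a b. norm (g x * h x) \<le> norm ((g x)\<^sup>2 + (h x)\<^sup>2)"
  proof (rule AE_I2)
    fix x
    have "0 \<le> (\<bar>g x\<bar> - \<bar>h x\<bar>)\<^sup>2" by simp
    then have "2 * (\<bar>g x\<bar> * \<bar>h x\<bar>) \<le> (g x)\<^sup>2 + (h x)\<^sup>2" by (simp add: power2_diff)
    then show "norm (g x * h x) \<le> norm ((g x)\<^sup>2 + (h x)\<^sup>2)"
      by (simp add: abs_mult) (smt (verit) mult_nonneg_nonneg abs_ge_zero)
  qed
qed

lemma poly_bounded: "\<exists>B. \<forall>x. 0 < x \<longrightarrow> x < 1 \<longrightarrow> \<bar>poly q x :: real\<bar> \<le> B"
proof -
  have "bounded (poly q ` {0..1})"
    by (intro compact_imp_bounded compact_continuous_image continuous_intros) auto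
  then obtain B where "\<And>x. x \<in> {0..1} \<Longrightarrow> \<bar>poly q x\<bar> \<le> B" 
    by (metis bounded_iff image_eqI real_norm_def)
  then show ?thesis by (intro exI[of _ B]) auto
qed

lemma poly_measurable_U01: "poly q \<in> borel_measurable U01"
  by (intro continuous_measurable_U01 continuous_intros)

lemma integrable_times_poly:
  assumes "integrable (jac_measure a b) g"
  shows "integrable (jac_measure a b) (\<lambda>x. g x * poly q x)"
proof -
  obtain B where B: "\<And>x. 0 < x \<Longrightarrow> x < 1 \<Longrightarrow> \<bar>poly q x\<bar> \<le> B" using poly_bounded by blast
  then have "0 \<le> B" by (meson abs_ge_zero order_trans zero_less_one dense)
  show ?thesis
  proof (rule Bochner_Integration.integrable_bound[of _ "\<lambda>x. B * g x"])
    show "(\<lambda>x. g x * poly q x) \<in> borel_measurable (jac_measure a b)"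
      using borel_measurable_integrable[OF assms] poly_measurable_U01[of q]
      unfolding jac_measure_measurable by (rule borel_measurable_times)
    show "AE x in jac_measure a b. norm (g x * poly q x) \<le> norm (B * g x)"
      by (rule AE_I2) (use B \<open>0 \<le> B\<close> in \<open>auto simp: abs_mult mult.commute[of B] intro!: mult_left_mono\<close>)
  qed (use assms in auto)
qed

lemma poly_integrable: "-1 < a \<Longrightarrow> -1 < b \<Longrightarrow> integrable (jac_measure a b) (poly q)"
  using integrable_times_poly[of a b "\<lambda>_. 1" q]
    finite_measure.integrable_const[OF jac_measure_finite, of a b 1] by simp

lemma sq_int_poly: "-1 < a \<Longrightarrow> -1 < b \<Longrightarrow> sq_int a b (poly q)"
  using poly_integrable[of a b "q * q"] by (simp add: sq_int_def poly_measurable_U01 power2_eq_square poly_mult[abs_def] cong: integrable_cong)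

lemma sq_int_integrable:
  assumes "sq_int a b g" "-1 < a" "-1 < b" shows "integrable (jac_measure a b) g"
  using sq_int_mult_integrable[OF assms(1) sq_int_poly[OF assms(2,3), of 1]] by simp

section \<open>Jacobi polynomials\<close>

text \<open>The polynomial behind \<open>jacobi01\<close>: after the substitution $t = 2x-1$ the two factors of the defining sum
  are $x-1$ and $x$.\<close>

definition jpoly :: "nat \<Rightarrow> real \<Rightarrow> real \<Rightarrow> real poly" where
  "jpoly n a b = (\<Sum>k\<le>n. smult (((real n + a) gchoose (n - k)) * ((real n + b) gchoose k))
     ([:-1, 1:] ^ k * [:0, 1:] ^ (n - k)))"

lemma poly_jpoly: "poly (jpoly n a b) x = jacobi01 n a b x"
  by (simp add: jpoly_def jacobi01_def jacobi_def poly_sum algebra_simps diff_divide_distrib)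

lemma jacobi01_eq: "jacobi01 n a b = poly (jpoly n a b)"
  by (simp add: fun_eq_iff poly_jpoly)

lemma gbinomial_Suc_mult: "real (Suc k) * (c gchoose Suc k) = (c - real k) * ((c::real) gchoose k)"
  using gbinomial_mult_1[of c k] by (simp add: algebra_simps)

lemma smult_sum_right: "smult c (\<Sum>i\<in>I. f i) = (\<Sum>i\<in>I. smult c (f i :: real poly))"
  by (induction I rule: infinite_finite_induct) (auto simp: smult_add_right)

lemma pderiv_sum_poly: "pderiv (\<Sum>i\<in>I. f i) = (\<Sum>i\<in>I. pderiv (f i :: real poly))"
  using higher_pderiv_sum[of 1 f I] by simp

context
  fixes a b :: real and n :: nat
begin

private abbreviation (input) A where
  "A k \<equiv> ((real (Suc n) + a) gchoose (Suc n - k)) * ((real (Suc n) + b) gchoose k)"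
private abbreviation (input) B where
  "B k \<equiv> ((real n + (a + 1)) gchoose (n - k)) * ((real n + (b + 1)) gchoose k)"
private abbreviation (input) y where "y \<equiv> [:-1, 1 :: real:]"
private abbreviation (input) z where "z \<equiv> [:0, 1 :: real:]"

text \<open>The two absorption identities between the coefficients for $(n+1,a,b)$ and for $(n,a+1,b+1)$. They
  give both the derivative formula and Rodrigues' formula by comparing coefficients.\<close>

lemma coeff_step_left: "k \<le> n \<Longrightarrow> real (Suc n - k) * A k = (a + 1 + real k) * B k"
proof -
  assume "k \<le> n"
  then have "Suc n - k = Suc (n - k)" "real (n - k) = real n - real k" by auto
  then have e: "real (Suc n - k) * ((real (Suc n) + a) gchoose (Suc n - k))
      = (a + 1 + real k) * ((real n + (a + 1)) gchoose (n - k))"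
    using gbinomial_Suc_mult[of "n - k" "real (Suc n) + a"] by (simp add: algebra_simps)
  have eqb: "real (Suc n) + b = real n + (b + 1)" by simp
  show ?thesis by (simp only: mult.assoc[symmetric] e eqb)
qed

lemma coeff_step_right: "k \<le> n \<Longrightarrow> real (Suc k) * A (Suc k) = (b + 1 + real (n - k)) * B k"
proof -
  assume "k \<le> n"
  then have "real (n - k) = real n - real k" by auto
  then have e: "real (Suc k) * ((real (Suc n) + b) gchoose Suc k)
      = (b + 1 + real (n - k)) * ((real n + (b + 1)) gchoose k)"
    using gbinomial_Suc_mult[of k "real (Suc n) + b"] by (simp add: algebra_simps)
  have eqa: "real (Suc n) + a = real n + (a + 1)" "Suc n - Suc k = n - k" by auto
  have "real (Suc k) * A (Suc k)
     = ((real (Suc n) + a) gchoose (Suc n - Suc k)) * (real (Suc k) * ((real (Suc n) + b) gchoose Suc k))"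
    by (rule mult.left_commute)
  also have "\<dots> = (b + 1 + real (n - k)) * B k"
    unfolding e eqa by (rule mult.left_commute)
  finally show ?thesis .
qed

lemma pderiv_jpoly: "pderiv (jpoly (Suc n) a b) = smult (real n + a + b + 2) (jpoly n (a + 1) (b + 1))"
proof -
  have D: "pderiv (y ^ k * z ^ m) = smult (real k) (y ^ (k - 1) * z ^ m) + smult (real m) (y ^ k * z ^ (m - 1))" for k m
    by (simp add: pderiv_mult pderiv_power pderiv_pCons mult.commute)
  have "pderiv (jpoly (Suc n) a b) = (\<Sum>k\<le>Suc n. smult (A k)
       (smult (real k) (y ^ (k - 1) * z ^ (Suc n - k)) + smult (real (Suc n - k)) (y ^ k * z ^ (Suc n - k - 1))))"
    by (simp add: jpoly_def pderiv_sum_poly pderiv_smult D del: sum.atMost_Suc)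
  also have "\<dots> = (\<Sum>k\<le>Suc n. smult (real k * A k) (y ^ (k - 1) * z ^ (Suc n - k)))
       + (\<Sum>k\<le>Suc n. smult (real (Suc n - k) * A k) (y ^ k * z ^ (Suc n - k - 1)))"
    by (simp add: smult_add_right sum.distrib mult.commute del: sum.atMost_Suc)
  also have "(\<Sum>k\<le>Suc n. smult (real k * A k) (y ^ (k - 1) * z ^ (Suc n - k)))
     = (\<Sum>k\<le>n. smult (real (Suc k) * A (Suc k)) (y ^ k * z ^ (n - k)))"
    by (subst sum.atMost_Suc_shift) simp
  also have "(\<Sum>k\<le>Suc n. smult (real (Suc n - k) * A k) (y ^ k * z ^ (Suc n - k - 1)))
     = (\<Sum>k\<le>n. smult (real (Suc n - k) * A k) (y ^ k * z ^ (n - k)))"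
    by (subst sum.atMost_Suc) simp
  also have "(\<Sum>k\<le>n. smult (real (Suc k) * A (Suc k)) (y ^ k * z ^ (n - k)))
      + (\<Sum>k\<le>n. smult (real (Suc n - k) * A k) (y ^ k * z ^ (n - k)))
     = (\<Sum>k\<le>n. smult ((real n + a + b + 2) * B k) (y ^ k * z ^ (n - k)))"
    unfolding sum.distrib[symmetric] smult_add_left[symmetric]
  proof (intro sum.cong refl arg_cong2[where f = smult])
    fix k assume "k \<in> {..n}"
    then have k: "k \<le> n" "real (n - k) = real n - real k" by auto
    show "real (Suc k) * A (Suc k) + real (Suc n - k) * A k = (real n + a + b + 2) * B k"
      unfolding coeff_step_left[OF k(1)] coeff_step_right[OF k(1)] k(2) by (simp add: algebra_simps)
  qed
  also have "\<dots> = smult (real n + a + b + 2) (jpoly n (a + 1) (b + 1))"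
    by (simp add: jpoly_def smult_sum_right)
  finally show ?thesis .
qed

text \<open>The polynomial content of Rodrigues' formula: up to sign, the right-hand side is what remains of the
  derivative of $\omega^{(a+1,b+1)} G_n^{(a+1,b+1)}$ after division by $\omega^{(a,b)}$.\<close>

lemma rodrigues_poly:
  "smult (real (Suc n)) (jpoly (Suc n) a b)
     = (smult (a + 1) z + smult (b + 1) y) * jpoly n (a + 1) (b + 1) + y * z * pderiv (jpoly n (a + 1) (b + 1))"
proof -
  have D: "(smult (a + 1) z + smult (b + 1) y) * (y ^ k * z ^ m) + y * z * pderiv (y ^ k * z ^ m)
     = smult (a + 1 + real k) (y ^ k * z ^ Suc m) + smult (b + 1 + real m) (y ^ Suc k * z ^ m)" for k m
  proof -
    have P: "t * (real j * t ^ (j - 1)) = real j * t ^ j" for t :: real and j by (cases j) auto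
    have pd: "pderiv (y ^ k * z ^ m) = smult (real k) (y ^ (k - 1) * z ^ m) + smult (real m) (y ^ k * z ^ (m - 1))"
      by (simp add: pderiv_mult pderiv_power pderiv_pCons mult.commute)
    have "poly ((smult (a + 1) z + smult (b + 1) y) * (y ^ k * z ^ m) + y * z * pderiv (y ^ k * z ^ m)) t
       = poly (smult (a + 1 + real k) (y ^ k * z ^ Suc m) + smult (b + 1 + real m) (y ^ Suc k * z ^ m)) t" for t
    proof -
      define v where "v = t - 1"
      have "((a + 1) * t + (b + 1) * v) * (v ^ k * t ^ m) + v * t * (real k * (v ^ (k - 1) * t ^ m) + real m * (v ^ k * t ^ (m - 1)))
        = ((a + 1) * t + (b + 1) * v) * (v ^ k * t ^ m) + (v * (real k * v ^ (k - 1))) * (t * t ^ m) + (t * (real m * t ^ (m - 1))) * (v * v ^ k)"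
        by (simp only: ring_distribs mult_ac)
      also have "\<dots> = (a + 1 + real k) * (v ^ k * (t * t ^ m)) + (b + 1 + real m) * ((v * v ^ k) * t ^ m)"
        unfolding P by (simp only: ring_distribs mult_ac add_ac)
      finally show ?thesis unfolding pd by (simp add: v_def algebra_simps)
    qed
    then show ?thesis by (simp add: poly_eq_poly_eq_iff[symmetric] fun_eq_iff)
  qed
  have "(smult (a + 1) z + smult (b + 1) y) * jpoly n (a + 1) (b + 1) + y * z * pderiv (jpoly n (a + 1) (b + 1))
     = (\<Sum>k\<le>n. smult (B k) ((smult (a + 1) z + smult (b + 1) y) * (y ^ k * z ^ (n - k)) + y * z * pderiv (y ^ k * z ^ (n - k))))"
    by (simp only: jpoly_def pderiv_sum_poly pderiv_smult sum_distrib_left mult_smult_right smult_add_right sum.distrib)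
  also have "\<dots> = (\<Sum>k\<le>n. smult ((a + 1 + real k) * B k) (y ^ k * z ^ Suc (n - k)))
      + (\<Sum>k\<le>n. smult ((b + 1 + real (n - k)) * B k) (y ^ Suc k * z ^ (n - k)))"
    unfolding D sum.distrib[symmetric] smult_add_right smult_smult by (simp only: mult.commute)
  also have "(\<Sum>k\<le>n. smult ((a + 1 + real k) * B k) (y ^ k * z ^ Suc (n - k)))
     = (\<Sum>k\<le>Suc n. smult (real (Suc n - k) * A k) (y ^ k * z ^ (Suc n - k)))"
    by (subst sum.atMost_Suc) (auto intro!: sum.cong simp: coeff_step_left[symmetric] Suc_diff_le simp del: power_Suc)
  also have "(\<Sum>k\<le>n. smult ((b + 1 + real (n - k)) * B k) (y ^ Suc k * z ^ (n - k)))
     = (\<Sum>k\<le>Suc n. smult (real k * A k) (y ^ k * z ^ (Suc n - k)))"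
  proof -
    have "(\<Sum>k\<le>n. smult ((b + 1 + real (n - k)) * B k) (y ^ Suc k * z ^ (n - k)))
      = (\<Sum>k\<le>n. smult (real (Suc k) * A (Suc k)) (y ^ Suc k * z ^ (Suc n - Suc k)))"
      by (intro sum.cong refl) (simp only: coeff_step_right[symmetric] atMost_iff diff_Suc_Suc)
    then show ?thesis by (subst sum.atMost_Suc_shift) simp
  qed
  also have "(\<Sum>k\<le>Suc n. smult (real (Suc n - k) * A k) (y ^ k * z ^ (Suc n - k)))
     + (\<Sum>k\<le>Suc n. smult (real k * A k) (y ^ k * z ^ (Suc n - k)))
     = (\<Sum>k\<le>Suc n. smult (real (Suc n) * A k) (y ^ k * z ^ (Suc n - k)))"
    unfolding sum.distrib[symmetric] smult_add_left[symmetric] distrib_right[symmetric]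
    by (intro sum.cong refl arg_cong2[where f = smult] arg_cong2[where f = "(*)"]) (auto simp: of_nat_diff)
  also have "\<dots> = smult (real (Suc n)) (jpoly (Suc n) a b)"
    by (simp only: jpoly_def smult_sum_right smult_smult)
  finally show ?thesis ..
qed

lemma rodrigues_derivative:
  assumes "0 < x" "x < 1"
  shows "((\<lambda>x. wgt (a + 1) (b + 1) x * poly (jpoly n (a + 1) (b + 1)) x) has_real_derivative
     - real (Suc n) * (wgt a b x * poly (jpoly (Suc n) a b) x)) (at x)"
proof -
  let ?P = "jpoly n (a + 1) (b + 1)"
  have "((\<lambda>x. wgt (a + 1) (b + 1) x * poly ?P x) has_real_derivative
     wgt a b x * (((b + 1) * (1 - x) - (a + 1) * x) * poly ?P x + x * (1 - x) * poly (pderiv ?P) x)) (at x)"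
  proof -
    have D1: "((\<lambda>x. (1 - x) powr (a + 1)) has_real_derivative - (a + 1) * (1 - x) powr a) (at x)"
    proof -
      have "((\<lambda>x. 1 - x) has_real_derivative - 1) (at x)" by (auto intro!: derivative_eq_intros)
      from DERIV_fun_powr[OF this, of "a + 1"] show ?thesis using assms by (simp add: algebra_simps)
    qed
    have D2: "((\<lambda>x. x powr (b + 1)) has_real_derivative (b + 1) * x powr b) (at x)"
      using DERIV_fun_powr[of "\<lambda>x. x" 1 x "b + 1"] assms by auto
    have "((\<lambda>x. wgt (a + 1) (b + 1) x * poly ?P x) has_real_derivative
       (- (a + 1) * (1 - x) powr a * x powr (b + 1) + (b + 1) * x powr b * (1 - x) powr (a + 1)) * poly ?P x
        + poly (pderiv ?P) x * wgt (a + 1) (b + 1) x) (at x)"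
      unfolding wgt_def by (rule DERIV_mult[OF DERIV_mult[OF D1 D2] poly_DERIV])
    then show ?thesis using assms by (simp add: wgt_def powr_add algebra_simps)
  qed
  also have "wgt a b x * (((b + 1) * (1 - x) - (a + 1) * x) * poly ?P x + x * (1 - x) * poly (pderiv ?P) x)
     = - (wgt a b x * poly (smult (real (Suc n)) (jpoly (Suc n) a b)) x)"
    unfolding rodrigues_poly by (simp add: algebra_simps)
  finally show ?thesis by (simp add: algebra_simps)
qed

end

text \<open>One step of Rodrigues' formula. The boundary terms vanish because $v\,\omega^{(a+1,b+1)}$ divided by
  $x(1-x)$ is $v\,\omega^{(a,b)}$, which is integrable.\<close>

lemma jacobi_integration_by_parts:
  assumes ab: "-1 < a" "-1 < b" and p: "primitive v v'"
    and v: "integrable (jac_measure a b) v" and v': "integrable (jac_measure (a + 1) (b + 1)) v'"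
  shows "real (Suc n) * (LINT x|jac_measure a b. v x * poly (jpoly (Suc n) a b) x)
       = (LINT x|jac_measure (a + 1) (b + 1). v' x * poly (jpoly n (a + 1) (b + 1)) x)"
proof -
  let ?Q = "jpoly n (a + 1) (b + 1)" and ?G = "jpoly (Suc n) a b"
  let ?\<psi> = "\<lambda>x. wgt (a + 1) (b + 1) x * poly ?Q x" and ?\<psi>' = "\<lambda>x. - real (Suc n) * (wgt a b x * poly ?G x)"
  have vm: "v \<in> borel_measurable U01" "v' \<in> borel_measurable U01"
    using v v' borel_measurable_integrable jac_measure_measurable by blast+
  note pm = poly_measurable_U01
  have vG: "integrable U01 (\<lambda>x. wgt a b x * (v x * poly q x))" for q
    using integrable_times_poly[OF v, of q] vm pm by (subst (asm) jac_measure_integrable) auto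
  have v'Q: "integrable U01 (\<lambda>x. wgt (a+1) (b+1) x * (v' x * poly ?Q x))"
    using integrable_times_poly[OF v', of ?Q] vm pm by (subst (asm) jac_measure_integrable) auto
  have "primitive ?\<psi> ?\<psi>'"
  proof (rule primitive_of_derivative)
    show "(?\<psi> has_real_derivative ?\<psi>' x) (at x)" if "x \<in> {0<..<1}" for x
      by (rule rodrigues_derivative) (use that in auto)
    show "continuous_on {0<..<1} ?\<psi>'"
      by (intro continuous_intros wgt_continuous)
  qed
  from primitive_mult[OF p this]
  have pr: "primitive (\<lambda>x. v x * ?\<psi> x) (\<lambda>x. v' x * ?\<psi> x + v x * ?\<psi>' x)" .
  have i1: "integrable U01 (\<lambda>x. v' x * ?\<psi> x)" using v'Q by (simp add: mult_ac)
  have i2: "integrable U01 (\<lambda>x. v x * ?\<psi>' x)"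
    using integrable_mult_right[OF vG[of ?G], of "- real (Suc n)"] by (simp only: mult_ac)
  have i3: "integrable U01 (\<lambda>x. v x * ?\<psi> x / (x * (1 - x)))"
  proof -
    have "v x * ?\<psi> x / (x * (1 - x)) = wgt a b x * (v x * poly ?Q x)" if "0 < x" "x < 1" for x
      using that by (simp add: wgt_1_1)
    then show ?thesis using vG[of ?Q] by (subst integrable_U01_cong) auto
  qed
  have "(LINT x|U01. v' x * ?\<psi> x + v x * ?\<psi>' x) = 0"
    by (rule integral_derivative_eq_0[OF pr _ i3]) (intro Bochner_Integration.integrable_add i1 i2)
  then have "(LINT x|U01. v' x * ?\<psi> x) = - (LINT x|U01. v x * ?\<psi>' x)"
    using Bochner_Integration.integral_add[OF i1 i2] by simp
  also have "\<dots> = (LINT x|U01. - (v x * ?\<psi>' x))" by simp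
  also have "\<dots> = (LINT x|U01. real (Suc n) * (wgt a b x * (v x * poly ?G x)))"
    by (rule integral_U01_cong) (simp only: mult_ac mult_minus_left mult_minus_right minus_minus)
  also have "\<dots> = real (Suc n) * (LINT x|U01. wgt a b x * (v x * poly ?G x))"
    by (rule integral_mult_right_zero)
  finally show ?thesis
    using vm pm by (subst (1 2) jac_measure_integral) (auto simp: mult_ac)
qed

lemma primitive_poly: "primitive (poly q) (poly (pderiv q))"
  by (rule primitive_of_derivative) (auto intro!: poly_DERIV continuous_intros)

text \<open>Each integration by parts lowers the degree of \<open>q\<close> and the index of the Jacobi polynomial by one; \<open>q\<close>
  runs out first.\<close>

lemma jpoly_orthogonal:
  assumes "-1 < a" "-1 < b" "degree q < n"
  shows "(LINT x|jac_measure a b. poly q x * poly (jpoly n a b) x) = 0"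
  using assms
proof (induction n arbitrary: a b q)
  case (Suc n)
  have "real (Suc n) * (LINT x|jac_measure a b. poly q x * poly (jpoly (Suc n) a b) x)
      = (LINT x|jac_measure (a+1) (b+1). poly (pderiv q) x * poly (jpoly n (a+1) (b+1)) x)"
    by (rule jacobi_integration_by_parts) (use Suc.prems in \<open>auto intro!: poly_integrable primitive_poly\<close>)
  also have "\<dots> = 0"
  proof (cases "degree q = 0")
    case True
    then have "pderiv q = 0" by (simp add: pderiv_eq_0_iff)
    then show ?thesis by simp
  next
    case False
    then show ?thesis using Suc.prems by (intro Suc.IH) (auto simp: degree_pderiv)
  qed
  finally show ?case by simp
qed simp

definition jnorm :: "nat \<Rightarrow> real \<Rightarrow> real \<Rightarrow> real" where
  "jnorm n a b = (LINT x|jac_measure a b. (poly (jpoly n a b) x)\<^sup>2)"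

lemma jnorm_Suc:
  assumes "-1 < a" "-1 < b"
  shows "real (Suc n) * jnorm (Suc n) a b = (real n + a + b + 2) * jnorm n (a + 1) (b + 1)"
proof -
  have "real (Suc n) * jnorm (Suc n) a b
     = (LINT x|jac_measure (a+1) (b+1). poly (pderiv (jpoly (Suc n) a b)) x * poly (jpoly n (a+1) (b+1)) x)"
    unfolding jnorm_def power2_eq_square
    by (rule jacobi_integration_by_parts) (use assms in \<open>auto intro!: poly_integrable primitive_poly\<close>)
  also have "\<dots> = (LINT x|jac_measure (a+1) (b+1). (real n + a + b + 2) * (poly (jpoly n (a+1) (b+1)) x)\<^sup>2)"
    by (simp add: pderiv_jpoly power2_eq_square mult.assoc)
  finally show ?thesis by (simp add: jnorm_def)
qed

section \<open>Expansion in Jacobi polynomials\<close>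

lemma degree_jpoly_le: "degree (jpoly n a b) \<le> n"
  unfolding jpoly_def
proof (rule degree_sum_le)
  fix k assume "k \<in> {..n}"
  have "degree ([:-1, 1::real:] ^ k * [:0, 1:] ^ (n - k)) \<le> degree ([:-1, 1::real:] ^ k) + degree ([:0, 1::real:] ^ (n - k))"
    by (rule degree_mult_le)
  also have "\<dots> = k + (n - k)" by (simp add: degree_power_eq)
  also have "\<dots> = n" using \<open>k \<in> {..n}\<close> by simp
  finally show "degree (smult (((real n + a) gchoose (n - k)) * ((real n + b) gchoose k))
       ([:-1, 1:] ^ k * [:0, 1:] ^ (n - k))) \<le> n"
    using degree_smult_le order_trans by blast
qed simp

text \<open>All the products in the sum are monic, so the leading coefficient is a Vandermonde convolution. It
  depends on \<open>a + b\<close> only; this is how \<open>G_m\<close> with exchanged parameters is recognised later.\<close>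

lemma coeff_jpoly: "coeff (jpoly n a b) n = (2 * real n + a + b) gchoose n"
proof -
  have "coeff (jpoly n a b) n = (\<Sum>k\<le>n. ((real n + a) gchoose (n - k)) * ((real n + b) gchoose k))"
    unfolding jpoly_def coeff_sum
  proof (rule sum.cong[OF refl])
    fix k assume k: "k \<in> {..n}"
    let ?p = "[:-1, 1::real:] ^ k * [:0, 1:] ^ (n - k)"
    have "degree ?p = n" using k by (simp add: degree_mult_eq degree_power_eq)
    moreover have "lead_coeff ?p = 1" by (simp add: lead_coeff_mult lead_coeff_power)
    ultimately show "coeff (smult (((real n + a) gchoose (n - k)) * ((real n + b) gchoose k)) ?p) n
        = ((real n + a) gchoose (n - k)) * ((real n + b) gchoose k)" by simp
  qed
  also have "\<dots> = (\<Sum>k\<le>n. ((real n + b) gchoose k) * ((real n + a) gchoose (n - k)))"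
    by (simp add: mult.commute)
  also have "\<dots> = (real n + b + (real n + a)) gchoose n" 
    using gbinomial_Vandermonde[of "real n + b" "real n + a" n] by (simp add: atMost_atLeast0)
  finally show ?thesis by (simp add: algebra_simps)
qed

lemma coeff_jpoly_pos: "-1 < a \<Longrightarrow> -1 < b \<Longrightarrow> 0 < coeff (jpoly n a b) n"
  unfolding coeff_jpoly gbinomial_prod_rev
  by (intro divide_pos_pos prod_pos) auto

lemma poly_eq_0_of_integral:
  assumes "-1 < a" "-1 < b" "(LINT x|jac_measure a b. (poly q x)\<^sup>2) = 0"
  shows "q = 0"
proof (rule ccontr)
  assume "q \<noteq> 0"
  then have fin: "finite {x. poly q x = 0}" by (rule poly_roots_finite)
  have i: "integrable U01 (\<lambda>x. wgt a b x * (poly q x)\<^sup>2)" and m: "(\<lambda>x. (poly q x)\<^sup>2) \<in> borel_measurable U01"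
    using sq_int_poly[OF assms(1,2), of q] poly_measurable_U01[of q]
    by (auto simp: sq_int_def jac_measure_integrable)
  have "(LINT x|U01. wgt a b x * (poly q x)\<^sup>2) = 0" using assms(3) jac_measure_integral[OF m] by simp
  then have "AE x in U01. wgt a b x * (poly q x)\<^sup>2 = 0"
    using integral_nonneg_eq_0_iff_AE[OF i] by (auto simp: wgt_nonneg)
  then have "AE x in lebesgue. x \<in> {0<..<1} \<longrightarrow> wgt a b x * (poly q x)\<^sup>2 = 0"
    by (simp add: unit_interval_AE_iff)
  then have "AE x in lebesgue. x \<notin> {0<..<1} - {x. poly q x = 0}"
  proof eventually_elim
    fix x assume "x \<in> {0<..<1} \<longrightarrow> wgt a b x * (poly q x)\<^sup>2 = 0"
    then show "x \<notin> {0<..<1} - {x. poly q x = 0}" using wgt_pos[of x a b] by auto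
  qed
  moreover have "open ({0<..<1} - {x. poly q x = 0})"
    using fin by (intro open_Diff finite_imp_closed) auto
  ultimately have "negligible ({0<..<1} - {x. poly q x = 0})"
    by (auto simp: negligible_iff_null_sets AE_iff_null_sets)
  then have "{0<..<1} - {x. poly q x = 0} = {}"
    using open_not_negligible \<open>open _\<close> by blast
  then have "{0<..<1::real} \<subseteq> {x. poly q x = 0}" by blast
  then have "finite {0<..<1::real}" using fin finite_subset by blast
  then show False using infinite_Ioo[of 0 "1::real"] by simp
qed

lemma jnorm_pos: assumes "-1 < a" "-1 < b" shows "0 < jnorm n a b"
proof -
  have "0 \<le> jnorm n a b" unfolding jnorm_def by (intro Bochner_Integration.integral_nonneg) auto
  moreover have "jnorm n a b \<noteq> 0"
    using poly_eq_0_of_integral[OF assms, of "jpoly n a b"] coeff_jpoly_pos[OF assms, of n]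
    by (auto simp: jnorm_def)
  ultimately show ?thesis by simp
qed

lemma jpoly_orthogonal':
  assumes "-1 < a" "-1 < b" "m \<noteq> n"
  shows "(LINT x|jac_measure a b. poly (jpoly m a b) x * poly (jpoly n a b) x) = 0"
proof (cases "m < n")
  case True
  then show ?thesis using degree_jpoly_le[of m a b] assms by (intro jpoly_orthogonal) auto
next
  case False
  then have "(LINT x|jac_measure a b. poly (jpoly n a b) x * poly (jpoly m a b) x) = 0"
    using degree_jpoly_le[of n a b] assms by (intro jpoly_orthogonal) auto
  then show ?thesis by (simp add: mult.commute)
qed

definition jinner :: "nat \<Rightarrow> real \<Rightarrow> real \<Rightarrow> (real \<Rightarrow> real) \<Rightarrow> real" where
  "jinner n a b v = (LINT x|jac_measure a b. v x * poly (jpoly n a b) x)"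

definition jsum :: "nat \<Rightarrow> real \<Rightarrow> real \<Rightarrow> (real \<Rightarrow> real) \<Rightarrow> real poly" where
  "jsum N a b v = (\<Sum>n\<le>N. smult (jinner n a b v / jnorm n a b) (jpoly n a b))"

text \<open>The contribution of the index \<open>n\<close> to the squared norm of \<open>v\<close> in Parseval's identity.\<close>

definition energy :: "nat \<Rightarrow> real \<Rightarrow> real \<Rightarrow> (real \<Rightarrow> real) \<Rightarrow> real" where
  "energy n a b v = (jinner n a b v)\<^sup>2 / jnorm n a b"

lemma energy_nonneg: "-1 < a \<Longrightarrow> -1 < b \<Longrightarrow> 0 \<le> energy n a b v"
  using jnorm_pos[of a b n] by (simp add: energy_def)

lemma degree_jsum: "degree (jsum N a b v) \<le> N"
  unfolding jsum_def
proof (rule degree_sum_le)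
  fix n assume "n \<in> {..N}"
  have "degree (smult (jinner n a b v / jnorm n a b) (jpoly n a b)) \<le> degree (jpoly n a b)"
    by (rule degree_smult_le)
  also have "\<dots> \<le> N" using degree_jpoly_le[of n a b] \<open>n \<in> {..N}\<close> by simp
  finally show "degree (smult (jinner n a b v / jnorm n a b) (jpoly n a b)) \<le> N" .
qed simp

lemma integral_times_poly_sum:
  assumes "integrable (jac_measure a b) v"
  shows "(LINT x|jac_measure a b. v x * poly (\<Sum>n\<in>I. smult (c n) (p n)) x)
    = (\<Sum>n\<in>I. c n * (LINT x|jac_measure a b. v x * poly (p n) x))"
proof -
  have "(LINT x|jac_measure a b. v x * poly (\<Sum>n\<in>I. smult (c n) (p n)) x)
     = (LINT x|jac_measure a b. (\<Sum>n\<in>I. c n * (v x * poly (p n) x)))"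
    by (simp add: poly_sum sum_distrib_left mult_ac)
  also have "\<dots> = (\<Sum>n\<in>I. LINT x|jac_measure a b. c n * (v x * poly (p n) x))"
    by (intro Bochner_Integration.integral_sum integrable_mult_right integrable_times_poly assms)
  finally show ?thesis by simp
qed

lemma jinner_jsum:
  assumes ab: "-1 < a" "-1 < b" and "n \<le> N"
  shows "jinner n a b (poly (jsum N a b v)) = jinner n a b v"
proof -
  have "jinner n a b (poly (jsum N a b v)) = (LINT x|jac_measure a b. poly (jpoly n a b) x * poly (jsum N a b v) x)"
    unfolding jinner_def by (simp add: mult.commute)
  also have "\<dots> = (\<Sum>m\<le>N. jinner m a b v / jnorm m a b * (LINT x|jac_measure a b. poly (jpoly n a b) x * poly (jpoly m a b) x))"
    unfolding jsum_def by (rule integral_times_poly_sum[OF poly_integrable[OF ab]])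
  also have "\<dots> = (\<Sum>m\<le>N. if m = n then jinner n a b v else 0)"
  proof (rule sum.cong[OF refl])
    fix m
    show "jinner m a b v / jnorm m a b * (LINT x|jac_measure a b. poly (jpoly n a b) x * poly (jpoly m a b) x)
       = (if m = n then jinner n a b v else 0)"
      using jpoly_orthogonal'[OF ab, of n m] jnorm_pos[OF ab, of n]
      by (auto simp: jnorm_def power2_eq_square)
  qed
  also have "\<dots> = jinner n a b v" using assms(3) by simp
  finally show ?thesis .
qed

lemma residual_energy:
  assumes ab: "-1 < a" "-1 < b" and v: "sq_int a b v"
  shows "(LINT x|jac_measure a b. (v x - poly (jsum N a b v) x)\<^sup>2)
     = (LINT x|jac_measure a b. (v x)\<^sup>2) - (\<Sum>n\<le>N. energy n a b v)"
    and "integrable (jac_measure a b) (\<lambda>x. (v x - poly (jsum N a b v) x)\<^sup>2)"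
proof -
  let ?S = "jsum N a b v" and ?J = "jac_measure a b"
  have i: "integrable ?J (\<lambda>x. (v x)\<^sup>2)" "integrable ?J (\<lambda>x. v x * poly ?S x)" "integrable ?J (\<lambda>x. (poly ?S x)\<^sup>2)"
    using v sq_int_poly[OF ab, of ?S] sq_int_mult_integrable[OF v sq_int_poly[OF ab]] by (auto simp: sq_int_def)
  have eq: "(\<lambda>x. (v x - poly ?S x)\<^sup>2) = (\<lambda>x. (v x)\<^sup>2 - 2 * (v x * poly ?S x) + (poly ?S x)\<^sup>2)"
    by (simp add: fun_eq_iff power2_diff)
  show "integrable ?J (\<lambda>x. (v x - poly ?S x)\<^sup>2)"
    unfolding eq by (intro Bochner_Integration.integrable_add Bochner_Integration.integrable_diff integrable_mult_right i)
  have E: "(LINT x|?J. w x * poly ?S x) = (\<Sum>n\<le>N. jinner n a b v / jnorm n a b * jinner n a b w)"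
    if "sq_int a b w" for w
    unfolding jsum_def jinner_def[of _ _ _ w]
    by (rule integral_times_poly_sum[OF sq_int_integrable[OF that ab]])
  have "(LINT x|?J. v x * poly ?S x) = (\<Sum>n\<le>N. energy n a b v)"
    using E[OF v] by (simp add: energy_def power2_eq_square)
  moreover have "(LINT x|?J. (poly ?S x)\<^sup>2) = (\<Sum>n\<le>N. energy n a b v)"
    using E[OF sq_int_poly[OF ab, of ?S]] jinner_jsum[OF ab, of _ N v] by (simp add: energy_def power2_eq_square)
  moreover have "(LINT x|?J. (v x - poly ?S x)\<^sup>2)
     = (LINT x|?J. (v x)\<^sup>2) - 2 * (LINT x|?J. v x * poly ?S x) + (LINT x|?J. (poly ?S x)\<^sup>2)"
    unfolding eq using i by (simp add: Bochner_Integration.integral_diff Bochner_Integration.integral_add)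
  ultimately show "(LINT x|?J. (v x - poly ?S x)\<^sup>2) = (LINT x|?J. (v x)\<^sup>2) - (\<Sum>n\<le>N. energy n a b v)"
    by simp
qed

lemma bessel:
  assumes "-1 < a" "-1 < b" "sq_int a b v"
  shows "(\<Sum>n\<le>N. energy n a b v) \<le> (LINT x|jac_measure a b. (v x)\<^sup>2)"
proof -
  have "0 \<le> (LINT x|jac_measure a b. (v x - poly (jsum N a b v) x)\<^sup>2)"
    by (intro Bochner_Integration.integral_nonneg) auto
  then show ?thesis using residual_energy(1)[OF assms, of N] by simp
qed

section \<open>Regularity and decay of the coefficients\<close>

text \<open>A chain \<open>v\<close>, \<open>v'\<close>, and so on of \<open>n\<close> successive derivatives, the \<open>j\<close>-th of which satisfies
  \<open>P j\<close>. The last one is known only almost everywhere; all others are continuous. The predicate \<open>P\<close> is a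
  parameter because the weighted and the essentially bounded case share the passage from weak derivatives.\<close>

primrec iterated :: "(nat \<Rightarrow> (real \<Rightarrow> real) \<Rightarrow> bool) \<Rightarrow> nat \<Rightarrow> (real \<Rightarrow> real) \<Rightarrow> bool" where
  "iterated P 0 v \<longleftrightarrow> P 0 v"
| "iterated P (Suc n) v \<longleftrightarrow> P 0 v \<and> (\<exists>v'. primitive v v' \<and> iterated (\<lambda>j. P (Suc j)) n v')"

lemma iterated_0: "iterated P n v \<Longrightarrow> P 0 v"
  by (cases n) auto

definition jsob :: "nat \<Rightarrow> real \<Rightarrow> real \<Rightarrow> (real \<Rightarrow> real) \<Rightarrow> bool" where
  "jsob n a b = iterated (\<lambda>j. sq_int (a + real j) (b + real j)) n"

definition ess_bounded :: "(real \<Rightarrow> real) \<Rightarrow> bool" where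
  "ess_bounded \<kappa> \<longleftrightarrow> \<kappa> \<in> borel_measurable U01 \<and> (\<exists>B. AE x in U01. \<bar>\<kappa> x\<bar> \<le> B)"

definition bsob :: "nat \<Rightarrow> (real \<Rightarrow> real) \<Rightarrow> bool" where
  "bsob n = iterated (\<lambda>_. ess_bounded) n"

lemma jsob_0: "jsob 0 a b v \<longleftrightarrow> sq_int a b v"
  by (simp add: jsob_def)

lemma jsob_Suc: "jsob (Suc n) a b v \<longleftrightarrow> sq_int a b v \<and> (\<exists>v'. primitive v v' \<and> jsob n (a + 1) (b + 1) v')"
proof -
  have "(\<lambda>j. sq_int (a + real (Suc j)) (b + real (Suc j))) = (\<lambda>j. sq_int (a + 1 + real j) (b + 1 + real j))"
    by (simp add: add_ac)
  then show ?thesis unfolding jsob_def by simp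
qed

lemma jsob_sq_int: "jsob n a b v \<Longrightarrow> sq_int a b v"
  unfolding jsob_def by (drule iterated_0) simp

lemma bsob_0: "bsob 0 \<kappa> \<longleftrightarrow> ess_bounded \<kappa>" 
  and bsob_Suc: "bsob (Suc n) \<kappa> \<longleftrightarrow> ess_bounded \<kappa> \<and> (\<exists>\<kappa>'. primitive \<kappa> \<kappa>' \<and> bsob n \<kappa>')"
  by (simp_all add: bsob_def)

lemma bsob_ess_bounded: "bsob n v \<Longrightarrow> ess_bounded v"
  unfolding bsob_def by (rule iterated_0)

lemma sq_int_add:
  assumes "sq_int a b v" "sq_int a b w" shows "sq_int a b (\<lambda>x. v x + w x)"
proof -
  have "(\<lambda>x. (v x + w x)\<^sup>2) = (\<lambda>x. (v x)\<^sup>2 + 2 * (v x * w x) + (w x)\<^sup>2)"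
    by (simp add: fun_eq_iff power2_sum)
  moreover have "integrable (jac_measure a b) (\<lambda>x. (v x)\<^sup>2 + 2 * (v x * w x) + (w x)\<^sup>2)"
    using assms sq_int_mult_integrable[OF assms]
    by (intro Bochner_Integration.integrable_add integrable_mult_right) (auto simp: sq_int_def)
  ultimately show ?thesis using assms by (auto simp: sq_int_def intro: borel_measurable_add)
qed

lemma sq_int_mult_bounded:
  assumes v: "sq_int a b v" and \<kappa>: "ess_bounded \<kappa>" shows "sq_int a b (\<lambda>x. v x * \<kappa> x)"
proof -
  obtain B where B: "AE x in U01. \<bar>\<kappa> x\<bar> \<le> B" using \<kappa> by (auto simp: ess_bounded_def)
  have m: "v \<in> borel_measurable U01" "\<kappa> \<in> borel_measurable U01" using v \<kappa> by (auto simp: sq_int_def ess_bounded_def)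
  have "integrable (jac_measure a b) (\<lambda>x. (v x * \<kappa> x)\<^sup>2)"
  proof (rule Bochner_Integration.integrable_bound[of _ "\<lambda>x. B\<^sup>2 * (v x)\<^sup>2"])
    show "integrable (jac_measure a b) (\<lambda>x. B\<^sup>2 * (v x)\<^sup>2)" using v by (simp add: sq_int_def)
    show "(\<lambda>x. (v x * \<kappa> x)\<^sup>2) \<in> borel_measurable (jac_measure a b)"
      unfolding jac_measure_measurable using m by (intro borel_measurable_power borel_measurable_times)
    show "AE x in jac_measure a b. norm ((v x * \<kappa> x)\<^sup>2) \<le> norm (B\<^sup>2 * (v x)\<^sup>2)"
      using jac_measure_AE[OF B]
    proof eventually_elim
      fix x assume "\<bar>\<kappa> x\<bar> \<le> B"
      then have "(\<kappa> x)\<^sup>2 \<le> B\<^sup>2" by (metis abs_ge_zero power2_abs power_mono)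
      then show "norm ((v x * \<kappa> x)\<^sup>2) \<le> norm (B\<^sup>2 * (v x)\<^sup>2)"
        by (simp add: power_mult_distrib mult.commute mult_right_mono)
    qed
  qed
  then show ?thesis using m by (auto simp: sq_int_def intro: borel_measurable_times)
qed

lemma sq_int_weight_mono:
  assumes "sq_int a b v" "a \<le> a'" "b \<le> b'" shows "sq_int a' b' v"
proof -
  have m: "v \<in> borel_measurable U01" "(\<lambda>x. (v x)\<^sup>2) \<in> borel_measurable U01"
    using assms(1) by (auto simp: sq_int_def)
  have "integrable U01 (\<lambda>x. wgt a' b' x * (v x)\<^sup>2)"
  proof (rule integrable_U01_bound)
    show "integrable U01 (\<lambda>x. wgt a b x * (v x)\<^sup>2)"
      using assms(1) m by (simp add: sq_int_def jac_measure_integrable)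
    show "(\<lambda>x. wgt a' b' x * (v x)\<^sup>2) \<in> borel_measurable U01"
      by (intro borel_measurable_times m borel_measurable_U01 wgt_measurable)
    fix x :: real assume "0 < x" "x < 1"
    then have "wgt a' b' x \<le> wgt a b x" unfolding wgt_def
      using assms(2,3) by (intro mult_mono powr_mono') auto
    then show "\<bar>wgt a' b' x * (v x)\<^sup>2\<bar> \<le> \<bar>wgt a b x * (v x)\<^sup>2\<bar>"
      by (simp add: abs_mult wgt_nonneg mult_right_mono)
  qed
  then show ?thesis using m by (simp add: sq_int_def jac_measure_integrable)
qed

lemma jsob_weight_mono: "jsob n a b v \<Longrightarrow> a \<le> a' \<Longrightarrow> b \<le> b' \<Longrightarrow> jsob n a' b' v"
proof (induction n arbitrary: a b a' b' v)
  case 0 then show ?case using sq_int_weight_mono by (simp add: jsob_0)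
next
  case (Suc n)
  then obtain v' where "sq_int a b v" "primitive v v'" "jsob n (a + 1) (b + 1) v'" by (auto simp: jsob_Suc)
  then show ?case using Suc.IH[of "a + 1" "b + 1" v' "a' + 1" "b' + 1"] Suc.prems sq_int_weight_mono[of a b v a' b']
    unfolding jsob_Suc by (intro conjI exI[of _ v']) auto
qed

lemma jsob_SucD: "jsob (Suc n) a b v \<Longrightarrow> jsob n a b v"
proof (induction n arbitrary: a b v)
  case 0 then show ?case by (simp add: jsob_Suc jsob_0)
next
  case (Suc n)
  then obtain v' where "sq_int a b v" "primitive v v'" "jsob (Suc n) (a + 1) (b + 1) v'"
    using jsob_Suc[of "Suc n"] by blast
  then show ?case using Suc.IH jsob_Suc[of n] by blast
qed

lemma bsob_SucD: "bsob (Suc n) v \<Longrightarrow> bsob n v"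
proof (induction n arbitrary: v)
  case 0 then show ?case by (simp add: bsob_Suc bsob_0)
next
  case (Suc n)
  then obtain v' where "ess_bounded v" "primitive v v'" "bsob (Suc n) v'"
    using bsob_Suc[of "Suc n"] by blast
  then show ?case using Suc.IH bsob_Suc[of n] by blast
qed

lemma jsob_add: "jsob n a b v \<Longrightarrow> jsob n a b w \<Longrightarrow> jsob n a b (\<lambda>x. v x + w x)"
proof (induction n arbitrary: a b v w)
  case 0 then show ?case using sq_int_add by (simp add: jsob_0)
next
  case (Suc n)
  then obtain v' w' where *: "sq_int a b v" "primitive v v'" "jsob n (a + 1) (b + 1) v'"
     "sq_int a b w" "primitive w w'" "jsob n (a + 1) (b + 1) w'" by (auto simp: jsob_Suc)
  show ?case unfolding jsob_Suc
    using sq_int_add[OF *(1,4)] primitive_add[OF *(2,5)] Suc.IH[OF *(3,6)] by blast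
qed

text \<open>The Leibniz rule term by term: differentiating \<open>\<kappa>\<close> instead of \<open>v\<close> leaves the weight of \<open>v\<close> too
  small by one in both exponents, which is harmless as the weights decrease with their exponents.\<close>

lemma jsob_mult: "jsob n a b v \<Longrightarrow> bsob n \<kappa> \<Longrightarrow> jsob n a b (\<lambda>x. v x * \<kappa> x)"
proof (induction n arbitrary: a b v \<kappa>)
  case 0 then show ?case using sq_int_mult_bounded by (simp add: jsob_0 bsob_0)
next
  case (Suc n)
  obtain v' \<kappa>' where *: "sq_int a b v" "primitive v v'" "jsob n (a + 1) (b + 1) v'"
     "ess_bounded \<kappa>" "primitive \<kappa> \<kappa>'" "bsob n \<kappa>'" using Suc.prems by (auto simp: jsob_Suc bsob_Suc)
  have "jsob n (a + 1) (b + 1) (\<lambda>x. v' x * \<kappa> x)"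
    by (rule Suc.IH[OF *(3) bsob_SucD[OF Suc.prems(2)]])
  moreover have "jsob n (a + 1) (b + 1) (\<lambda>x. v x * \<kappa>' x)"
    by (rule Suc.IH[OF jsob_weight_mono[OF jsob_SucD[OF Suc.prems(1)]] *(6)]) auto
  ultimately have "jsob n (a + 1) (b + 1) (\<lambda>x. v' x * \<kappa> x + v x * \<kappa>' x)" by (rule jsob_add)
  then show ?case unfolding jsob_Suc
    using sq_int_mult_bounded[OF *(1,4)] primitive_mult[OF *(2,5)] by blast
qed

text \<open>Integration by parts multiplies the inner product by \<open>m + 1\<close>, and the norms of the polynomials are
  related by \<open>jnorm_Suc\<close>. The assumption on \<open>a + b\<close> says that the remaining quotient is at most 1.\<close>

lemma energy_Suc:
  assumes ab: "-1 < a" "-1 < b" "-1 \<le> a + b" and v: "sq_int a b v" "primitive v v'" "sq_int (a + 1) (b + 1) v'"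
  shows "energy (Suc m) a b v \<le> energy m (a + 1) (b + 1) v' / (real (Suc m))\<^sup>2"
proof -
  define X where "X = jinner (Suc m) a b v"
  define h where "h = jnorm m (a + 1) (b + 1)"
  have h: "0 < h" unfolding h_def using ab by (intro jnorm_pos) auto
  have Y: "jinner m (a + 1) (b + 1) v' = real (Suc m) * X"
    unfolding jinner_def X_def
    by (rule jacobi_integration_by_parts[symmetric, OF ab(1,2) v(2)])
       (use sq_int_integrable v ab in auto)
  have H: "jnorm (Suc m) a b = (real m + a + b + 2) * h / real (Suc m)"
    using jnorm_Suc[OF ab(1,2), of m] unfolding h_def by (simp add: field_simps)
  have "energy (Suc m) a b v = X\<^sup>2 * real (Suc m) / ((real m + a + b + 2) * h)"
    unfolding energy_def H X_def[symmetric] by simp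
  also have "\<dots> \<le> X\<^sup>2 * real (Suc m) / (real (Suc m) * h)"
    using h ab by (intro divide_left_mono mult_right_mono mult_pos_pos) auto
  also have "\<dots> = X\<^sup>2 / h" by simp
  also have "\<dots> = energy m (a + 1) (b + 1) v' / (real (Suc m))\<^sup>2"
    unfolding energy_def Y h_def[symmetric] by (simp add: power_mult_distrib)
  finally show ?thesis .
qed

text \<open>Induction on the number of derivatives, with Bessel's inequality at the start. Passing to \<open>v'\<close> lowers
  the indices by one, which costs a power of 4 in the constant; the tail from \<open>N = 0\<close> contains the index 0, to
  which \<open>energy_Suc\<close> does not apply, and is bounded by Bessel's inequality instead.\<close>

lemma energy_tail:
  assumes "-1 < a" "-1 < b" "-1 \<le> a + b" "jsob n a b v"
  shows "\<exists>C\<ge>0. \<forall>N M. (\<Sum>m=N..M. energy m a b v) \<le> C / real (N + 1) ^ (2 * n)"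
  using assms
proof (induction n arbitrary: a b v)
  case 0
  then have v: "sq_int a b v" by (simp add: jsob_0)
  have "(\<Sum>m=N..M. energy m a b v) \<le> (LINT x|jac_measure a b. (v x)\<^sup>2)" for N M
    using bessel[OF 0(1,2) v, of M] sum_mono2[of "{..M}" "{N..M}" "\<lambda>m. energy m a b v"]
      energy_nonneg[OF 0(1,2)] by force
  then show ?case by (intro exI[of _ "LINT x|jac_measure a b. (v x)\<^sup>2"]) auto
next
  case (Suc n)
  obtain v' where v: "sq_int a b v" "primitive v v'" "jsob n (a + 1) (b + 1) v'"
    using Suc.prems by (auto simp: jsob_Suc)
  have v': "sq_int (a + 1) (b + 1) v'" using v(3) by (rule jsob_sq_int)
  obtain C where C: "C \<ge> 0" "\<And>N M. (\<Sum>m=N..M. energy m (a + 1) (b + 1) v') \<le> C / real (N + 1) ^ (2 * n)"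
    using Suc.IH[of "a + 1" "b + 1" v'] Suc.prems v(3) by auto
  let ?E = "LINT x|jac_measure a b. (v x)\<^sup>2"
  have E0: "?E \<ge> 0" by (intro Bochner_Integration.integral_nonneg) auto
  show ?case
  proof (intro exI[of _ "?E + C * 4 ^ (n + 1)"] conjI allI)
    show "0 \<le> ?E + C * 4 ^ (n + 1)" using E0 C(1) by simp
    fix N M
    show "(\<Sum>m=N..M. energy m a b v) \<le> (?E + C * 4 ^ (n + 1)) / real (N + 1) ^ (2 * Suc n)"
    proof (cases N)
      case 0
      have "(\<Sum>m=N..M. energy m a b v) \<le> ?E"
        using bessel[OF Suc.prems(1,2) v(1), of M] 0 by (simp add: atMost_atLeast0)
      moreover have "0 \<le> C * 4 ^ (n + 1)" using C(1) by simp
      ultimately show ?thesis using 0 by simp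
    next
      case (Suc k)
      have "(\<Sum>m=N..M. energy m a b v) \<le> (\<Sum>m=N..Suc M. energy m a b v)"
        by (rule sum_mono2) (use energy_nonneg[OF Suc.prems(1,2)] in auto)
      also have "\<dots> = (\<Sum>m=k..M. energy (Suc m) a b v)"
        unfolding Suc by (rule sum.shift_bounds_cl_Suc_ivl)
      also have "\<dots> \<le> (\<Sum>m=k..M. energy m (a + 1) (b + 1) v' / (real (k + 1))\<^sup>2)"
      proof (rule sum_mono)
        fix m assume m: "m \<in> {k..M}"
        have "energy (Suc m) a b v \<le> energy m (a + 1) (b + 1) v' / (real (Suc m))\<^sup>2"
          by (rule energy_Suc) (use Suc.prems v v' in auto)
        also have "\<dots> \<le> energy m (a + 1) (b + 1) v' / (real (k + 1))\<^sup>2"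
          using m energy_nonneg[of "a + 1" "b + 1" m v'] Suc.prems
          by (intro divide_left_mono power_mono mult_pos_pos) auto
        finally show "energy (Suc m) a b v \<le> energy m (a + 1) (b + 1) v' / (real (k + 1))\<^sup>2" .
      qed
      also have "\<dots> = (\<Sum>m=k..M. energy m (a + 1) (b + 1) v') / (real (k + 1))\<^sup>2"
        by (simp add: sum_divide_distrib)
      also have "\<dots> \<le> C / real (k + 1) ^ (2 * n) / (real (k + 1))\<^sup>2"
        by (intro divide_right_mono C) auto
      also have "\<dots> = C / real (k + 1) ^ (2 * Suc n)" by (simp add: power2_eq_square)
      also have "\<dots> \<le> C * 4 ^ (n + 1) / real (N + 1) ^ (2 * Suc n)"
      proof -
        have "real (N + 1) ^ (2 * Suc n) \<le> (2 * real (k + 1)) ^ (2 * Suc n)"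
          using Suc by (intro power_mono) auto
        also have "\<dots> = 4 ^ (n + 1) * real (k + 1) ^ (2 * Suc n)"
          unfolding power_mult_distrib by (simp add: power_mult)
        finally have *: "real (N + 1) ^ (2 * Suc n) \<le> 4 ^ (n + 1) * real (k + 1) ^ (2 * Suc n)" .
        have "C / real (k + 1) ^ (2 * Suc n) = C * 4 ^ (n + 1) / (4 ^ (n + 1) * real (k + 1) ^ (2 * Suc n))"
          by simp
        also have "\<dots> \<le> C * 4 ^ (n + 1) / real (N + 1) ^ (2 * Suc n)"
          using * C(1) by (intro divide_left_mono) auto
        finally show ?thesis .
      qed
      also have "\<dots> \<le> (?E + C * 4 ^ (n + 1)) / real (N + 1) ^ (2 * Suc n)"
        using E0 by (intro divide_right_mono) auto
      finally show ?thesis .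
    qed
  qed
qed

section \<open>From Sobolev spaces to chains of derivatives\<close>

lemma set_integrable_sub_U01:
  fixes f :: "real \<Rightarrow> real"
  assumes "S \<subseteq> {0<..<1}"
  shows "set_integrable lebesgue S f \<longleftrightarrow> integrable U01 (\<lambda>x. indicator S x * f x)"
    and "(LINT x:S|lebesgue. f x) = (LINT x|U01. indicator S x * f x)"
proof -
  have *: "indicator {0<..<1} x *\<^sub>R (indicator S x * f x) = indicator S x *\<^sub>R f x" for x
    using assms by (auto simp: indicator_def)
  show "set_integrable lebesgue S f \<longleftrightarrow> integrable U01 (\<lambda>x. indicator S x * f x)"
    unfolding set_integrable_U01[symmetric] set_integrable_def * ..
  show "(LINT x:S|lebesgue. f x) = (LINT x|U01. indicator S x * f x)"
    unfolding set_integral_U01[symmetric] set_lebesgue_integral_def * ..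
qed

lemma locally_integrable_cong_AE:
  assumes "locally_integrable g" "AE x in U01. g x = h x" "h \<in> borel_measurable U01"
  shows "locally_integrable h"
  unfolding locally_integrable_def
proof (intro allI impI)
  fix a b :: real assume ab: "0 < a" "b < 1"
  have sub: "{a..b} \<subseteq> {0<..<1}" using ab by auto
  have "indicator {a..b} \<in> borel_measurable U01" by (rule borel_measurable_U01) simp
  then have m: "(\<lambda>x. indicator {a..b} x * h x) \<in> borel_measurable U01"
    using assms(3) by (rule borel_measurable_times)
  have i: "integrable U01 (\<lambda>x. indicator {a..b} x * g x)"
    using assms(1) ab set_integrable_sub_U01(1)[OF sub] by (auto simp: locally_integrable_def)
  have "AE x in U01. indicator {a..b} x * g x = indicator {a..b} x * h x"
    using assms(2) by eventually_elim simp
  then have "integrable U01 (\<lambda>x. indicator {a..b} x * h x)"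
    using integrable_cong_AE[OF borel_measurable_integrable[OF i] m] i by blast
  then show "set_integrable lebesgue {a..b} h" using set_integrable_sub_U01(1)[OF sub] by blast
qed

text \<open>The representatives have to be chosen from the highest derivative downwards: an indefinite integral of
  \<open>g (Suc j)\<close> is also one of any function that agrees with it almost everywhere.\<close>

lemma iterated_of_weak_derivs:
  assumes cong: "\<And>j g h. P j g \<Longrightarrow> (AE x in U01. g x = h x) \<Longrightarrow> h \<in> borel_measurable U01 \<Longrightarrow> P j h"
    and meas: "\<And>j g. P j g \<Longrightarrow> g \<in> borel_measurable U01"
    and P: "\<And>j. j \<le> n \<Longrightarrow> P j (g j)"
    and W: "\<And>j. j < n \<Longrightarrow> has_weak_deriv 1 (g j) (g (Suc j))"
  shows "\<exists>v. iterated P n v \<and> (AE x in U01. v x = g 0 x)"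
  using assms
proof (induction n arbitrary: P g)
  case 0
  have "iterated P 0 (g 0)" using 0(3)[of 0] by simp
  then show ?case by blast
next
  case (Suc n)
  have "\<exists>v. iterated (\<lambda>j. P (Suc j)) n v \<and> (AE x in U01. v x = g (Suc 0) x)"
  proof (rule Suc.IH[of "\<lambda>j. P (Suc j)" "\<lambda>j. g (Suc j)"])
    show "P (Suc j) h" if "P (Suc j) g" "AE x in U01. g x = h x" "h \<in> borel_measurable U01" for j g h
      using that by (rule Suc.prems(1))
    show "g \<in> borel_measurable U01" if "P (Suc j) g" for j g
      using that by (rule Suc.prems(2))
    show "P (Suc j) (g (Suc j))" if "j \<le> n" for j
      using that by (intro Suc.prems(3)) simp
    show "has_weak_deriv 1 (g (Suc j)) (g (Suc (Suc j)))" if "j < n" for j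
      using that by (intro Suc.prems(4)) simp
  qed
  then obtain v' where v': "iterated (\<lambda>j. P (Suc j)) n v'" "AE x in U01. v' x = g (Suc 0) x" by blast
  have wd: "has_weak_deriv 1 (g 0) (g (Suc 0))" using Suc.prems(4)[of 0] by simp
  obtain V where V: "primitive V (g (Suc 0))" "AE x in U01. g 0 x = V x"
    using weak_deriv_primitive[OF wd] by blast
  have m': "v' \<in> borel_measurable U01" using iterated_0[OF v'(1)] Suc.prems(2) by blast
  have ae: "AE x in U01. g (Suc 0) x = v' x" using v'(2) by eventually_elim simp
  have "primitive V v'"
    by (rule primitive_cong_AE[OF V(1) ae locally_integrable_cong_AE[OF has_weak_derivD(2)[OF wd] ae m']])
  moreover have "V \<in> borel_measurable U01"
    by (rule continuous_measurable_U01[OF primitive_continuous[OF V(1)]])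
  then have "P 0 V" using Suc.prems(1)[OF Suc.prems(3)[of 0] V(2)] by simp
  moreover have "AE x in U01. V x = g 0 x" using V(2) by eventually_elim simp
  ultimately show ?case using v'(1) by (intro exI[of _ V]) auto
qed

lemma weak_deriv_step:
  assumes g: "has_weak_deriv j v g" and h: "has_weak_deriv (Suc j) v h"
  shows "has_weak_deriv 1 g h"
  unfolding has_weak_deriv_def
proof (intro conjI allI impI has_weak_derivD(2)[OF g] has_weak_derivD(2)[OF h])
  fix \<phi> assume t: "test_fun \<phi>"
  have "(-1) ^ j * (LINT x:{0<..<1}|lebesgue. g x * deriv \<phi> x)
      = (LINT x:{0<..<1}|lebesgue. v x * (deriv ^^ j) (deriv \<phi>) x)"
    using has_weak_derivD(3)[OF g test_fun_deriv[OF t]] by simp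
  also have "\<dots> = (LINT x:{0<..<1}|lebesgue. v x * (deriv ^^ Suc j) \<phi> x)"
    by (simp only: funpow_Suc_right o_apply)
  also have "\<dots> = (-1) ^ Suc j * (LINT x:{0<..<1}|lebesgue. h x * \<phi> x)"
    by (rule has_weak_derivD(3)[OF h t])
  finally have "(-1) ^ j * (LINT x:{0<..<1}|lebesgue. g x * deriv \<phi> x)
      = (-1) ^ j * - (LINT x:{0<..<1}|lebesgue. h x * \<phi> x)" by simp
  then show "(LINT x:{0<..<1}|lebesgue. g x * (deriv ^^ 1) \<phi> x)
      = (-1) ^ 1 * (LINT x:{0<..<1}|lebesgue. h x * \<phi> x)"
    by (subst (asm) mult_cancel_left) simp
qed

lemma sq_int_cong_AE:
  assumes "sq_int a b g" "AE x in U01. g x = h x" "h \<in> borel_measurable U01"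
  shows "sq_int a b h"
proof -
  have "AE x in jac_measure a b. (g x)\<^sup>2 = (h x)\<^sup>2"
    using jac_measure_AE[OF assms(2)] by eventually_elim simp
  moreover have "(\<lambda>x. (h x)\<^sup>2) \<in> borel_measurable (jac_measure a b)" "(\<lambda>x. (g x)\<^sup>2) \<in> borel_measurable (jac_measure a b)"
    using assms by (auto simp: jac_measure_measurable sq_int_def intro: borel_measurable_power)
  ultimately show ?thesis using assms integrable_cong_AE[of "\<lambda>x. (g x)\<^sup>2" "jac_measure a b" "\<lambda>x. (h x)\<^sup>2"]
    by (auto simp: sq_int_def)
qed

lemma ess_bounded_cong_AE:
  assumes "ess_bounded g" "AE x in U01. g x = h x" "h \<in> borel_measurable U01"
  shows "ess_bounded h"
proof -
  obtain B where "AE x in U01. \<bar>g x\<bar> \<le> B" using assms by (auto simp: ess_bounded_def)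
  with assms(2) have "AE x in U01. \<bar>h x\<bar> \<le> B" by eventually_elim simp
  then show ?thesis using assms(3) by (auto simp: ess_bounded_def)
qed

lemma in_wH_representative:
  assumes "in_wH n a b v"
  shows "\<exists>w. jsob n a b w \<and> (AE x in U01. w x = v x)"
proof -
  have "\<forall>j. \<exists>g. j \<le> n \<longrightarrow> has_weak_deriv j v g \<and> sq_int (a + real j) (b + real j) g"
    using assms unfolding in_wH_def in_wL2_iff by blast
  then obtain g where g: "\<And>j. j \<le> n \<Longrightarrow> has_weak_deriv j v (g j)"
      "\<And>j. j \<le> n \<Longrightarrow> sq_int (a + real j) (b + real j) (g j)" by metis
  have "\<exists>w. iterated (\<lambda>j. sq_int (a + real j) (b + real j)) n w \<and> (AE x in U01. w x = g 0 x)"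
  proof (rule iterated_of_weak_derivs)
    show "has_weak_deriv 1 (g j) (g (Suc j))" if "j < n" for j
      by (rule weak_deriv_step[OF g(1) g(1)]) (use that in auto)
    show "sq_int (a + real j) (b + real j) h"
      if "sq_int (a + real j) (b + real j) g" "AE x in U01. g x = h x" "h \<in> borel_measurable U01" for j g h
      using that by (rule sq_int_cong_AE)
    show "g \<in> borel_measurable U01" if "sq_int (a + real j) (b + real j) g" for j g
      using that by (simp add: sq_int_def)
  qed (rule g(2))
  then obtain w where w: "jsob n a b w" "AE x in U01. w x = g 0 x" by (auto simp: jsob_def)
  have "AE x in U01. g 0 x = v x" using weak_deriv_0_AE[OF g(1)[of 0]] by simp
  with w(2) have "AE x in U01. w x = v x" by eventually_elim simp
  with w(1) show ?thesis by blast
qed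

lemma in_Winf_representative:
  assumes "in_Winf n v"
  shows "\<exists>w. bsob n w \<and> (AE x in U01. w x = v x)"
proof -
  have "\<forall>j. \<exists>g. j \<le> n \<longrightarrow> has_weak_deriv j v g \<and> ess_bounded g"
    using assms locally_integrable_measurable has_weak_derivD(2)
    unfolding in_Winf_def ess_bounded_def by blast
  then obtain g where g: "\<And>j. j \<le> n \<Longrightarrow> has_weak_deriv j v (g j)" "\<And>j. j \<le> n \<Longrightarrow> ess_bounded (g j)"
    by metis
  have "\<exists>w. iterated (\<lambda>j. ess_bounded) n w \<and> (AE x in U01. w x = g 0 x)"
  proof (rule iterated_of_weak_derivs)
    show "has_weak_deriv 1 (g j) (g (Suc j))" if "j < n" for j
      by (rule weak_deriv_step[OF g(1) g(1)]) (use that in auto)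
    show "ess_bounded h"
      if "ess_bounded g" "AE x in U01. g x = h x" "h \<in> borel_measurable U01" for g h
      using that by (rule ess_bounded_cong_AE)
    show "g \<in> borel_measurable U01" if "ess_bounded g" for g
      using that by (simp add: ess_bounded_def)
  qed (rule g(2))
  then obtain w where w: "bsob n w" "AE x in U01. w x = g 0 x" by (auto simp: bsob_def)
  have "AE x in U01. g 0 x = v x" using weak_deriv_0_AE[OF g(1)[of 0]] by simp
  with w(2) have "AE x in U01. w x = v x" by eventually_elim simp
  with w(1) show ?thesis by blast
qed

section \<open>The antiderivative of the right-hand side\<close>

definition antideriv :: "(real \<Rightarrow> real) \<Rightarrow> real \<Rightarrow> real" where
  "antideriv f x = (LINT y:{0<..<x}|lebesgue. f y)"

lemma integrable_from_0:
  assumes f: "locally_integrable f" and i: "set_integrable lebesgue {0<..<q} f" and "0 < q" "r < 1"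
  shows "set_integrable lebesgue {0<..<r} f"
proof -
  have "set_integrable lebesgue {q/2..r} f" using f assms(3,4) by (auto simp: locally_integrable_def)
  then have "set_integrable lebesgue ({0<..<q} \<union> {q/2..r}) f"
    using i by (intro set_integrable_Un) auto
  then show ?thesis by (rule set_integrable_subset) auto
qed

lemma primitive_antideriv:
  assumes f: "locally_integrable f" and i: "set_integrable lebesgue {0<..<1/2} f"
  shows "primitive (antideriv f) f"
  unfolding primitive_def
proof (intro allI impI conjI)
  fix p q :: real assume pq: "0 < p" "p \<le> q" "q < 1"
  show pqi: "set_integrable lebesgue {p..q} f" using f pq by (auto simp: locally_integrable_def)
  have pi: "set_integrable lebesgue {0<..<p} f" by (rule integrable_from_0[OF f i]) (use pq in auto)
  have "antideriv f q = (LINT y:{0<..<p} \<union> {p..q}|lebesgue. f y)"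
    unfolding antideriv_def set_lebesgue_integral_def
  proof (rule integral_cong_AE)
    have qi: "set_integrable lebesgue {0<..<q} f" by (rule integrable_from_0[OF f i]) (use pq in auto)
    then show "(\<lambda>x. indicat_real {0<..<q} x *\<^sub>R f x) \<in> borel_measurable lebesgue"
      by (auto simp: set_integrable_def)
    have "set_integrable lebesgue ({0<..<p} \<union> {p..q}) f" using pi pqi by (intro set_integrable_Un) auto
    then show "(\<lambda>x. indicat_real ({0<..<p} \<union> {p..q}) x *\<^sub>R f x) \<in> borel_measurable lebesgue"
      by (auto simp: set_integrable_def)
    have "AE x in lebesgue. x \<noteq> q" using AE_completion[OF AE_lborel_singleton[of q]] .
    then show "AE x in lebesgue. indicat_real {0<..<q} x *\<^sub>R f x = indicat_real ({0<..<p} \<union> {p..q}) x *\<^sub>R f x"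
      by eventually_elim (use pq in \<open>auto simp: indicator_def\<close>)
  qed
  also have "\<dots> = (LINT y:{0<..<p}|lebesgue. f y) + (LINT y:{p..q}|lebesgue. f y)"
    by (rule set_integral_Un[OF _ pi pqi]) auto
  finally show "antideriv f q - antideriv f p = (LINT y:{p..q}|lebesgue. f y)"
    by (simp add: antideriv_def)
qed

lemma antideriv_eq_0:
  assumes f: "locally_integrable f" and i: "\<not> set_integrable lebesgue {0<..<1/2} f" and x: "0 < x" "x < 1"
  shows "antideriv f x = 0"
proof -
  have "\<not> set_integrable lebesgue {0<..<x} f" using integrable_from_0[OF f _ x(1), of "1/2"] i by auto
  then show ?thesis unfolding antideriv_def set_lebesgue_integral_def set_integrable_def
    by (rule not_integrable_integral_eq)
qed

text \<open>Split $|f| = (|f|\,\omega^{1/2})\,\omega^{-1/2}$ on $(1/2,x)$ by the inequality between the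
  arithmetic and the geometric mean with parameter $l = (1-x)^{a/4}$. The factor $1/\omega$ is bounded by
  $2(1-y)^{-a}$; one factor $(1-y)^{-a/2}$ of it is estimated by its value at $x$, the other one is integrable.\<close>

lemma antideriv_growth:
  assumes a: "0 < a" "a \<le> 1" and b: "0 < b" "b \<le> 1"
    and sq: "sq_int a b f" and p: "primitive F f" and F0: "\<And>x. 0 < x \<Longrightarrow> x \<le> 1/2 \<Longrightarrow> \<bar>F x\<bar> \<le> C0"
  shows "\<exists>C. \<forall>x. 0 < x \<longrightarrow> x < 1 \<longrightarrow> \<bar>F x\<bar> \<le> C * (1 - x) powr (- a / 4)"
proof -
  define E where "E = (LINT y|U01. wgt a b y * (f y)\<^sup>2)"
  define D where "D = (LINT y|U01. wgt (- a / 2) 0 y)"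
  have f2: "integrable U01 (\<lambda>y. wgt a b y * (f y)\<^sup>2)"
    using sq jac_measure_integrable[of "\<lambda>x. (f x)\<^sup>2" a b]
    by (auto simp: sq_int_def borel_measurable_power)
  have wi: "integrable U01 (wgt (- a / 2) 0)" using a by (intro wgt_integrable) auto
  have E0: "0 \<le> E" and D0: "0 \<le> D" unfolding E_def D_def
    by (intro Bochner_Integration.integral_nonneg mult_nonneg_nonneg wgt_nonneg zero_le_power2)+
  have C0: "0 \<le> C0" using F0[of "1/2"] by linarith
  have big: "1 \<le> (1 - x) powr (- a / 4)" if "0 < x" "x < 1" for x
    using that a powr_mono'[of "- a / 4" 0 "1 - x"] by simp
  have "\<bar>F x\<bar> \<le> (C0 + E / 2 + D) * (1 - x) powr (- a / 4)" if x: "0 < x" "x < 1" for x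
  proof (cases "x \<le> 1/2")
    case True
    have "\<bar>F x\<bar> \<le> C0 * 1" using F0 x True by simp
    also have "\<dots> \<le> (C0 + E / 2 + D) * (1 - x) powr (- a / 4)"
      using big[OF x] C0 E0 D0 by (intro mult_mono) auto
    finally show ?thesis .
  next
    case False
    define l where "l = (1 - x) powr (a / 4)"
    have l: "0 < l" "1 / l = (1 - x) powr (- a / 4)" using x by (auto simp: l_def powr_minus_divide)
    have sub: "{1/2..x} \<subseteq> {0<..<1}" using x by auto
    have fi: "set_integrable lebesgue {1/2..x} f" by (rule primitiveD(1)[OF p]) (use x False in auto)
    have fU: "integrable U01 (\<lambda>y. indicator {1/2..x} y * f y)"
      using fi set_integrable_sub_U01(1)[OF sub] by blast
    have key: "\<bar>indicator {1/2..x} y * f y\<bar>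
        \<le> (1 / l / 2) * (wgt a b y * (f y)\<^sup>2) + (1 / l) * wgt (- a / 2) 0 y" if y: "0 < y" "y < 1" for y
    proof (cases "y \<in> {1/2..x}")
      case False
      then show ?thesis using l by (auto simp: wgt_nonneg intro!: add_nonneg_nonneg mult_nonneg_nonneg)
    next
      case True
      define w where "w = wgt a b y"
      have w: "0 < w" unfolding w_def by (rule wgt_pos[OF y])
      have "1/2 \<le> y powr 1" using True y by simp
      also have "\<dots> \<le> y powr b" using b y by (intro powr_mono') auto
      finally have "(1 - y) powr a * (1/2) \<le> w" unfolding w_def wgt_def by (intro mult_left_mono) auto
      moreover have pa: "0 < (1 - y) powr a" using y by simp
      ultimately have "1 / w \<le> 1 / ((1 - y) powr a * (1/2))" by (intro divide_left_mono mult_pos_pos w) auto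
      also have "\<dots> = 2 * ((1 - y) powr (- a / 2) * (1 - y) powr (- a / 2))"
        by (simp add: powr_add[symmetric] powr_minus_divide)
      also have "\<dots> \<le> 2 * ((1 - y) powr (- a / 2) * (1 - x) powr (- a / 2))"
        using True y x a by (intro mult_left_mono powr_mono2') auto
      also have "(1 - x) powr (- a / 2) = (1 / l) * (1 / l)"
        unfolding l(2) by (simp add: powr_add[symmetric])
      finally have w': "1 / w \<le> 2 * ((1 - y) powr (- a / 2) * ((1 / l) * (1 / l)))" .
      have "0 \<le> (w / l) * (\<bar>f y\<bar> - l / w)\<^sup>2" using w l by simp
      also have "\<dots> = (w / l) * \<bar>f y\<bar>\<^sup>2 - 2 * \<bar>f y\<bar> * ((w / l) * (l / w)) + ((w / l) * (l / w)) * (l / w)"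
        by (simp add: power2_eq_square algebra_simps)
      also have "(w / l) * (l / w) = 1" using w l by simp
      finally have "2 * \<bar>f y\<bar> \<le> (1 / l) * (w * (f y)\<^sup>2) + l * (1 / w)" by simp
      also have "l * (1 / w) \<le> l * (2 * ((1 - y) powr (- a / 2) * ((1 / l) * (1 / l))))"
        using w' l by (intro mult_left_mono) auto
      also have "\<dots> = 2 * ((1 / l) * (1 - y) powr (- a / 2))"
        unfolding l(2)[symmetric] using l(1) by (simp add: field_simps)
      finally have "2 * \<bar>f y\<bar> \<le> (1 / l) * (w * (f y)\<^sup>2) + 2 * ((1 / l) * (1 - y) powr (- a / 2))" by simp
      moreover have "A \<le> B / 2 + C" if "2 * A \<le> B + 2 * C" for A B C :: real using that by simp
      ultimately have "\<bar>f y\<bar> \<le> (1 / l) * (w * (f y)\<^sup>2) / 2 + (1 / l) * (1 - y) powr (- a / 2)" by blast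
      moreover have "wgt (- a / 2) 0 y = (1 - y) powr (- a / 2)" using y by (simp add: wgt_def)
      ultimately show ?thesis using True by (simp add: w_def)
    qed
    have ri: "integrable U01 (\<lambda>y. (1 / l / 2) * (wgt a b y * (f y)\<^sup>2) + (1 / l) * wgt (- a / 2) 0 y)"
      by (intro Bochner_Integration.integrable_add integrable_mult_right f2 wi)
    have "\<bar>F x - F (1/2)\<bar> = \<bar>LINT y|U01. indicator {1/2..x} y * f y\<bar>"
      using primitiveD(2)[OF p, of "1/2" x] x False set_integrable_sub_U01(2)[OF sub, of f] by simp
    also have "\<dots> \<le> (LINT y|U01. \<bar>indicator {1/2..x} y * f y\<bar>)" by (rule integral_abs_bound)
    also have "\<dots> \<le> (LINT y|U01. (1 / l / 2) * (wgt a b y * (f y)\<^sup>2) + (1 / l) * wgt (- a / 2) 0 y)"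
      by (rule integral_mono[OF integrable_abs[OF fU] ri]) (use key in auto)
    also have "\<dots> = (1 / l / 2) * E + (1 / l) * D"
      unfolding E_def D_def integral_mult_right_zero[symmetric]
      by (rule Bochner_Integration.integral_add) (intro integrable_mult_right f2 wi)+
    finally have "\<bar>F x\<bar> \<le> C0 * 1 + (E / 2 + D) * (1 / l)"
      using F0[of "1/2"] by (simp add: algebra_simps)
    also have "\<dots> \<le> C0 * (1 / l) + (E / 2 + D) * (1 / l)"
      using mult_left_mono[OF big[OF x] C0] unfolding l(2) by simp
    also have "\<dots> = (C0 + E / 2 + D) * (1 - x) powr (- a / 4)" unfolding l(2)[symmetric] by (simp add: algebra_simps)
    finally show ?thesis .
  qed
  then show ?thesis by blast
qed

lemma sq_int_of_growth:
  assumes "0 < a" "-1 < b" "F \<in> borel_measurable U01"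
    and C: "\<And>x. 0 < x \<Longrightarrow> x < 1 \<Longrightarrow> \<bar>F x\<bar> \<le> C * (1 - x) powr (- a / 4)"
  shows "sq_int (a - 1) b F"
proof -
  have m: "(\<lambda>x. (F x)\<^sup>2) \<in> borel_measurable U01" using assms(3) by (rule borel_measurable_power)
  have "integrable U01 (\<lambda>x. wgt (a - 1) b x * (F x)\<^sup>2)"
  proof (rule integrable_U01_bound)
    show "integrable U01 (\<lambda>x. C\<^sup>2 * wgt (a / 2 - 1) b x)"
      using assms by (intro integrable_mult_right wgt_integrable) auto
    show "(\<lambda>x. wgt (a - 1) b x * (F x)\<^sup>2) \<in> borel_measurable U01"
      by (intro borel_measurable_times m borel_measurable_U01 wgt_measurable)
    fix x :: real assume x: "0 < x" "x < 1"
    have "(F x)\<^sup>2 \<le> (C * (1 - x) powr (- a / 4))\<^sup>2"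
      using power_mono[OF C[OF x], of 2] by simp
    also have "\<dots> = C\<^sup>2 * wgt (- a / 2) 0 x"
      using x by (simp add: power_mult_distrib wgt_def power2_eq_square powr_add[symmetric])
    finally have "wgt (a - 1) b x * (F x)\<^sup>2 \<le> wgt (a - 1) b x * (C\<^sup>2 * wgt (- a / 2) 0 x)"
      by (intro mult_left_mono wgt_nonneg)
    also have "\<dots> = C\<^sup>2 * (wgt (a - 1) b x * wgt (- a / 2) 0 x)" by simp
    also have "wgt (a - 1) b x * wgt (- a / 2) 0 x = wgt (a / 2 - 1) b x" by (simp add: wgt_add)
    finally show "\<bar>wgt (a - 1) b x * (F x)\<^sup>2\<bar> \<le> \<bar>C\<^sup>2 * wgt (a / 2 - 1) b x\<bar>"
      by (simp add: abs_mult wgt_nonneg)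
  qed
  then show ?thesis using m assms(3) by (simp add: sq_int_def jac_measure_integrable)
qed

lemma sq_int_const: "-1 < a \<Longrightarrow> -1 < b \<Longrightarrow> sq_int a b (\<lambda>_. c)"
proof -
  assume "-1 < a" "-1 < b"
  moreover have "poly [:c:] = (\<lambda>_. c)" by (simp add: fun_eq_iff)
  ultimately show ?thesis using sq_int_poly[of a b "[:c:]"] by metis
qed

lemma jsob_const: "-1 < a \<Longrightarrow> -1 < b \<Longrightarrow> jsob n a b (\<lambda>_. c)"
proof (induction n arbitrary: a b c)
  case 0 then show ?case using sq_int_const by (simp add: jsob_0)
next
  case (Suc n)
  have "jsob n (a + 1) (b + 1) (\<lambda>_. 0)" using Suc by auto
  moreover have "sq_int a b (\<lambda>_. c)" using Suc sq_int_const by simp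
  ultimately show ?case unfolding jsob_Suc using primitive_const[of c] by blast
qed

lemma primitive_cong:
  assumes "primitive v g" "\<And>x. 0 < x \<Longrightarrow> x < 1 \<Longrightarrow> v x = w x" shows "primitive w g"
  using assms unfolding primitive_def by auto

lemma jsob_cong:
  assumes "jsob n a b v" "\<And>x. 0 < x \<Longrightarrow> x < 1 \<Longrightarrow> v x = w x" shows "jsob n a b w"
proof -
  have "v \<in> borel_measurable U01" using jsob_sq_int[OF assms(1)] by (simp add: sq_int_def)
  then have "w \<in> borel_measurable U01" using measurable_cong[of U01 v w] assms(2) by auto
  then have "sq_int a b w"
    by (rule sq_int_cong_AE[OF jsob_sq_int[OF assms(1)], rotated]) (use assms(2) in \<open>auto intro!: AE_I2\<close>)
  moreover have "primitive w v'" if "primitive v v'" for v'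
    using that assms(2) by (rule primitive_cong)
  ultimately show ?thesis
    using assms(1) by (cases n) (auto simp: jsob_0 jsob_Suc)
qed

text \<open>There are two cases. If \<open>f\<close> is integrable at 0, then \<open>antideriv f\<close> has the derivative \<open>f\<close>,
  and it is square integrable since by \<open>antideriv_growth\<close> it is small compared with the weight. Otherwise
  the integral from 0 to \<open>x\<close> diverges for every \<open>x\<close>, so \<open>antideriv f\<close> has the default value 0
  throughout, which is as regular as one wants.\<close>

lemma antideriv_jsob:
  assumes a: "0 < a" "a \<le> 1" and b: "0 < b" "b \<le> 1" and f: "in_wH n a b f"
  shows "jsob (Suc n) (a - 1) (b - 1) (antideriv f)"
proof -
  obtain f0 where f0: "jsob n a b f0" "AE x in U01. f0 x = f x" using in_wH_representative[OF f] by blast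
  obtain g where "has_weak_deriv 0 f g" using f unfolding in_wH_def by blast
  then have lf: "locally_integrable f" by (rule has_weak_derivD(1))
  have fm: "f \<in> borel_measurable U01" by (rule locally_integrable_measurable[OF lf])
  show ?thesis
  proof (cases "set_integrable lebesgue {0<..<1/2} f")
    case False
    have "jsob (Suc n) (a - 1) (b - 1) (\<lambda>_. 0)" using a b by (intro jsob_const) auto
    then show ?thesis by (rule jsob_cong) (use antideriv_eq_0[OF lf False] in auto)
  next
    case True
    have p: "primitive (antideriv f) f" by (rule primitive_antideriv[OF lf True])
    have ae: "AE x in U01. f x = f0 x" using f0(2) by eventually_elim simp
    have f0m: "f0 \<in> borel_measurable U01" using jsob_sq_int[OF f0(1)] by (simp add: sq_int_def)
    have p0: "primitive (antideriv f) f0"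
      by (rule primitive_cong_AE[OF p ae locally_integrable_cong_AE[OF lf ae f0m]])
    have F0: "\<bar>antideriv f x\<bar> \<le> (LINT y:{0<..<1/2}|lebesgue. \<bar>f y\<bar>)" if x: "0 < x" "x \<le> 1/2" for x
    proof -
      have xi: "set_integrable lebesgue {0<..<x} f" by (rule set_integrable_subset[OF True]) (use x in auto)
      have "\<bar>antideriv f x\<bar> \<le> (LINT y:{0<..<x}|lebesgue. \<bar>f y\<bar>)"
        unfolding antideriv_def using set_integral_norm_bound[OF xi] by simp
      also have "\<dots> \<le> (LINT y:{0<..<1/2}|lebesgue. \<bar>f y\<bar>)"
        unfolding set_lebesgue_integral_def
      proof (rule integral_mono)
        show "integrable lebesgue (\<lambda>y. indicator {0<..<x} y *\<^sub>R \<bar>f y\<bar>)"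
          using set_integrable_abs[OF xi] by (simp add: set_integrable_def)
        show "integrable lebesgue (\<lambda>y. indicator {0<..<1/2} y *\<^sub>R \<bar>f y\<bar>)"
          using set_integrable_abs[OF True] by (simp add: set_integrable_def)
      qed (use x in \<open>auto simp: indicator_def\<close>)
      finally show ?thesis .
    qed
    have sf: "sq_int a b f" by (rule sq_int_cong_AE[OF jsob_sq_int[OF f0(1)] f0(2) fm])
    obtain C where C: "\<And>x. 0 < x \<Longrightarrow> x < 1 \<Longrightarrow> \<bar>antideriv f x\<bar> \<le> C * (1 - x) powr (- a / 4)"
      using antideriv_growth[OF a b sf p F0] by blast
    have "sq_int (a - 1) (b - 1) (antideriv f)"
      by (rule sq_int_of_growth[OF a(1) _ _ C])
         (use b continuous_measurable_U01[OF primitive_continuous[OF p]] in auto)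
    then show ?thesis unfolding jsob_Suc using p0 f0(1) by auto
  qed
qed

lemma rhs_jsob:
  assumes \<beta>: "0 < \<beta>" "\<beta> \<le> 1" and \<gamma>: "0 < \<gamma>" "\<gamma> \<le> 1"
    and f: "in_wH n \<beta> \<gamma> f" and K: "in_Winf (n + 1) (\<lambda>x. 1 / K x)"
  shows "\<exists>G. jsob (Suc n) (\<beta> - 1) (\<gamma> - 1) G \<and> (AE x in U01. G x = rhs1 K f x - A * rhs2 K x)"
proof -
  obtain \<kappa> where \<kappa>: "bsob (Suc n) \<kappa>" "AE x in U01. \<kappa> x = 1 / K x"
    using in_Winf_representative[OF K] by auto
  let ?G = "\<lambda>x. (antideriv f x + - A) * \<kappa> x"
  have "jsob (Suc n) (\<beta> - 1) (\<gamma> - 1) ?G"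
    using \<beta> \<gamma> by (intro jsob_mult jsob_add antideriv_jsob f jsob_const \<kappa>) auto
  moreover have "AE x in U01. ?G x = rhs1 K f x - A * rhs2 K x"
    using \<kappa>(2) by eventually_elim (simp add: rhs1_def rhs2_def antideriv_def algebra_simps)
  ultimately show ?thesis by blast
qed

text \<open>The essential supremum of the zeroth weak derivative lies between \<open>c\<close> and a finite bound, so
  that its conversion to a real number is faithful.\<close>

lemma Winf_norm_pos:
  assumes "in_Winf n v" "0 < c" "\<And>x. 0 < x \<Longrightarrow> x < 1 \<Longrightarrow> c \<le> v x"
  shows "0 < Winf_norm n v"
proof -
  obtain g B where g: "has_weak_deriv 0 v g" "AE x in U01. \<bar>g x\<bar> \<le> B"
    using assms(1) unfolding in_Winf_def by blast
  let ?w = "weak_deriv 0 v"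
  have w: "has_weak_deriv 0 v ?w" by (rule has_weak_deriv_weak_deriv[OF g(1)])
  have m: "(\<lambda>x. ereal \<bar>?w x\<bar>) \<in> borel_measurable U01"
    using locally_integrable_measurable[OF has_weak_derivD(2)[OF w]] by measurable
  have "AE x in U01. ereal \<bar>?w x\<bar> \<le> ereal B"
    using weak_deriv_unique[OF w g(1)] g(2) by eventually_elim simp
  then have up: "esssup U01 (\<lambda>x. ereal \<bar>?w x\<bar>) \<le> ereal B" by (rule esssup_I[OF m])
  have "AE x in U01. ?w x = v x" by (rule weak_deriv_0_AE[OF w])
  moreover have "AE x in U01. c \<le> v x" by (rule AE_I2) (use assms(3) in auto)
  moreover have "AE x in U01. ereal \<bar>?w x\<bar> \<le> esssup U01 (\<lambda>x. ereal \<bar>?w x\<bar>)" by (rule esssup_AE)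
  ultimately have ae: "AE x in U01. ereal c \<le> esssup U01 (\<lambda>x. ereal \<bar>?w x\<bar>)"
  proof eventually_elim
    fix x assume *: "?w x = v x" "c \<le> v x" "ereal \<bar>?w x\<bar> \<le> esssup U01 (\<lambda>x. ereal \<bar>?w x\<bar>)"
    have "ereal c \<le> ereal \<bar>?w x\<bar>" using * by simp
    then show "ereal c \<le> esssup U01 (\<lambda>x. ereal \<bar>?w x\<bar>)" using *(3) order_trans by blast
  qed
  have low: "ereal c \<le> esssup U01 (\<lambda>x. ereal \<bar>?w x\<bar>)"
  proof (rule ccontr)
    assume "\<not> ?thesis"
    then have "AE x in lebesgue. x \<notin> {0<..<1::real}" using ae by (auto simp: unit_interval_AE_iff)
    then have "{0<..<1::real} \<in> null_sets lebesgue" by (subst AE_iff_null_sets) auto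
    then show False by (simp add: null_sets_def)
  qed
  have "0 < Linf_norm ?w" unfolding Linf_norm_def
    using up low assms(2) by (cases "esssup U01 (\<lambda>x. ereal \<bar>?w x\<bar>)") auto
  also have "\<dots> \<le> Winf_norm n v" unfolding Winf_norm_def by (intro Max_ge) auto
  finally show ?thesis .
qed

section \<open>The two-sided Abel kernel\<close>

lemma nn_integral_U01: "(\<integral>\<^sup>+x. ennreal (f x) \<partial>U01) = (\<integral>\<^sup>+x. ennreal (indicator {0<..<1} x * f x) \<partial>lborel)"
proof -
  have "(\<integral>\<^sup>+x. ennreal (f x) \<partial>U01) = (\<integral>\<^sup>+x. ennreal (f x) * indicator {0<..<1} x \<partial>lebesgue)"
    by (rule nn_integral_restrict_space) simp
  also have "\<dots> = (\<integral>\<^sup>+x. ennreal (f x) * indicator {0<..<1} x \<partial>lborel)"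
    by (rule nn_integral_completion)
  also have "\<dots> = (\<integral>\<^sup>+x. ennreal (indicator {0<..<1} x * f x) \<partial>lborel)"
    by (rule nn_integral_cong) (auto simp: indicator_def)
  finally show ?thesis .
qed

lemma Beta_nn_integral:
  assumes "0 < u" "0 < v"
  shows "(\<integral>\<^sup>+t. ennreal (indicator {0<..<1} t * (t powr (u - 1) * (1 - t) powr (v - 1))) \<partial>lborel) = ennreal (Beta u v)"
  by (rule nn_integral_has_integral_lebesgue)
     (use has_integral_Beta_real[OF assms] in \<open>auto simp: has_integral_Icc_iff_Ioo\<close>)

text \<open>The exponents of the three factors add up to $-2$, the degree for which a projective substitution
  introduces no further factor: $u = z(1-y)/(1-yz)$ fixes 0 and 1, sends the third singularity $1/y$ to
  infinity and leaves a Beta integral.\<close>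

lemma Euler_integral_degenerate:
  assumes b: "-1 < b" and s: "0 < \<sigma>" and y: "0 < y" "y < 1" and ab: "a + b + \<sigma> = 0"
  shows "(\<integral>\<^sup>+z. ennreal (indicator {0<..<1} z * ((1 - z) powr (\<sigma> - 1) * z powr b * (1 - y * z) powr (a - 1))) \<partial>lborel)
       = ennreal (Beta (b + 1) \<sigma> * (1 - y) powr (- b - 1))"
proof -
  define f where "f u = u powr b * (1 - u) powr (\<sigma> - 1)" for u :: real
  define g where "g z = z * (1 - y) / (1 - y * z)" for z
  define g' where "g' z = (1 - y) / (1 - y * z)\<^sup>2" for z
  have pos: "0 < 1 - y * z" if "z \<in> {0..1}" for z
  proof -
    have "y * z \<le> y * 1" using that y by (intro mult_left_mono) auto
    then show ?thesis using y by linarith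
  qed
  have D: "(g has_real_derivative g' z) (at z)" if "z \<in> {0..1}" for z
    unfolding g_def g'_def using pos[OF that]
    by (auto intro!: derivative_eq_intros simp: field_simps power2_eq_square)
  have g01: "g 0 = 0" "g 1 = 1" using y by (auto simp: g_def)
  have null: "(\<integral>\<^sup>+z. ennreal (h z * indicator {0..1} z) \<partial>lborel) = (\<integral>\<^sup>+z. ennreal (indicator {0<..<1} z * h z) \<partial>lborel)"
    for h :: "real \<Rightarrow> real"
  proof (rule nn_integral_cong_AE)
    have "AE z in lborel. z \<noteq> (0::real)" "AE z in lborel. z \<noteq> (1::real)" by (rule AE_lborel_singleton)+
    then show "AE z in lborel. ennreal (h z * indicator {0..1} z) = ennreal (indicator {0<..<1} z * h z)"
      by eventually_elim (auto simp: indicator_def)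
  qed
  have "ennreal (Beta (b + 1) \<sigma>) = (\<integral>\<^sup>+t. ennreal (f t * indicator {g 0..g 1} t) \<partial>lborel)"
    using Beta_nn_integral[of "b + 1" \<sigma>] b s unfolding g01 null by (simp add: f_def)
  also have "\<dots> = (\<integral>\<^sup>+z. ennreal (f (g z) * g' z * indicator {0..1} z) \<partial>lborel)"
  proof (rule nn_integral_substitution)
    show "set_borel_measurable borel {g 0..g 1} f"
      unfolding set_borel_measurable_def f_def by measurable
    show "continuous_on {0..1} g'"
      unfolding g'_def using pos by (intro continuous_intros) (force simp: less_le)
    show "0 \<le> g' z" if "z \<in> {0..1}" for z using y by (simp add: g'_def)
  qed (use D in auto)
  also have "\<dots> = (\<integral>\<^sup>+z. ennreal (indicator {0<..<1} z * (f (g z) * g' z)) \<partial>lborel)" by (rule null)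
  also have "\<dots> = (\<integral>\<^sup>+z. ennreal ((1 - y) powr (b + 1)) * ennreal (indicator {0<..<1} z * ((1 - z) powr (\<sigma> - 1) * z powr b * (1 - y * z) powr (a - 1))) \<partial>lborel)"
  proof (rule nn_integral_cong)
    fix z
    have "f (g z) * g' z = (1 - y) powr (b + 1) * ((1 - z) powr (\<sigma> - 1) * z powr b * (1 - y * z) powr (a - 1))"
      if z: "0 < z" "z < 1"
    proof -
      let ?w = "1 - y * z"
      have w: "0 < ?w" using pos z by auto
      have 1: "1 - g z = (1 - z) / ?w" unfolding g_def using w by (simp add: field_simps)
      have 2: "?w powr (a - 1) = ?w powr (1 - \<sigma>) * ?w powr (- b) * ?w powr (-2)"
        using ab by (simp add: powr_add[symmetric]) (metis (no_types) add.commute add_diff_cancel_left' diff_add_eq diff_diff_eq2 diff_minus_eq_add eq_neg_iff_add_eq_0 minus_diff_eq one_add_one uminus_add_conv_diff)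
      have "f (g z) * g' z = (z powr b * (1 - y) powr b * ?w powr (- b)) * ((1 - z) powr (\<sigma> - 1) * ?w powr (1 - \<sigma>)) * ((1 - y) * ?w powr (-2))"
      proof -
        have e1: "g z powr b = z powr b * (1 - y) powr b * ?w powr (- b)"
          unfolding g_def using w z y by (simp add: powr_divide powr_mult powr_minus_divide)
        have "?w powr (1 - \<sigma>) = ?w powr (- (\<sigma> - 1))" by simp
        also have "\<dots> = 1 / ?w powr (\<sigma> - 1)" by (rule powr_minus_divide)
        finally have e2: "((1 - z) / ?w) powr (\<sigma> - 1) = (1 - z) powr (\<sigma> - 1) * ?w powr (1 - \<sigma>)"
          using w z by (simp add: powr_divide)
        have e3: "g' z = (1 - y) * ?w powr (-2)"
          unfolding g'_def using w by (simp add: powr_minus_divide powr_numeral)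
        show ?thesis unfolding f_def 1 e1 e2 e3 ..
      qed
      also have "\<dots> = ((1 - y) powr b * (1 - y)) * ((1 - z) powr (\<sigma> - 1) * z powr b * (?w powr (1 - \<sigma>) * ?w powr (- b) * ?w powr (-2)))"
        by (simp only: mult_ac)
      also have "\<dots> = (1 - y) powr (b + 1) * ((1 - z) powr (\<sigma> - 1) * z powr b * ?w powr (a - 1))"
        unfolding 2 using y by (simp add: powr_add)
      finally show ?thesis .
    qed
    then show "ennreal (indicator {0<..<1} z * (f (g z) * g' z))
      = ennreal ((1 - y) powr (b + 1)) * ennreal (indicator {0<..<1} z * ((1 - z) powr (\<sigma> - 1) * z powr b * (1 - y * z) powr (a - 1)))"
      by (auto simp: indicator_def ennreal_mult')
  qed
  also have "\<dots> = ennreal ((1 - y) powr (b + 1)) * (\<integral>\<^sup>+z. ennreal (indicator {0<..<1} z * ((1 - z) powr (\<sigma> - 1) * z powr b * (1 - y * z) powr (a - 1))) \<partial>lborel)"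
    by (rule nn_integral_cmult) measurable
  finally have E: "ennreal (Beta (b + 1) \<sigma>) = ennreal ((1 - y) powr (b + 1)) * (\<integral>\<^sup>+z. ennreal (indicator {0<..<1} z * ((1 - z) powr (\<sigma> - 1) * z powr b * (1 - y * z) powr (a - 1))) \<partial>lborel)"
    (is "_ = _ * ?I") .
  have "?I = ennreal ((1 - y) powr (- b - 1) * (1 - y) powr (b + 1)) * ?I"
    using y by (simp add: powr_add[symmetric])
  also have "\<dots> = ennreal ((1 - y) powr (- b - 1)) * ennreal (Beta (b + 1) \<sigma>)"
    unfolding E by (simp add: ennreal_mult' mult.assoc)
  also have "\<dots> = ennreal (Beta (b + 1) \<sigma> * (1 - y) powr (- b - 1))"
    by (subst ennreal_mult'') (simp_all add: mult.commute)
  finally show ?thesis .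
qed

lemma Abel_weight_scaled:
  assumes ab: "a + b + \<sigma> = 0" and x: "0 < x" "x < 1"
  shows "(\<integral>\<^sup>+t. ennreal (indicator {0<..<x} t * ((x - t) powr (\<sigma> - 1) * wgt a b t)) \<partial>lborel)
     = (\<integral>\<^sup>+z. ennreal (indicator {0<..<1} z * ((1 - z) powr (\<sigma> - 1) * z powr b * (x powr (- a) * (1 - x * z) powr a))) \<partial>lborel)"
proof -
  let ?f = "\<lambda>t. indicator {0<..<x} t * ((x - t) powr (\<sigma> - 1) * wgt a b t)"
  have "(\<integral>\<^sup>+t. ennreal (?f t) \<partial>lborel) = ennreal \<bar>x\<bar> * (\<integral>\<^sup>+z. ennreal (?f (0 + x * z)) \<partial>lborel)"
    by (rule nn_integral_real_affine) (use x in auto)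
  also have "\<dots> = (\<integral>\<^sup>+z. ennreal \<bar>x\<bar> * ennreal (?f (0 + x * z)) \<partial>lborel)"
    by (rule nn_integral_cmult[symmetric]) measurable
  also have "\<dots> = (\<integral>\<^sup>+z. ennreal (indicator {0<..<1} z * ((1 - z) powr (\<sigma> - 1) * z powr b * (x powr (- a) * (1 - x * z) powr a))) \<partial>lborel)"
  proof (rule nn_integral_cong)
    fix z
    have 1: "indicator {0<..<x} (x * z) = (indicator {0<..<1} z :: real)"
      using x by (auto simp: indicator_def zero_less_mult_iff)
    have "x * ((x - x * z) powr (\<sigma> - 1) * wgt a b (x * z)) = (1 - z) powr (\<sigma> - 1) * z powr b * (x powr (- a) * (1 - x * z) powr a)"
      if z: "0 < z" "z < 1"
    proof -
      have "x - x * z = x * (1 - z)" by (simp add: algebra_simps)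
      then have "x * ((x - x * z) powr (\<sigma> - 1) * wgt a b (x * z))
         = (x powr 1 * x powr (\<sigma> - 1) * x powr b) * ((1 - z) powr (\<sigma> - 1) * z powr b * (1 - x * z) powr a)"
        using x z by (simp add: powr_mult wgt_def)
      also have "x powr 1 * x powr (\<sigma> - 1) * x powr b = x powr (1 + (\<sigma> - 1) + b)"
        by (simp only: powr_add)
      also have "1 + (\<sigma> - 1) + b = - a" using ab by simp
      finally show ?thesis by (simp only: mult_ac)
    qed
    then show "ennreal \<bar>x\<bar> * ennreal (?f (0 + x * z))
      = ennreal (indicator {0<..<1} z * ((1 - z) powr (\<sigma> - 1) * z powr b * (x powr (- a) * (1 - x * z) powr a)))"
      using x 1 by (cases "z \<in> {0<..<1}") (auto simp: ennreal_mult'[symmetric])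
  qed
  finally show ?thesis .
qed

text \<open>After scaling, the integrand on the left contains $x^{-a}(1-xz)^a = (x/(1-xz))^{-a}$, which is the integral
  over $y \in (0,x)$ of its derivative. Exchanging the order of integration leaves the integral of
  \<open>Euler_integral_degenerate\<close>.\<close>

lemma Abel_weight_integral:
  assumes a: "a < 0" and b: "-1 < b" and s: "0 < \<sigma>" and ab: "a + b + \<sigma> = 0" and x: "0 < x" "x < 1"
  shows "(\<integral>\<^sup>+t. ennreal (indicator {0<..<x} t * ((x - t) powr (\<sigma> - 1) * wgt a b t)) \<partial>lborel)
     = ennreal (- a * Beta (b + 1) \<sigma>) * (\<integral>\<^sup>+y. ennreal (indicator {0<..<x} y * wgt (- b - 1) (- a - 1) y) \<partial>lborel)"
proof -
  define h where "h z y = indicator {0<..<x} y * indicator {0<..<1} z *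
     (((1 - z) powr (\<sigma> - 1) * z powr b) * (- a * y powr (- a - 1) * (1 - y * z) powr (a - 1)))" for z y :: real
  have hm: "(\<lambda>(z, y). ennreal (h z y)) \<in> borel_measurable (lborel \<Otimes>\<^sub>M lborel)"
    unfolding h_def by measurable
  have inner1: "(\<integral>\<^sup>+y. ennreal (h z y) \<partial>lborel)
     = ennreal (indicator {0<..<1} z * ((1 - z) powr (\<sigma> - 1) * z powr b * (x powr (- a) * (1 - x * z) powr a)))" for z
  proof (cases "z \<in> {0<..<1}")
    case True
    have pos: "0 < 1 - y * z" if "y \<in> {0..x}" for y
    proof -
      have "y * z \<le> 1 * z" using that x True by (intro mult_right_mono) auto
      also have "\<dots> < 1" using True by simp
      finally show ?thesis by simp
    qed
    define w where "w y = (y / (1 - y * z)) powr (- a)" for y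
    have "((\<lambda>y. - a * y powr (- a - 1) * (1 - y * z) powr (a - 1)) has_integral (w x - w 0)) {0..x}"
    proof (rule fundamental_theorem_of_calculus_interior)
      show "continuous_on {0..x} w" unfolding w_def
        using pos a by (intro continuous_intros continuous_on_powr') (force simp: less_le)+
      fix y assume y: "y \<in> {0<..<x}"
      then have w0: "0 < 1 - y * z" using pos by auto
      have "((\<lambda>y. y / (1 - y * z)) has_real_derivative 1 / (1 - y * z)\<^sup>2) (at y)"
        using w0 by (auto intro!: derivative_eq_intros simp: field_simps power2_eq_square)
      from DERIV_fun_powr[OF this, of "- a"]
      have "(w has_real_derivative - a * (y / (1 - y * z)) powr (- a - 1) * (1 / (1 - y * z)\<^sup>2)) (at y)"
        unfolding w_def using y w0 by simp
      also have "- a * (y / (1 - y * z)) powr (- a - 1) * (1 / (1 - y * z)\<^sup>2) = - a * y powr (- a - 1) * (1 - y * z) powr (a - 1)"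
      proof -
        have "(1 - y * z) powr (a - 1) = (1 - y * z) powr (- (- a - 1) + (-2))" by simp
        also have "\<dots> = (1 - y * z) powr (- (- a - 1)) * (1 - y * z) powr (- 2)" by (rule powr_add)
        also have "\<dots> = 1 / (1 - y * z) powr (- a - 1) * (1 / (1 - y * z)\<^sup>2)"
          using w0 by (simp only: powr_minus_divide) (simp add: powr_numeral)
        finally show ?thesis using w0 y by (simp add: powr_divide)
      qed
      finally show "(w has_vector_derivative - a * y powr (- a - 1) * (1 - y * z) powr (a - 1)) (at y)"
        by (simp add: has_real_derivative_iff_has_vector_derivative)
    qed (use x in auto)
    moreover have "w x - w 0 = x powr (- a) * (1 - x * z) powr a"
      using pos[of x] x a by (simp add: w_def powr_divide powr_minus_divide field_simps)
    ultimately have "((\<lambda>y. ((1 - z) powr (\<sigma> - 1) * z powr b) * (- a * y powr (- a - 1) * (1 - y * z) powr (a - 1)))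
        has_integral ((1 - z) powr (\<sigma> - 1) * z powr b) * (x powr (- a) * (1 - x * z) powr a)) {0<..<x}"
      unfolding has_integral_Icc_iff_Ioo by (intro has_integral_mult_right) simp
    moreover have "0 \<le> ((1 - z) powr (\<sigma> - 1) * z powr b) * (- a * y powr (- a - 1) * (1 - y * z) powr (a - 1))" for y
      using a by (intro mult_nonneg_nonneg) auto
    ultimately have "(\<integral>\<^sup>+y. ennreal (indicator {0<..<x} y *
        (((1 - z) powr (\<sigma> - 1) * z powr b) * (- a * y powr (- a - 1) * (1 - y * z) powr (a - 1)))) \<partial>lborel)
      = ennreal (((1 - z) powr (\<sigma> - 1) * z powr b) * (x powr (- a) * (1 - x * z) powr a))"
      by (intro nn_integral_has_integral_lebesgue)
    moreover have "indicator {0<..<1} z = (1 :: real)" using True by simp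
    ultimately show ?thesis unfolding h_def by (simp only: mult_1_left mult_1_right)
  qed (simp add: h_def)
  have inner2: "(\<integral>\<^sup>+z. ennreal (h z y) \<partial>lborel)
     = ennreal (- a * Beta (b + 1) \<sigma>) * ennreal (indicator {0<..<x} y * wgt (- b - 1) (- a - 1) y)" for y
  proof (cases "y \<in> {0<..<x}")
    case True
    then have y: "0 < y" "y < 1" using x by auto
    have "(\<integral>\<^sup>+z. ennreal (h z y) \<partial>lborel) = (\<integral>\<^sup>+z. ennreal (- a * y powr (- a - 1)) *
        ennreal (indicator {0<..<1} z * ((1 - z) powr (\<sigma> - 1) * z powr b * (1 - y * z) powr (a - 1))) \<partial>lborel)"
    proof (rule nn_integral_cong)
      fix z
      have 0: "0 \<le> - a * y powr (- a - 1)" using a by (simp add: mult_nonpos_nonneg)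
      show "ennreal (h z y) = ennreal (- a * y powr (- a - 1)) *
          ennreal (indicator {0<..<1} z * ((1 - z) powr (\<sigma> - 1) * z powr b * (1 - y * z) powr (a - 1)))"
        unfolding ennreal_mult'[OF 0, symmetric] h_def using True by (simp add: mult_ac)
    qed
    also have "\<dots> = ennreal (- a * y powr (- a - 1)) * ennreal (Beta (b + 1) \<sigma> * (1 - y) powr (- b - 1))"
      unfolding Euler_integral_degenerate[OF b s y ab, symmetric]
      by (rule nn_integral_cmult) measurable
    also have "\<dots> = ennreal ((- a * Beta (b + 1) \<sigma>) * (indicator {0<..<x} y * wgt (- b - 1) (- a - 1) y))"
      using True a by (subst ennreal_mult'[symmetric]) (auto simp: wgt_def mult_ac mult_nonpos_nonneg)
    also have "\<dots> = ennreal (- a * Beta (b + 1) \<sigma>) * ennreal (indicator {0<..<x} y * wgt (- b - 1) (- a - 1) y)"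
      by (rule ennreal_mult'') (auto simp: wgt_nonneg)
    finally show ?thesis .
  qed (simp add: h_def)
  have "(\<integral>\<^sup>+t. ennreal (indicator {0<..<x} t * ((x - t) powr (\<sigma> - 1) * wgt a b t)) \<partial>lborel)
     = (\<integral>\<^sup>+z. (\<integral>\<^sup>+y. ennreal (h z y) \<partial>lborel) \<partial>lborel)"
    unfolding inner1 by (rule Abel_weight_scaled[OF ab x])
  also have "\<dots> = (\<integral>\<^sup>+y. (\<integral>\<^sup>+z. ennreal (h z y) \<partial>lborel) \<partial>lborel)"
    by (rule lborel_pair.Fubini'[OF hm, symmetric])
  also have "\<dots> = ennreal (- a * Beta (b + 1) \<sigma>) * (\<integral>\<^sup>+y. ennreal (indicator {0<..<x} y * wgt (- b - 1) (- a - 1) y) \<partial>lborel)"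
    unfolding inner2 by (rule nn_integral_cmult) measurable
  finally show ?thesis .
qed

text \<open>The two parameters are $\beta$ and $\alpha-\beta$. Treating them on equal footing exposes the symmetry of
  the problem under reflection and transposition, and their sum is $\alpha$.\<close>

definition admissible :: "real \<Rightarrow> real \<Rightarrow> bool" where
  "admissible p q \<longleftrightarrow> 0 < p \<and> p \<le> 1 \<and> 0 < q \<and> q \<le> 1 \<and> 1 < p + q \<and> p + q < 2"

lemma admissible_sym: "admissible p q \<Longrightarrow> admissible q p"
  by (auto simp: admissible_def)

text \<open>Up to a common factor this is the kernel of the transposed operator for the parameters $p=\beta$,
  $q=\alpha-\beta$. The value on the diagonal is 0 so that the transpose is obtained by exchanging the
  parameters everywhere (\<open>abel_ker_sym\<close>).\<close>

definition abel_ker :: "real \<Rightarrow> real \<Rightarrow> real \<Rightarrow> real \<Rightarrow> real" where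
  "abel_ker p q x t =
     (if t < x then sin (pi * q) * (x - t) powr (1 - (p + q))
      else if x < t then sin (pi * p) * (t - x) powr (1 - (p + q)) else 0)"

lemma abel_ker_sym: "abel_ker p q t x = abel_ker q p x t"
  by (auto simp: abel_ker_def add.commute)

lemma sin_pi_mult_nonneg: "0 \<le> p \<Longrightarrow> p \<le> 1 \<Longrightarrow> 0 \<le> sin (pi * p)"
  by (rule sin_ge_zero) auto

lemma abel_ker_nonneg: "admissible p q \<Longrightarrow> 0 \<le> abel_ker p q x t"
  by (auto simp: abel_ker_def admissible_def sin_pi_mult_nonneg)

lemma abel_ker_measurable [measurable]:
  "(\<lambda>z. abel_ker p q (fst z) (snd z)) \<in> borel_measurable (borel \<Otimes>\<^sub>M borel)"
  unfolding abel_ker_def by measurable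

lemma abel_ker_measurable_prod:
  "(\<lambda>z. abel_ker p q (fst z) (snd z)) \<in> borel_measurable (U01 \<Otimes>\<^sub>M U01)"
proof -
  have "(\<lambda>z. (fst z, snd z)) \<in> U01 \<Otimes>\<^sub>M U01 \<rightarrow>\<^sub>M borel \<Otimes>\<^sub>M borel"
    by (intro measurable_Pair measurable_compose[OF measurable_fst ident_measurable_U01]
          measurable_compose[OF measurable_snd ident_measurable_U01])
  from measurable_compose[OF this abel_ker_measurable] show ?thesis by simp
qed

lemma abel_ker_measurable_snd: "(\<lambda>t. abel_ker p q x t) \<in> borel_measurable U01"
  by (rule borel_measurable_U01) (unfold abel_ker_def, measurable)

lemma Gamma_reflection_real:
  assumes "0 < z" "z < 1"
  shows "sin (pi * z) * (Gamma z * Gamma (1 - z :: real)) = pi"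
proof -
  have s: "0 < sin (pi * z)" using assms by (intro sin_gt_zero) auto
  have "complex_of_real (Gamma z * Gamma (1 - z)) = Gamma (of_real z) * Gamma (1 - of_real z)"
    using Gamma_complex_of_real[of z] Gamma_complex_of_real[of "1 - z"] by simp
  also have "\<dots> = of_real pi / sin (of_real pi * of_real z)" by (rule Gamma_reflection_complex)
  also have "\<dots> = complex_of_real (pi / sin (pi * z))" by (simp add: sin_of_real[symmetric])
  finally have "Gamma z * Gamma (1 - z) = pi / sin (pi * z)" by (simp only: of_real_eq_iff)
  then show ?thesis using s by simp
qed

lemma kernel_constant:
  assumes "0 < p" "p < 1" "0 < q" "q < 1"
  shows "sin (pi * q) * ((1 - p) * Beta q (2 - (p + q))) * Beta (1 - p) (1 - q) = pi"
proof -
  have "Gamma (1 - p + 1) = (1 - p) * Gamma (1 - p)"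
  proof (rule Gamma_plus1)
    show "1 - p \<notin> \<int>\<^sub>\<le>\<^sub>0" using assms nonpos_Ints_nonpos[of "1 - p"] by auto
  qed
  then have B1: "Beta q (2 - (p + q)) = Gamma q * Gamma (2 - (p + q)) / ((1 - p) * Gamma (1 - p))"
    unfolding Beta_def by (simp add: algebra_simps)
  have B2: "Beta (1 - p) (1 - q) = Gamma (1 - p) * Gamma (1 - q) / Gamma (2 - (p + q))"
    unfolding Beta_def by (simp add: algebra_simps)
  have pos: "0 < Gamma (1 - p)" "0 < Gamma (2 - (p + q))" "0 < 1 - p"
    using assms by (auto intro!: Gamma_real_pos)
  have "sin (pi * q) * ((1 - p) * Beta q (2 - (p + q))) * Beta (1 - p) (1 - q)
      = sin (pi * q) * (Gamma q * Gamma (1 - q))"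
  proof -
    have cancel: "S * (d * (Q * g2 / (d * g1))) * (g1 * R / g2) = S * (Q * R)"
      if "g1 \<noteq> 0" "g2 \<noteq> 0" "d \<noteq> 0" for S d Q g1 g2 R :: real
      using that by simp
    show ?thesis unfolding B1 B2 by (rule cancel) (use pos in linarith)+
  qed
  then show ?thesis using Gamma_reflection_real[of q] assms by simp
qed

lemma nn_integral_reflect:
  fixes f :: "real \<Rightarrow> real"
  assumes "f \<in> borel_measurable borel"
  shows "(\<integral>\<^sup>+t. ennreal (f t) \<partial>lborel) = (\<integral>\<^sup>+t. ennreal (f (1 - t)) \<partial>lborel)"
proof -
  have "(\<lambda>t. ennreal (f t)) \<in> borel_measurable borel" using assms by measurable
  from nn_integral_real_affine[OF this, of "-1" 1] show ?thesis by simp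
qed

text \<open>By \<open>Abel_weight_integral\<close>, and its reflection, the integral over $t<x$ is a multiple of the integral of
  $\omega^{(-q,-p)}$ over $(0,x)$, and the integral over $t>x$ is a multiple of that over $(x,1)$. By the
  reflection formula for the Gamma function the two sines make these multiples equal, so that the sum does not
  depend on $x$. If $p=1$ or $q=1$ the weight $\omega^{(-q,-p)}$ is not integrable, but then one of the
  sines is 0 and the remaining integral is a Beta integral by itself.\<close>

lemma abel_ker_weight_nn:
  assumes adm: "admissible p q" and x: "0 < x" "x < 1"
  shows "(\<integral>\<^sup>+t. ennreal (abel_ker p q x t * wgt (p - 1) (q - 1) t) \<partial>U01) = ennreal pi"
proof -
  have pq: "0 < p" "p \<le> 1" "0 < q" "q \<le> 1" "1 < p + q" "p + q < 2" using adm by (auto simp: admissible_def)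
  define \<sigma> where "\<sigma> = 2 - (p + q)"
  have s: "0 < \<sigma>" "(p - 1) + (q - 1) + \<sigma> = 0" "(q - 1) + (p - 1) + \<sigma> = 0" "1 - (p + q) = \<sigma> - 1"
    using pq by (auto simp: \<sigma>_def)
  define I1 where "I1 = (\<integral>\<^sup>+t. ennreal (indicator {0<..<x} t * ((x - t) powr (\<sigma> - 1) * wgt (p - 1) (q - 1) t)) \<partial>lborel)"
  define I2 where "I2 = (\<integral>\<^sup>+t. ennreal (indicator {x<..<1} t * ((t - x) powr (\<sigma> - 1) * wgt (p - 1) (q - 1) t)) \<partial>lborel)"
  have sn: "0 \<le> sin (pi * p)" "0 \<le> sin (pi * q)" using pq by (auto intro: sin_pi_mult_nonneg)
  have "(\<integral>\<^sup>+t. ennreal (abel_ker p q x t * wgt (p - 1) (q - 1) t) \<partial>U01)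
     = (\<integral>\<^sup>+t. ennreal (sin (pi * q)) * ennreal (indicator {0<..<x} t * ((x - t) powr (\<sigma> - 1) * wgt (p - 1) (q - 1) t))
          + ennreal (sin (pi * p)) * ennreal (indicator {x<..<1} t * ((t - x) powr (\<sigma> - 1) * wgt (p - 1) (q - 1) t)) \<partial>lborel)"
    unfolding nn_integral_U01
  proof (rule nn_integral_cong)
    fix t :: real
    consider "t \<le> 0" | "1 \<le> t" | "t = x" | "0 < t" "t < x" | "x < t" "t < 1" by linarith
    then show "ennreal (indicator {0<..<1} t * (abel_ker p q x t * wgt (p - 1) (q - 1) t))
       = ennreal (sin (pi * q)) * ennreal (indicator {0<..<x} t * ((x - t) powr (\<sigma> - 1) * wgt (p - 1) (q - 1) t))
          + ennreal (sin (pi * p)) * ennreal (indicator {x<..<1} t * ((t - x) powr (\<sigma> - 1) * wgt (p - 1) (q - 1) t))"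
      by cases (use x sn in \<open>auto simp: abel_ker_def s(4) ennreal_mult'[symmetric] mult.assoc\<close>)
  qed
  also have "\<dots> = ennreal (sin (pi * q)) * I1 + ennreal (sin (pi * p)) * I2"
    unfolding I1_def I2_def by (subst nn_integral_add; (measurable)?) (simp add: nn_integral_cmult)
  also have "\<dots> = ennreal pi"
  proof -
    have I2': "I2 = (\<integral>\<^sup>+t. ennreal (indicator {0<..<1 - x} t * ((1 - x - t) powr (\<sigma> - 1) * wgt (q - 1) (p - 1) t)) \<partial>lborel)"
    proof -
      have "I2 = (\<integral>\<^sup>+t. ennreal (indicator {x<..<1} (1 - t) * ((1 - t - x) powr (\<sigma> - 1) * wgt (p - 1) (q - 1) (1 - t))) \<partial>lborel)"
        unfolding I2_def by (rule nn_integral_reflect) measurable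
      also have "\<dots> = (\<integral>\<^sup>+t. ennreal (indicator {0<..<1 - x} t * ((1 - x - t) powr (\<sigma> - 1) * wgt (q - 1) (p - 1) t)) \<partial>lborel)"
        by (rule nn_integral_cong) (auto simp: indicator_def wgt_def mult.commute algebra_simps)
      finally show ?thesis .
    qed
    have x': "0 < 1 - x" "1 - x < 1" using x by auto
    have edge: "(\<integral>\<^sup>+t. ennreal (indicator {0<..<y} t * ((y - t) powr (\<sigma> - 1) * wgt 0 (b - 1) t)) \<partial>lborel) = ennreal (Beta b (1 - b))"
      if b: "0 < b" "b < 1" "\<sigma> = 1 - b" and y: "0 < y" "y < 1" for y b
    proof -
      have "(\<integral>\<^sup>+t. ennreal (indicator {0<..<y} t * ((y - t) powr (\<sigma> - 1) * wgt 0 (b - 1) t)) \<partial>lborel)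
        = (\<integral>\<^sup>+z. ennreal (indicator {0<..<1} z * ((1 - z) powr (\<sigma> - 1) * z powr (b - 1) * (y powr (- 0) * (1 - y * z) powr 0))) \<partial>lborel)"
        by (rule Abel_weight_scaled) (use b y in auto)
      also have "\<dots> = (\<integral>\<^sup>+t. ennreal (indicator {0<..<1} t * (t powr (b - 1) * (1 - t) powr (1 - b - 1))) \<partial>lborel)"
      proof (rule nn_integral_cong)
        fix z
        have "y * z < 1" if "0 < z" "z < 1" using that y mult_strict_mono[of y 1 z 1] by simp
        then show "ennreal (indicator {0<..<1} z * ((1 - z) powr (\<sigma> - 1) * z powr (b - 1) * (y powr (- 0) * (1 - y * z) powr 0)))
           = ennreal (indicator {0<..<1} z * (z powr (b - 1) * (1 - z) powr (1 - b - 1)))"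
          using b y by (auto simp: indicator_def mult.commute)
      qed
      also have "\<dots> = ennreal (Beta b (1 - b))" by (rule Beta_nn_integral) (use b in auto)
      finally show ?thesis .
    qed
    have edge': "sin (pi * b) * Beta b (1 - b) = pi" if "0 < b" "b < 1" for b :: real
      using Gamma_reflection_real[OF that] by (simp add: Beta_def)
    consider "p = 1" "q < 1" | "q = 1" "p < 1" | "p < 1" "q < 1" using pq by linarith
    then show ?thesis
    proof cases
      case 1
      then have "I1 = ennreal (Beta q (1 - q))" unfolding I1_def using edge[of q x] x pq by (simp add: \<sigma>_def)
      then show ?thesis using 1 pq edge'[of q] sn by (simp add: ennreal_mult'[symmetric])
    next
      case 2
      then have "I2 = ennreal (Beta p (1 - p))" unfolding I2' using edge[of p "1 - x"] x' pq by (simp add: \<sigma>_def)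
      then show ?thesis using 2 pq edge'[of p] sn by (simp add: ennreal_mult'[symmetric])
    next
      case 3
      define B where "B = Beta (1 - p) (1 - q)"
      have B: "0 < B" unfolding B_def Beta_def using 3 pq by (intro divide_pos_pos mult_pos_pos Gamma_real_pos) auto
      define \<kappa> where "\<kappa> = pi / B"
      have k1: "sin (pi * q) * ((1 - p) * Beta q \<sigma>) = \<kappa>"
        using kernel_constant[of p q] 3 pq B by (simp add: \<kappa>_def B_def \<sigma>_def field_simps)
      have k2: "sin (pi * p) * ((1 - q) * Beta p \<sigma>) = \<kappa>"
        using kernel_constant[of q p] 3 pq B by (simp add: \<kappa>_def B_def \<sigma>_def field_simps Beta_commute add.commute)
      define N1 where "N1 = (\<integral>\<^sup>+y. ennreal (indicator {0<..<x} y * wgt (- q) (- p) y) \<partial>lborel)"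
      define N2 where "N2 = (\<integral>\<^sup>+y. ennreal (indicator {x<..<1} y * wgt (- q) (- p) y) \<partial>lborel)"
      have "I1 = ennreal ((1 - p) * Beta q \<sigma>) * N1"
        unfolding I1_def N1_def using Abel_weight_integral[of "p - 1" "q - 1" \<sigma> x] 3 pq s x by simp
      then have T1: "ennreal (sin (pi * q)) * I1 = ennreal \<kappa> * N1"
        using sn by (simp add: k1[symmetric] ennreal_mult'[symmetric] mult.assoc[symmetric])
      have "I2 = ennreal ((1 - q) * Beta p \<sigma>) * (\<integral>\<^sup>+y. ennreal (indicator {0<..<1 - x} y * wgt (- p) (- q) y) \<partial>lborel)"
        unfolding I2' using Abel_weight_integral[of "q - 1" "p - 1" \<sigma> "1 - x"] 3 pq s x' by simp
      also have "(\<integral>\<^sup>+y. ennreal (indicator {0<..<1 - x} y * wgt (- p) (- q) y) \<partial>lborel)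
        = (\<integral>\<^sup>+y. ennreal (indicator {0<..<1 - x} (1 - y) * wgt (- p) (- q) (1 - y)) \<partial>lborel)"
        by (rule nn_integral_reflect) measurable
      also have "\<dots> = N2" unfolding N2_def
        by (rule nn_integral_cong) (auto simp: indicator_def wgt_def mult.commute)
      finally have T2: "ennreal (sin (pi * p)) * I2 = ennreal \<kappa> * N2"
        using sn by (simp add: k2[symmetric] ennreal_mult'[symmetric] mult.assoc[symmetric])
      have "N1 + N2 = (\<integral>\<^sup>+y. ennreal (indicator {0<..<x} y * wgt (- q) (- p) y) + ennreal (indicator {x<..<1} y * wgt (- q) (- p) y) \<partial>lborel)"
        unfolding N1_def N2_def by (rule nn_integral_add[symmetric]) measurable
      also have "\<dots> = (\<integral>\<^sup>+y. ennreal (indicator {0<..<1} y * (y powr (1 - p - 1) * (1 - y) powr (1 - q - 1))) \<partial>lborel)"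
      proof (rule nn_integral_cong_AE)
        show "AE y in lborel. ennreal (indicator {0<..<x} y * wgt (- q) (- p) y) + ennreal (indicator {x<..<1} y * wgt (- q) (- p) y)
           = ennreal (indicator {0<..<1} y * (y powr (1 - p - 1) * (1 - y) powr (1 - q - 1)))"
          using AE_lborel_singleton[of x]
          by eventually_elim (use x in \<open>auto simp: indicator_def wgt_def mult.commute\<close>)
      qed
      also have "\<dots> = ennreal B" unfolding B_def by (rule Beta_nn_integral) (use 3 in auto)
      finally have N: "N1 + N2 = ennreal B" .
      have "ennreal (sin (pi * q)) * I1 + ennreal (sin (pi * p)) * I2 = ennreal \<kappa> * (N1 + N2)"
        unfolding T1 T2 by (simp add: distrib_left)
      also have "\<dots> = ennreal (\<kappa> * B)" unfolding N using B by (intro ennreal_mult''[symmetric]) auto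
      finally show ?thesis using B by (simp add: \<kappa>_def)
    qed
  qed
  finally show ?thesis .
qed

lemma abel_ker_weight:
  assumes "admissible p q" "0 < x" "x < 1"
  shows "integrable U01 (\<lambda>t. abel_ker p q x t * wgt (p - 1) (q - 1) t)"
    and "(LINT t|U01. abel_ker p q x t * wgt (p - 1) (q - 1) t) = pi"
proof -
  have "has_bochner_integral U01 (\<lambda>t. abel_ker p q x t * wgt (p - 1) (q - 1) t) pi"
  proof (rule has_bochner_integral_nn_integral)
    show "(\<lambda>t. abel_ker p q x t * wgt (p - 1) (q - 1) t) \<in> borel_measurable U01"
      by (intro borel_measurable_times abel_ker_measurable_snd borel_measurable_U01 wgt_measurable)
    show "AE t in U01. 0 \<le> abel_ker p q x t * wgt (p - 1) (q - 1) t"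
      by (intro AE_I2 mult_nonneg_nonneg abel_ker_nonneg assms(1) wgt_nonneg)
  qed (use abel_ker_weight_nn[OF assms] in auto)
  then show "integrable U01 (\<lambda>t. abel_ker p q x t * wgt (p - 1) (q - 1) t)"
    "(LINT t|U01. abel_ker p q x t * wgt (p - 1) (q - 1) t) = pi"
    by (auto simp: has_bochner_integral_iff)
qed

text \<open>The polynomial carries its weight along: the transform is applied to $\omega^{(p-1,q-1)}P$.\<close>

definition abel_transform :: "real \<Rightarrow> real \<Rightarrow> real poly \<Rightarrow> real \<Rightarrow> real" where
  "abel_transform p q P x = (LINT t|U01. abel_ker p q x t * (wgt (p - 1) (q - 1) t * poly P t))"

lemma abel_transform_integrable:
  assumes "admissible p q" "0 < x" "x < 1"
  shows "integrable U01 (\<lambda>t. abel_ker p q x t * (wgt (p - 1) (q - 1) t * poly P t))"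
proof -
  obtain B where B: "\<And>t. 0 < t \<Longrightarrow> t < 1 \<Longrightarrow> \<bar>poly P t\<bar> \<le> B" using poly_bounded by blast
  show ?thesis
  proof (rule integrable_U01_bound)
    show "integrable U01 (\<lambda>t. B * (abel_ker p q x t * wgt (p - 1) (q - 1) t))"
      by (intro integrable_mult_right abel_ker_weight assms)
    show "(\<lambda>t. abel_ker p q x t * (wgt (p - 1) (q - 1) t * poly P t)) \<in> borel_measurable U01"
      by (intro borel_measurable_times abel_ker_measurable_snd borel_measurable_U01 wgt_measurable poly_measurable_U01)
    fix t :: real assume t: "0 < t" "t < 1"
    have k: "0 \<le> abel_ker p q x t * wgt (p - 1) (q - 1) t"
      by (intro mult_nonneg_nonneg abel_ker_nonneg assms wgt_nonneg)
    have "\<bar>abel_ker p q x t * (wgt (p - 1) (q - 1) t * poly P t)\<bar> = (abel_ker p q x t * wgt (p - 1) (q - 1) t) * \<bar>poly P t\<bar>"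
      using k by (simp add: abs_mult abel_ker_nonneg[OF assms(1)] wgt_nonneg)
    also have "\<dots> \<le> (abel_ker p q x t * wgt (p - 1) (q - 1) t) * B" by (intro mult_left_mono B t k)
    also have "\<dots> \<le> \<bar>B * (abel_ker p q x t * wgt (p - 1) (q - 1) t)\<bar>" by (simp add: mult.commute)
    finally show "\<bar>abel_ker p q x t * (wgt (p - 1) (q - 1) t * poly P t)\<bar> \<le> \<bar>B * (abel_ker p q x t * wgt (p - 1) (q - 1) t)\<bar>" .
  qed
qed

text \<open>The kernel is nonnegative and integrates the weight to the constant $\pi$, whereas \<open>P\<close> is bounded. So the
  inner integral of the absolute value is at most a constant times $|g|$.\<close>

lemma abel_swap:
  assumes adm: "admissible p q" and g: "integrable U01 g"
  shows "integrable U01 (\<lambda>x. (wgt (p - 1) (q - 1) x * poly P x) * (LINT t|U01. abel_ker q p x t * g t))" (is ?thesis1)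
    and "(LINT x|U01. (wgt (p - 1) (q - 1) x * poly P x) * (LINT t|U01. abel_ker q p x t * g t))
      = (LINT t|U01. g t * abel_transform p q P t)" (is ?thesis2)
    and "AE x in U01. integrable U01 (\<lambda>t. abel_ker q p x t * g t)" (is ?thesis3)
proof -
  interpret F: finite_measure U01 by (rule finite_measure_U01)
  interpret P: pair_sigma_finite U01 U01 by standard
  define h where "h P t x = abel_ker p q t x * (wgt (p - 1) (q - 1) x * poly P x) * g t" for P t x
  have gm: "g \<in> borel_measurable U01" using g by auto
  have hm: "(\<lambda>(t, x). h P t x) \<in> borel_measurable (U01 \<Otimes>\<^sub>M U01)" for P
    unfolding h_def case_prod_beta
    by (intro borel_measurable_times abel_ker_measurable_prod
          measurable_compose[OF measurable_fst gm]
          measurable_compose[OF measurable_snd borel_measurable_U01[OF wgt_measurable]]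
          measurable_compose[OF measurable_snd poly_measurable_U01])
  have hi: "integrable (U01 \<Otimes>\<^sub>M U01) (\<lambda>(t, x). h P t x)" for P
  proof -
    obtain B where B: "\<And>t. 0 < t \<Longrightarrow> t < 1 \<Longrightarrow> \<bar>poly P t\<bar> \<le> B" using poly_bounded by blast
    show ?thesis
    proof (rule P.Fubini_integrable[OF hm])
      show "AE t in U01. integrable U01 (\<lambda>x. case (t, x) of (t, x) \<Rightarrow> h P t x)"
        by (rule AE_I2) (auto simp: h_def intro!: integrable_mult_left abel_transform_integrable[OF adm])
      show "integrable U01 (\<lambda>t. LINT x|U01. norm (case (t, x) of (t, x) \<Rightarrow> h P t x))"
      proof (rule integrable_U01_bound)
        show "integrable U01 (\<lambda>t. B * pi * \<bar>g t\<bar>)" using g by simp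
        show "(\<lambda>t. LINT x|U01. norm (case (t, x) of (t, x) \<Rightarrow> h P t x)) \<in> borel_measurable U01"
          using hm[of P] by (intro F.borel_measurable_lebesgue_integral) (auto simp: case_prod_beta)
        fix t :: real assume t: "0 < t" "t < 1"
        have "(LINT x|U01. \<bar>h P t x\<bar>) \<le> (LINT x|U01. B * \<bar>g t\<bar> * (abel_ker p q t x * wgt (p - 1) (q - 1) x))"
        proof (rule integral_mono)
          show "integrable U01 (\<lambda>x. \<bar>h P t x\<bar>)" unfolding h_def
            by (intro integrable_abs integrable_mult_left abel_transform_integrable[OF adm] t)
          show "integrable U01 (\<lambda>x. B * \<bar>g t\<bar> * (abel_ker p q t x * wgt (p - 1) (q - 1) x))"
            by (intro integrable_mult_right abel_ker_weight adm t)
          fix x assume "x \<in> space U01"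
          then have x: "0 < x" "x < 1" by auto
          have "\<bar>h P t x\<bar> = \<bar>poly P x\<bar> * (\<bar>g t\<bar> * (abel_ker p q t x * wgt (p - 1) (q - 1) x))"
            by (simp add: h_def abs_mult abel_ker_nonneg[OF adm] wgt_nonneg)
          also have "\<dots> \<le> B * (\<bar>g t\<bar> * (abel_ker p q t x * wgt (p - 1) (q - 1) x))"
            by (intro mult_right_mono B x mult_nonneg_nonneg abel_ker_nonneg adm wgt_nonneg) auto
          finally show "\<bar>h P t x\<bar> \<le> B * \<bar>g t\<bar> * (abel_ker p q t x * wgt (p - 1) (q - 1) x)" by (simp add: mult.assoc)
        qed
        also have "\<dots> = B * \<bar>g t\<bar> * (LINT x|U01. abel_ker p q t x * wgt (p - 1) (q - 1) x)"
          by (rule integral_mult_right_zero)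
        also have "\<dots> = B * pi * \<bar>g t\<bar>" using abel_ker_weight(2)[OF adm t] by simp
        finally show "\<bar>LINT x|U01. norm (case (t, x) of (t, x) \<Rightarrow> h P t x)\<bar> \<le> \<bar>B * pi * \<bar>g t\<bar>\<bar>"
          by (simp add: Bochner_Integration.integral_nonneg)
      qed
    qed
  qed
  have hx: "(LINT t|U01. h P t x) = (wgt (p - 1) (q - 1) x * poly P x) * (LINT t|U01. abel_ker q p x t * g t)" for P x
    unfolding h_def integral_mult_right_zero[symmetric]
    by (rule Bochner_Integration.integral_cong[OF refl]) (simp add: abel_ker_sym mult_ac)
  have ht: "(LINT x|U01. h P t x) = g t * abel_transform p q P t" for P t
    unfolding h_def abel_transform_def by (simp add: mult.commute)
  show ?thesis1 using P.integrable_snd[OF hi[of P]] unfolding hx .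
  show ?thesis2 using P.Fubini_integral[OF hi[of P]] unfolding hx ht .
  show ?thesis3 using P.AE_integrable_snd[OF hi[of 1]]
  proof (rule AE_mp, intro AE_I2 impI)
    fix x assume "x \<in> space U01" and i: "integrable U01 (\<lambda>t. h 1 t x)"
    then have w: "0 < wgt (p - 1) (q - 1) x" by (auto intro: wgt_pos)
    have "(\<lambda>t. 1 / wgt (p - 1) (q - 1) x * h 1 t x) = (\<lambda>t. abel_ker q p x t * g t)"
      using w by (auto simp: h_def abel_ker_sym fun_eq_iff)
    then show "integrable U01 (\<lambda>t. abel_ker q p x t * g t)"
      using integrable_mult_right[OF i, of "1 / wgt (p - 1) (q - 1) x"] by simp
  qed
qed

section \<open>The kernel on weighted polynomials\<close>

lemma poly_antiderivative: "\<exists>Q. pderiv Q = (R :: real poly)"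
proof -
  have "pderiv (\<Sum>i\<le>degree R. monom (coeff R i / real (Suc i)) (Suc i)) = (\<Sum>i\<le>degree R. monom (coeff R i) i)"
    unfolding pderiv_sum_poly by (intro sum.cong refl) (simp add: pderiv_monom del: of_nat_Suc)
  then show ?thesis by (metis poly_as_sum_of_monoms)
qed

text \<open>The function $(t-y)$ times the kernel is continuous across the diagonal and differentiable off it.\<close>

lemma abel_ker_integral:
  assumes adm: "admissible p q" and x: "0 < u" "u \<le> x" "x < 1"
  shows "(LINT t|U01. indicator {u..x} t * abel_ker p q t y)
     = (abel_ker p q x y * (x - y) - abel_ker p q u y * (u - y)) / (2 - (p + q))"
proof -
  define \<sigma> where "\<sigma> = 2 - (p + q)"
  have s: "0 < \<sigma>" "1 - (p + q) = \<sigma> - 1" using adm by (auto simp: \<sigma>_def admissible_def)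
  define F where "F t = (if y \<le> t then sin (pi * q) * (t - y) powr \<sigma> else - (sin (pi * p) * (y - t) powr \<sigma>)) / \<sigma>" for t
  have F: "F t = abel_ker p q t y * (t - y) / \<sigma>" for t
  proof -
    consider "y < t" | "t = y" | "t < y" by linarith
    then show ?thesis
    proof cases
      case 1
      then have "(t - y) powr \<sigma> = (t - y) powr (\<sigma> - 1) * (t - y)"
        using powr_add[of "t - y" "\<sigma> - 1" 1] by simp
      then show ?thesis using 1 by (simp add: F_def abel_ker_def s(2))
    next
      case 3
      then have e: "(y - t) powr \<sigma> = (y - t) powr (\<sigma> - 1) * (y - t)"
        using powr_add[of "y - t" "\<sigma> - 1" 1] by simp
      show ?thesis using 3 by (simp add: e F_def abel_ker_def s(2) algebra_simps diff_divide_distrib)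
    qed (simp add: F_def abel_ker_def)
  qed
  have cont: "continuous_on {u..x} F"
  proof -
    have "continuous_on ({t. y \<le> t} \<union> {t. t \<le> y}) (\<lambda>t. if y \<le> t then sin (pi * q) * (t - y) powr \<sigma> else - (sin (pi * p) * (y - t) powr \<sigma>))"
    proof (rule continuous_on_cases)
      show "continuous_on {t. y \<le> t} (\<lambda>t. sin (pi * q) * (t - y) powr \<sigma>)"
        by (intro continuous_intros continuous_on_powr') (use s in auto)
      show "continuous_on {t. t \<le> y} (\<lambda>t. - (sin (pi * p) * (y - t) powr \<sigma>))"
        by (intro continuous_intros continuous_on_powr') (use s in auto)
    qed (use s in \<open>auto simp: closed_Collect_le\<close>)
    moreover have "{t. y \<le> t} \<union> {t. t \<le> y} = UNIV" by auto
    ultimately have "continuous_on UNIV F" unfolding F_def using s by (intro continuous_on_divide) auto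
    then show ?thesis by (rule continuous_on_subset) simp
  qed
  have "((\<lambda>t. abel_ker p q t y) has_integral (F x - F u)) {u..x}"
  proof (rule fundamental_theorem_of_calculus_interior_strong[of "{y}"])
    fix t assume t: "t \<in> {u<..<x} - {y}"
    have "(F has_real_derivative abel_ker p q t y) (at t)"
    proof (cases "y < t")
      case True
      have "((\<lambda>t. t - y) has_real_derivative 1) (at t)" by (auto intro!: derivative_eq_intros)
      from DERIV_cdivide[OF DERIV_cmult[OF DERIV_fun_powr[OF this, of \<sigma>]], of "sin (pi * q)" \<sigma>]
      have D: "((\<lambda>t. sin (pi * q) * (t - y) powr \<sigma> / \<sigma>) has_real_derivative abel_ker p q t y) (at t)"
        using True s(1) by (simp add: abel_ker_def s(2))
      have "eventually (\<lambda>t. t \<in> {y<..}) (nhds t)" using True by (intro eventually_nhds_in_open) auto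
      then have "eventually (\<lambda>t. sin (pi * q) * (t - y) powr \<sigma> / \<sigma> = F t) (nhds t)"
        by eventually_elim (simp add: F_def)
      from DERIV_cong_ev[OF refl this refl] D show ?thesis by blast
    next
      case False
      then have ty: "t < y" using t by auto
      have "((\<lambda>t. y - t) has_real_derivative - 1) (at t)" by (auto intro!: derivative_eq_intros)
      from DERIV_cdivide[OF DERIV_cmult[OF DERIV_fun_powr[OF this, of \<sigma>]], of "- sin (pi * p)" \<sigma>]
      have D: "((\<lambda>t. - sin (pi * p) * (y - t) powr \<sigma> / \<sigma>) has_real_derivative abel_ker p q t y) (at t)"
        using ty s(1) by (simp add: abel_ker_def s(2))
      have "eventually (\<lambda>t. t \<in> {..<y}) (nhds t)" using ty by (intro eventually_nhds_in_open) auto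
      then have "eventually (\<lambda>t. - sin (pi * p) * (y - t) powr \<sigma> / \<sigma> = F t) (nhds t)"
        by eventually_elim (simp add: F_def)
      from DERIV_cong_ev[OF refl this refl] D show ?thesis by blast
    qed
    then show "(F has_vector_derivative abel_ker p q t y) (at t)"
      by (simp add: has_real_derivative_iff_has_vector_derivative)
  qed (use x cont in auto)
  moreover from this have "(\<lambda>t. abel_ker p q t y) absolutely_integrable_on {u..x}"
    by (intro nonnegative_absolutely_integrable_1) (auto simp: abel_ker_nonneg[OF adm] has_integral_iff)
  ultimately have "(LINT t:{u..x}|lebesgue. abel_ker p q t y) = F x - F u"
    using set_lebesgue_integral_eq_integral(2) by (metis integral_unique)
  moreover have "{u..x} \<subseteq> {0<..<1}" using x by auto
  ultimately show ?thesis
    using set_integrable_sub_U01(2)[of "{u..x}" "\<lambda>t. abel_ker p q t y"]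
    by (simp add: F \<sigma>_def[symmetric] diff_divide_distrib)
qed

text \<open>Write $y^{m+1} = x y^m - (x-y) y^m$. The second term leads to $(x-y)$ times the kernel, which by
  \<open>abel_ker_integral\<close> is an indefinite integral in $x$ of a multiple of the kernel.\<close>

lemma abel_transform_monom_step:
  assumes adm: "admissible p q" and x: "0 < u" "u \<le> x" "x < 1"
  shows "(x * abel_transform p q (monom 1 m) x - abel_transform p q (monom 1 (Suc m)) x)
       - (u * abel_transform p q (monom 1 m) u - abel_transform p q (monom 1 (Suc m)) u)
     = (2 - (p + q)) * (LINT t:{u..x}|lebesgue. abel_transform p q (monom 1 m) t)"
proof -
  let ?S = "abel_transform p q" and ?\<sigma> = "2 - (p + q)" and ?w = "wgt (p - 1) (q - 1)"
  have \<sigma>: "?\<sigma> \<noteq> 0" using adm by (auto simp: admissible_def)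
  have sub: "{u..x} \<subseteq> {0<..<1}" using x by auto
  have e: "z * ?S (monom 1 m) z - ?S (monom 1 (Suc m)) z
      = (LINT y|U01. ?w y * y ^ m * (abel_ker p q z y * (z - y)))"
    and ei: "integrable U01 (\<lambda>y. ?w y * y ^ m * (abel_ker p q z y * (z - y)))"
    if z: "0 < z" "z < 1" for z
  proof -
    have i: "integrable U01 (\<lambda>y. z * (abel_ker p q z y * (?w y * poly (monom 1 m) y)))"
      "integrable U01 (\<lambda>y. abel_ker p q z y * (?w y * poly (monom 1 (Suc m)) y))"
      by (intro integrable_mult_right abel_transform_integrable adm z)+
    have eq: "(\<lambda>y. z * (abel_ker p q z y * (?w y * poly (monom 1 m) y)) - abel_ker p q z y * (?w y * poly (monom 1 (Suc m)) y))
      = (\<lambda>y. ?w y * y ^ m * (abel_ker p q z y * (z - y)))"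
      by (simp add: fun_eq_iff poly_monom algebra_simps)
    show "integrable U01 (\<lambda>y. ?w y * y ^ m * (abel_ker p q z y * (z - y)))"
      using Bochner_Integration.integrable_diff[OF i] unfolding eq .
    show "z * ?S (monom 1 m) z - ?S (monom 1 (Suc m)) z
      = (LINT y|U01. ?w y * y ^ m * (abel_ker p q z y * (z - y)))"
      using Bochner_Integration.integral_diff[OF i] unfolding eq abel_transform_def by simp
  qed
  have gi: "integrable U01 (indicat_real {u..x})"
  proof -
    have "set_integrable lebesgue {u..x} (\<lambda>_. 1 :: real)"
      by (rule absolutely_integrable_continuous_real) auto
    then show ?thesis using set_integrable_sub_U01(1)[OF sub, of "\<lambda>_. 1"] by simp
  qed
  have "(LINT t:{u..x}|lebesgue. ?S (monom 1 m) t) = (LINT t|U01. indicator {u..x} t * ?S (monom 1 m) t)"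
    by (rule set_integrable_sub_U01(2)[OF sub])
  also have "\<dots> = (LINT y|U01. (?w y * poly (monom 1 m) y) * (LINT t|U01. abel_ker q p y t * indicator {u..x} t))"
    by (rule abel_swap(2)[OF adm gi, symmetric])
  also have "\<dots> = (LINT y|U01. (?w y * y ^ m * (abel_ker p q x y * (x - y)) - ?w y * y ^ m * (abel_ker p q u y * (u - y))) / ?\<sigma>)"
  proof (rule Bochner_Integration.integral_cong[OF refl])
    fix y
    have "(LINT t|U01. abel_ker q p y t * indicator {u..x} t) = (LINT t|U01. indicator {u..x} t * abel_ker p q t y)"
      by (rule Bochner_Integration.integral_cong) (simp_all add: abel_ker_sym[of q p])
    also have "\<dots> = (abel_ker p q x y * (x - y) - abel_ker p q u y * (u - y)) / ?\<sigma>"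
      by (rule abel_ker_integral[OF adm x])
    finally show "(?w y * poly (monom 1 m) y) * (LINT t|U01. abel_ker q p y t * indicator {u..x} t)
      = (?w y * y ^ m * (abel_ker p q x y * (x - y)) - ?w y * y ^ m * (abel_ker p q u y * (u - y))) / ?\<sigma>"
      by (simp add: poly_monom right_diff_distrib)
  qed
  also have "\<dots> = ((x * ?S (monom 1 m) x - ?S (monom 1 (Suc m)) x) - (u * ?S (monom 1 m) u - ?S (monom 1 (Suc m)) u)) / ?\<sigma>"
    using e[of x] e[of u] Bochner_Integration.integral_diff[OF ei[of x] ei[of u]] x by simp
  finally show ?thesis using \<sigma> by simp
qed

text \<open>Fixed by the leading coefficients: \<open>abel_transform_monom_step\<close> multiplies them by
  $1 - (2-p-q)/(m+1) = (p+q-1+m)/(m+1)$.\<close>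

definition abel_eig :: "real \<Rightarrow> real \<Rightarrow> nat \<Rightarrow> real" where
  "abel_eig p q m = pi * pochhammer (p + q - 1) m / fact m"

text \<open>By \<open>abel_transform_monom_step\<close> the transform of the next monomial is \<open>x\<close> times that of the previous one,
  minus an antiderivative of it, up to a constant.\<close>

lemma abel_transform_monom:
  assumes adm: "admissible p q"
  shows "\<exists>R. degree R \<le> m \<and> coeff R m = abel_eig p q m \<and> (\<forall>x. 0 < x \<longrightarrow> x < 1 \<longrightarrow> abel_transform p q (monom 1 m) x = poly R x)"
proof (induction m)
  case 0
  have "abel_transform p q (monom 1 0) x = poly [:pi:] x" if "0 < x" "x < 1" for x
    using abel_ker_weight(2)[OF adm that] by (simp add: abel_transform_def monom_0)
  then show ?case by (intro exI[of _ "[:pi:]"]) (auto simp: abel_eig_def)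
next
  case (Suc m)
  let ?S = "abel_transform p q" and ?\<sigma> = "2 - (p + q)"
  obtain R where R: "degree R \<le> m" "coeff R m = abel_eig p q m"
      "\<And>x. 0 < x \<Longrightarrow> x < 1 \<Longrightarrow> ?S (monom 1 m) x = poly R x" using Suc.IH by blast
  obtain Q where Q: "pderiv Q = R" using poly_antiderivative by blast
  define D where "D x = x * ?S (monom 1 m) x - ?S (monom 1 (Suc m)) x" for x
  define c where "c = D (1/2) - ?\<sigma> * poly Q (1/2)"
  have step: "D x - D u = ?\<sigma> * (poly Q x - poly Q u)" if "0 < u" "u \<le> x" "x < 1" for u x
  proof -
    have "D x - D u = ?\<sigma> * (LINT t:{u..x}|lebesgue. ?S (monom 1 m) t)"
      unfolding D_def by (rule abel_transform_monom_step[OF adm that])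
    also have "(LINT t:{u..x}|lebesgue. ?S (monom 1 m) t) = (LINT t:{u..x}|lebesgue. poly (pderiv Q) t)"
      unfolding Q set_lebesgue_integral_def
      by (rule Bochner_Integration.integral_cong[OF refl]) (use R(3) that in \<open>auto simp: indicator_def\<close>)
    also have "\<dots> = poly Q x - poly Q u"
      using primitiveD(2)[OF primitive_poly[of Q] that] by simp
    finally show ?thesis .
  qed
  have D: "D x = ?\<sigma> * poly Q x + c" if "0 < x" "x < 1" for x
    using step[of x "1/2"] step[of "1/2" x] that unfolding c_def right_diff_distrib by (cases "x \<le> 1/2") auto
  define R' where "R' = pCons 0 R - smult ?\<sigma> Q - [:c:]"
  have "?S (monom 1 (Suc m)) x = poly R' x" if "0 < x" "x < 1" for x
    using D[OF that] R(3)[OF that] by (simp add: D_def R'_def)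
  moreover have "degree Q \<le> Suc m" using R(1) unfolding Q[symmetric] degree_pderiv by simp
  then have "degree R' \<le> Suc m" unfolding R'_def
    by (intro degree_diff_le degree_pCons_le[THEN order_trans] order_trans[OF degree_smult_le]) (use R(1) in auto)
  moreover have "coeff R' (Suc m) = abel_eig p q (Suc m)"
  proof -
    have "real (Suc m) * coeff Q (Suc m) = abel_eig p q m"
      using R(2) coeff_pderiv[of Q m] Q by simp
    then have "coeff Q (Suc m) = abel_eig p q m / real (Suc m)" by (simp add: field_simps)
    then have "coeff R' (Suc m) = abel_eig p q m * (1 - ?\<sigma> / real (Suc m))"
      by (simp add: R'_def R(2) algebra_simps del: of_nat_Suc)
    also have "1 - ?\<sigma> / real (Suc m) = (p + q - 1 + real m) / real (Suc m)"
      by (simp add: field_simps)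
    also have "abel_eig p q m * \<dots> = abel_eig p q (Suc m)"
      by (simp add: abel_eig_def pochhammer_Suc mult_ac)
    finally show ?thesis .
  qed
  ultimately show ?case by blast
qed

lemma abel_transform_poly:
  assumes adm: "admissible p q" and n: "degree P \<le> n"
  shows "\<exists>R. degree R \<le> n \<and> coeff R n = abel_eig p q n * coeff P n \<and>
    (\<forall>x. 0 < x \<longrightarrow> x < 1 \<longrightarrow> abel_transform p q P x = poly R x)"
proof -
  obtain R where R: "\<And>m. degree (R m) \<le> m" "\<And>m. coeff (R m) m = abel_eig p q m"
      "\<And>m x. 0 < x \<Longrightarrow> x < 1 \<Longrightarrow> abel_transform p q (monom 1 m) x = poly (R m) x"
    using abel_transform_monom[OF adm] by metis
  define Q where "Q = (\<Sum>m\<le>n. smult (coeff P m) (R m))"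
  have P: "P = (\<Sum>m\<le>n. smult (coeff P m) (monom 1 m))"
    using poly_as_sum_of_monoms'[OF n] by (simp add: smult_monom)
  have "abel_transform p q P x = poly Q x" if x: "0 < x" "x < 1" for x
  proof -
    have "abel_transform p q P x = (LINT t|U01. (\<Sum>m\<le>n. coeff P m * (abel_ker p q x t * (wgt (p - 1) (q - 1) t * poly (monom 1 m) t))))"
      unfolding abel_transform_def
      by (subst P) (simp add: poly_sum sum_distrib_left mult_ac)
    also have "\<dots> = (\<Sum>m\<le>n. LINT t|U01. coeff P m * (abel_ker p q x t * (wgt (p - 1) (q - 1) t * poly (monom 1 m) t)))"
      by (intro Bochner_Integration.integral_sum integrable_mult_right abel_transform_integrable adm x)
    also have "\<dots> = (\<Sum>m\<le>n. coeff P m * abel_transform p q (monom 1 m) x)"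
      by (simp add: abel_transform_def)
    also have "\<dots> = poly Q x" using R(3)[OF x] by (simp add: Q_def poly_sum)
    finally show ?thesis .
  qed
  moreover have "degree Q \<le> n" unfolding Q_def
  proof (rule degree_sum_le)
    fix m assume "m \<in> {..n}"
    then show "degree (smult (coeff P m) (R m)) \<le> n"
      using degree_smult_le[of "coeff P m" "R m"] R(1)[of m] by simp
  qed simp
  moreover have "coeff Q n = abel_eig p q n * coeff P n"
  proof -
    have "coeff Q n = (\<Sum>m\<le>n. if m = n then abel_eig p q n * coeff P n else 0)"
      unfolding Q_def coeff_sum
    proof (rule sum.cong[OF refl])
      fix m assume "m \<in> {..n}"
      moreover have "coeff (R m) n = 0" if "m < n" using R(1)[of m] that by (intro coeff_eq_0) simp
      ultimately show "coeff (smult (coeff P m) (R m)) n = (if m = n then abel_eig p q n * coeff P n else 0)"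
        using R(2)[of n] by (cases "m = n") auto
    qed
    then show ?thesis by simp
  qed
  ultimately show ?thesis by blast
qed

text \<open>The image is a polynomial of degree at most \<open>m\<close>. It is orthogonal to all polynomials \<open>V\<close> of smaller
  degree, for moving the kernel to the other factor produces a polynomial of degree less than \<open>m\<close>,
  against which \<open>G_m\<close> is orthogonal. Together with the leading coefficient this determines it.\<close>

lemma abel_transform_jpoly:
  assumes adm: "admissible p q" and x: "0 < x" "x < 1"
  shows "abel_transform p q (jpoly m (p - 1) (q - 1)) x = abel_eig p q m * poly (jpoly m (q - 1) (p - 1)) x"
proof -
  let ?P = "jpoly m (p - 1) (q - 1)" and ?P' = "jpoly m (q - 1) (p - 1)"
  have a: "-1 < p - 1" "-1 < q - 1" using adm by (auto simp: admissible_def)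
  obtain R where R: "degree R \<le> m" "coeff R m = abel_eig p q m * coeff ?P m"
      "\<And>x. 0 < x \<Longrightarrow> x < 1 \<Longrightarrow> abel_transform p q ?P x = poly R x"
    using abel_transform_poly[OF adm degree_jpoly_le] by blast
  define E where "E = R - smult (abel_eig p q m) ?P'"
  have small: "E = 0 \<or> degree E < m"
  proof -
    have "degree E \<le> m" unfolding E_def
      by (intro degree_diff_le R(1) order_trans[OF degree_smult_le degree_jpoly_le])
    moreover have "coeff E m = 0" unfolding E_def by (simp add: R(2) coeff_jpoly add.commute algebra_simps)
    ultimately show ?thesis by (metis leading_coeff_0_iff le_neq_implies_less)
  qed
  have orth: "(LINT x|jac_measure (q - 1) (p - 1). poly V x * poly E x) = 0" if V: "degree V < m" for V
  proof -
    obtain V' where V': "degree V' \<le> degree V" "\<And>x. 0 < x \<Longrightarrow> x < 1 \<Longrightarrow> abel_transform q p V x = poly V' x"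
      using abel_transform_poly[OF admissible_sym[OF adm] order_refl, of V] by blast
    have wi: "integrable U01 (\<lambda>t. wgt (q - 1) (p - 1) t * poly V t)"
      using poly_integrable[OF a(2,1), of V] jac_measure_integrable[OF poly_measurable_U01] by blast
    have "(LINT x|jac_measure (q - 1) (p - 1). poly V x * poly R x)
       = (LINT t|U01. (wgt (q - 1) (p - 1) t * poly V t) * abel_transform p q ?P t)"
      by (subst jac_measure_integral)
         (auto intro!: integral_U01_cong borel_measurable_times poly_measurable_U01 simp: R(3) mult.assoc)
    also have "\<dots> = (LINT x|U01. (wgt (p - 1) (q - 1) x * poly ?P x) * (LINT t|U01. abel_ker q p x t * (wgt (q - 1) (p - 1) t * poly V t)))"
      by (rule abel_swap(2)[OF adm wi, symmetric])
    also have "\<dots> = (LINT x|jac_measure (p - 1) (q - 1). poly V' x * poly ?P x)"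
      unfolding abel_transform_def[symmetric]
      by (subst jac_measure_integral)
         (auto intro!: integral_U01_cong borel_measurable_times poly_measurable_U01 simp: V'(2) mult_ac)
    also have "\<dots> = 0" using V' V by (intro jpoly_orthogonal a) auto
    finally have 1: "(LINT x|jac_measure (q - 1) (p - 1). poly V x * poly R x) = 0" .
    have 2: "(LINT x|jac_measure (q - 1) (p - 1). poly V x * poly ?P' x) = 0"
      using V by (intro jpoly_orthogonal a)
    have "(LINT x|jac_measure (q - 1) (p - 1). poly V x * poly E x)
      = (LINT x|jac_measure (q - 1) (p - 1). poly V x * poly R x - abel_eig p q m * (poly V x * poly ?P' x))"
      by (simp add: E_def algebra_simps)
    also have "\<dots> = 0"
      using integrable_times_poly[OF poly_integrable[OF a(2,1)]] 1 2
      by (subst Bochner_Integration.integral_diff) auto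
    finally show ?thesis .
  qed
  have "E = 0"
  proof (rule ccontr)
    assume "E \<noteq> 0"
    then have "(LINT x|jac_measure (q - 1) (p - 1). (poly E x)\<^sup>2) = 0"
      using small orth[of E] by (simp add: power2_eq_square)
    then show False using poly_eq_0_of_integral[OF a(2,1)] \<open>E \<noteq> 0\<close> by blast
  qed
  then have "R = smult (abel_eig p q m) ?P'" by (simp add: E_def)
  then show ?thesis using R(3)[OF x] by simp
qed

section \<open>Completeness\<close>

lemma jinner_orthogonal_poly:
  assumes ab: "-1 < a" "-1 < b" and z: "integrable (jac_measure a b) z"
    and 0: "\<And>n. n \<le> N \<Longrightarrow> jinner n a b z = 0" and D: "degree D \<le> N"
  shows "(LINT x|jac_measure a b. z x * poly D x) = 0"
  using D
proof (induction "degree D" arbitrary: D rule: less_induct)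
  case less
  let ?d = "degree D" and ?J = "jpoly (degree D) a b"
  define c where "c = lead_coeff D / coeff ?J ?d"
  define D' where "D' = D - smult c ?J"
  have "degree D' \<le> ?d" unfolding D'_def
    by (intro degree_diff_le order_refl order_trans[OF degree_smult_le degree_jpoly_le])
  moreover have "coeff D' ?d = 0"
    using coeff_jpoly_pos[OF ab, of ?d] by (simp add: D'_def c_def)
  ultimately have "D' = 0 \<or> degree D' < ?d" by (metis leading_coeff_0_iff le_neq_implies_less)
  then have D': "(LINT x|jac_measure a b. z x * poly D' x) = 0"
    using less.hyps[of D'] less.prems by auto
  have "(LINT x|jac_measure a b. z x * poly D x) = (LINT x|jac_measure a b. z x * poly D' x + c * (z x * poly ?J x))"
    by (simp add: D'_def algebra_simps)
  also have "\<dots> = (LINT x|jac_measure a b. z x * poly D' x) + c * jinner ?d a b z"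
    unfolding jinner_def using integrable_times_poly[OF z]
    by (subst Bochner_Integration.integral_add) auto
  finally show ?case using D' 0 less.prems by simp
qed

lemma sq_int_uminus: "sq_int a b w \<Longrightarrow> sq_int a b (\<lambda>x. - w x)"
  by (simp add: sq_int_def)

lemma sq_int_diff: "sq_int a b v \<Longrightarrow> sq_int a b w \<Longrightarrow> sq_int a b (\<lambda>x. v x - w x)"
  using sq_int_add[OF _ sq_int_uminus, of a b v w] by simp

text \<open>The residual of the partial sum is orthogonal to all polynomials of degree at most \<open>N\<close>.\<close>

lemma jsum_best_approximation:
  assumes ab: "-1 < a" "-1 < b" and v: "sq_int a b v" and P: "degree P \<le> N"
  shows "(LINT x|jac_measure a b. (v x - poly (jsum N a b v) x)\<^sup>2) \<le> (LINT x|jac_measure a b. (v x - poly P x)\<^sup>2)"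
proof -
  let ?J = "jac_measure a b" and ?S = "jsum N a b v"
  define z where "z x = v x - poly ?S x" for x
  have zs: "sq_int a b z" unfolding z_def by (intro sq_int_diff v sq_int_poly ab)
  have zi: "integrable ?J z" by (rule sq_int_integrable[OF zs ab])
  have "jinner n a b z = 0" if "n \<le> N" for n
  proof -
    have "jinner n a b z = (LINT x|?J. v x * poly (jpoly n a b) x - poly ?S x * poly (jpoly n a b) x)"
      by (simp add: jinner_def z_def left_diff_distrib)
    also have "\<dots> = jinner n a b v - jinner n a b (poly ?S)"
      unfolding jinner_def
      by (intro Bochner_Integration.integral_diff integrable_times_poly sq_int_integrable v ab poly_integrable)
    finally show ?thesis using jinner_jsum[OF ab that] by simp
  qed
  then have cross: "(LINT x|?J. z x * poly (?S - P) x) = 0"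
    by (rule jinner_orthogonal_poly[OF ab zi, of N]) (auto intro!: degree_diff_le degree_jsum P)
  have i: "integrable ?J (\<lambda>x. (z x)\<^sup>2)" "integrable ?J (\<lambda>x. z x * poly (?S - P) x)" "integrable ?J (\<lambda>x. (poly (?S - P) x)\<^sup>2)"
    using zs sq_int_poly[OF ab, of "?S - P"] integrable_times_poly[OF zi, of "?S - P"] by (simp_all add: sq_int_def)
  have "(LINT x|?J. (v x - poly P x)\<^sup>2) = (LINT x|?J. (z x)\<^sup>2 + 2 * (z x * poly (?S - P) x) + (poly (?S - P) x)\<^sup>2)"
    by (rule Bochner_Integration.integral_cong[OF refl]) (simp add: z_def power2_eq_square algebra_simps)
  also have "\<dots> = (LINT x|?J. (z x)\<^sup>2) + 2 * (LINT x|?J. z x * poly (?S - P) x) + (LINT x|?J. (poly (?S - P) x)\<^sup>2)"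
    using i by (subst Bochner_Integration.integral_add) (auto simp: Bochner_Integration.integral_add)
  also have "\<dots> \<ge> (LINT x|?J. (z x)\<^sup>2)"
    unfolding cross by (simp add: Bochner_Integration.integral_nonneg)
  finally show ?thesis by (simp add: z_def)
qed

lemma continuous_poly_approximation:
  fixes h :: "real \<Rightarrow> real"
  assumes "continuous_on {0..1} h" "0 < e"
  shows "\<exists>P. \<forall>x\<in>{0..1}. \<bar>h x - poly P x\<bar> < e"
proof -
  obtain g where g: "real_polynomial_function g" "\<And>x. x \<in> {0..1} \<Longrightarrow> \<bar>h x - g x\<bar> < e"
    using Stone_Weierstrass_real_polynomial_function[OF _ assms(1) assms(2)] by auto
  obtain c n where "g = (\<lambda>x. \<Sum>i\<le>n. c i * x ^ i)"
    using g(1) unfolding real_polynomial_function_iff_sum by blast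
  then have "g = poly (\<Sum>i\<le>n. monom (c i) i)" by (simp add: poly_sum poly_monom fun_eq_iff)
  then show ?thesis using g(2) by blast
qed

text \<open>The quotient $u/\omega$ may be singular at the end points, but $u/(\omega+1/n)$ is continuous on $[0,1]$, is
  dominated by $u/\omega$ and tends to it. Weierstrass' theorem applies to these functions.\<close>

lemma weighted_poly_approximation:
  assumes ab: "0 < a" "0 < b" and u: "continuous_on {0..1} u"
    and v: "sq_int a b (\<lambda>x. u x / wgt a b x)" and e: "0 < e"
  shows "\<exists>P. (LINT x|jac_measure a b. (u x / wgt a b x - poly P x)\<^sup>2) \<le> e"
proof -
  have ab1: "-1 < a" "-1 < b" using ab by auto
  let ?J = "jac_measure a b" and ?v = "\<lambda>x. u x / wgt a b x"
  define w where "w n x = u x / (wgt a b x + 1 / real (Suc n))" for n x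
  have wc: "continuous_on {0..1} (w n)" for n
  proof -
    have "continuous_on {0..1} (wgt a b)"
      unfolding wgt_def[abs_def] by (intro continuous_intros continuous_on_powr') (use ab in auto)
    moreover have "wgt a b x + 1 / real (Suc n) \<noteq> 0" for x
      using wgt_nonneg[of a b x] by (smt (verit) of_nat_0_less_iff zero_less_Suc zero_less_divide_1_iff)
    ultimately show ?thesis unfolding w_def by (intro continuous_intros u) auto
  qed
  have wm: "w n \<in> borel_measurable U01" for n
    by (rule continuous_measurable_U01[OF continuous_on_subset[OF wc]]) auto
  have vm: "?v \<in> borel_measurable U01" using v by (simp add: sq_int_def)
  have vw: "?v x - w n x = ?v x * (1 / real (Suc n) / (wgt a b x + 1 / real (Suc n)))" if "0 < x" "x < 1" for n x
  proof -
    have "u / c - u / (c + d) = u / c * (d / (c + d))" if "0 < c" "0 < d" for u c d :: real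
      using that by (simp add: field_simps)
    then show ?thesis unfolding w_def using wgt_pos[OF that, of a b] by simp
  qed
  have le: "(?v x - w n x)\<^sup>2 \<le> (?v x)\<^sup>2" if x: "0 < x" "x < 1" for n x
  proof -
    have *: "0 \<le> d / (c + d)" "d / (c + d) \<le> 1" if "0 < c" "0 < d" for c d :: real
      using that by auto
    have "0 \<le> 1 / real (Suc n) / (wgt a b x + 1 / real (Suc n))"
      "1 / real (Suc n) / (wgt a b x + 1 / real (Suc n)) \<le> 1"
      using wgt_pos[OF x, of a b] by (intro *; simp)+
    moreover have "\<bar>y * t\<bar> \<le> \<bar>y\<bar>" if "0 \<le> t" "t \<le> 1" for y t :: real
      using that by (simp add: abs_mult mult_left_le)
    ultimately have "\<bar>?v x - w n x\<bar> \<le> \<bar>?v x\<bar>" unfolding vw[OF x] by blast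
    then show ?thesis by (simp only: abs_le_square_iff)
  qed
  have "(\<lambda>n. LINT x|?J. (?v x - w n x)\<^sup>2) \<longlonglongrightarrow> (LINT x|?J. 0)"
  proof (rule integral_dominated_convergence[where w = "\<lambda>x. (?v x)\<^sup>2"])
    show "integrable ?J (\<lambda>x. (?v x)\<^sup>2)" using v by (simp add: sq_int_def)
    show "(\<lambda>x. (?v x - w n x)\<^sup>2) \<in> borel_measurable ?J" for n
      unfolding jac_measure_measurable by (intro borel_measurable_power borel_measurable_diff vm wm)
    show "AE x in ?J. (\<lambda>n. (?v x - w n x)\<^sup>2) \<longlonglongrightarrow> 0"
    proof (rule AE_I2)
      fix x assume "x \<in> space ?J"
      then have x: "0 < x" "x < 1" by auto
      have "(\<lambda>n. (?v x - u x / (wgt a b x + 1 / real (Suc n)))\<^sup>2) \<longlonglongrightarrow> (?v x - u x / (wgt a b x + 0))\<^sup>2"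
        using wgt_pos[OF x, of a b] by (intro tendsto_intros LIMSEQ_Suc[OF lim_1_over_n]) auto
      then show "(\<lambda>n. (?v x - w n x)\<^sup>2) \<longlonglongrightarrow> 0" by (simp add: w_def)
    qed
    show "AE x in ?J. norm ((?v x - w n x)\<^sup>2) \<le> (?v x)\<^sup>2" for n
      by (rule AE_I2) (use le in auto)
  qed simp
  then have "eventually (\<lambda>n. (LINT x|?J. (?v x - w n x)\<^sup>2) < e / 4) sequentially"
    by (rule order_tendstoD) (use e in simp)
  then obtain n where n: "(LINT x|?J. (?v x - w n x)\<^sup>2) < e / 4" by (auto simp: eventually_sequentially)
  define T where "T = (LINT x|?J. 1 :: real)"
  have T0: "0 \<le> T" unfolding T_def by (intro Bochner_Integration.integral_nonneg) auto
  define d where "d = sqrt (e / (4 * (T + 1)))"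
  have d: "0 < d" "d\<^sup>2 * T \<le> e / 4"
  proof -
    show "0 < d" using e T0 by (simp add: d_def)
    have "d\<^sup>2 * T = e / 4 * (T / (T + 1))" using e T0 by (simp add: d_def)
    also have "\<dots> \<le> e / 4 * 1" using e T0 by (intro mult_left_mono) auto
    finally show "d\<^sup>2 * T \<le> e / 4" by simp
  qed
  obtain P where P: "\<And>x. x \<in> {0..1} \<Longrightarrow> \<bar>w n x - poly P x\<bar> < d"
    using continuous_poly_approximation[OF wc d(1)] by blast
  have P2: "(w n x - poly P x)\<^sup>2 \<le> d\<^sup>2" if "0 < x" "x < 1" for x
    using power_mono[of "\<bar>w n x - poly P x\<bar>" d 2] P[of x] that by simp
  have sp: "sq_int a b (\<lambda>x. ?v x - poly P x)" by (intro sq_int_diff v sq_int_poly ab1)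
  have iw: "integrable ?J (\<lambda>x. (?v x - w n x)\<^sup>2)"
  proof (rule Bochner_Integration.integrable_bound)
    show "integrable ?J (\<lambda>x. (?v x)\<^sup>2)" using v by (simp add: sq_int_def)
    show "(\<lambda>x. (?v x - w n x)\<^sup>2) \<in> borel_measurable ?J"
      unfolding jac_measure_measurable by (intro borel_measurable_power borel_measurable_diff vm wm)
    show "AE x in ?J. norm ((?v x - w n x)\<^sup>2) \<le> norm ((?v x)\<^sup>2)"
      by (rule AE_I2) (use le in auto)
  qed
  have i1: "integrable ?J (\<lambda>_. d\<^sup>2)" using finite_measure.integrable_const[OF jac_measure_finite[OF ab1]] .
  have "(LINT x|?J. (?v x - poly P x)\<^sup>2) \<le> (LINT x|?J. 2 * (?v x - w n x)\<^sup>2 + 2 * d\<^sup>2)"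
  proof (rule integral_mono)
    show "integrable ?J (\<lambda>x. (?v x - poly P x)\<^sup>2)" using sp by (simp add: sq_int_def)
    show "integrable ?J (\<lambda>x. 2 * (?v x - w n x)\<^sup>2 + 2 * d\<^sup>2)"
      by (intro Bochner_Integration.integrable_add integrable_mult_right iw i1)
    fix x assume "x \<in> space ?J"
    then have x: "0 < x" "x < 1" by auto
    have "(y - z)\<^sup>2 \<le> 2 * (y - t)\<^sup>2 + 2 * (t - z)\<^sup>2" for y t z :: real
    proof -
      have "0 \<le> ((y - t) - (t - z))\<^sup>2" by simp
      then show ?thesis by (simp add: power2_eq_square algebra_simps)
    qed
    then have "(?v x - poly P x)\<^sup>2 \<le> 2 * (?v x - w n x)\<^sup>2 + 2 * (w n x - poly P x)\<^sup>2" .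
    then show "(?v x - poly P x)\<^sup>2 \<le> 2 * (?v x - w n x)\<^sup>2 + 2 * d\<^sup>2" using P2[OF x] by linarith
  qed
  also have "\<dots> = (LINT x|?J. 2 * (?v x - w n x)\<^sup>2) + (LINT x|?J. 2 * d\<^sup>2)"
    by (intro Bochner_Integration.integral_add integrable_mult_right iw i1)
  also have "\<dots> = 2 * (LINT x|?J. (?v x - w n x)\<^sup>2) + 2 * (d\<^sup>2 * T)"
    unfolding T_def by simp
  also have "\<dots> \<le> e" using n d(2) by linarith
  finally show ?thesis by blast
qed

text \<open>The residuals of the orders \<open>N\<close> and \<open>M\<close> differ by a finite sum of energies, and the one of order
  \<open>M\<close> tends to 0.\<close>

lemma residual_le_tail:
  assumes ab: "0 < a" "0 < b" and u: "continuous_on {0..1} u"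
    and v: "sq_int a b (\<lambda>x. u x / wgt a b x)"
    and tail: "\<And>M. (\<Sum>n=Suc N..M. energy n a b (\<lambda>x. u x / wgt a b x)) \<le> B"
  shows "(LINT x|jac_measure a b. (u x / wgt a b x - poly (jsum N a b (\<lambda>x. u x / wgt a b x)) x)\<^sup>2) \<le> B"
proof (rule field_le_epsilon)
  fix e :: real assume e: "0 < e"
  have ab1: "-1 < a" "-1 < b" using ab by auto
  let ?v = "\<lambda>x. u x / wgt a b x"
  let ?R = "\<lambda>N. (LINT x|jac_measure a b. (?v x - poly (jsum N a b ?v) x)\<^sup>2)"
  obtain P where P: "(LINT x|jac_measure a b. (?v x - poly P x)\<^sup>2) \<le> e"
    using weighted_poly_approximation[OF ab u v e] by blast
  define M where "M = max N (degree P)"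
  have "?R M \<le> (LINT x|jac_measure a b. (?v x - poly P x)\<^sup>2)"
    by (rule jsum_best_approximation[OF ab1 v]) (simp add: M_def)
  moreover have "?R N = ?R M + (\<Sum>n=Suc N..M. energy n a b ?v)"
  proof -
    have "{..M} = {..N} \<union> {Suc N..M}" by (auto simp: M_def)
    then have "(\<Sum>n\<le>M. energy n a b ?v) = (\<Sum>n\<le>N. energy n a b ?v) + (\<Sum>n=Suc N..M. energy n a b ?v)"
      by (simp only:) (rule sum.union_disjoint, auto)
    then show ?thesis using residual_energy(1)[OF ab1 v, of M] residual_energy(1)[OF ab1 v, of N] by simp
  qed
  ultimately show "?R N \<le> B + e" using P tail[of M] by linarith
qed

section \<open>The eigenvalues\<close>

text \<open>The quotient of both sides increases with \<open>j\<close>, as $(1+1/n)^{\alpha-1} \le 1 + (\alpha-1)/n$ by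
  Bernoulli's inequality for the exponent $\alpha-1 \in (0,1)$.\<close>

lemma Gamma_ratio_lower_bound:
  assumes "1 < \<alpha>" "\<alpha> < 2"
  shows "Gamma \<alpha> * real (Suc j) powr (\<alpha> - 1) \<le> Gamma (real j + \<alpha>) / fact j"
proof (induction j)
  case 0 then show ?case by simp
next
  case (Suc j)
  let ?n = "real (Suc j)"
  have "(1 + 1 / ?n) powr (\<alpha> - 1) * 1 powr (2 - \<alpha>) \<le> (\<alpha> - 1) * (1 + 1 / ?n) + (2 - \<alpha>) * 1"
    by (rule Youngs_inequality_0) (use assms in \<open>auto simp: add_pos_nonneg\<close>)
  also have "\<dots> = (real j + \<alpha>) / ?n" by (simp add: field_simps)
  finally have y: "(1 + 1 / ?n) powr (\<alpha> - 1) \<le> (real j + \<alpha>) / ?n" by simp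
  have "real (Suc (Suc j)) = ?n * (1 + 1 / ?n)" by (simp add: field_simps)
  then have "Gamma \<alpha> * real (Suc (Suc j)) powr (\<alpha> - 1) = (Gamma \<alpha> * ?n powr (\<alpha> - 1)) * (1 + 1 / ?n) powr (\<alpha> - 1)"
    by (simp only: powr_mult)
  also have "\<dots> \<le> (Gamma (real j + \<alpha>) / fact j) * ((real j + \<alpha>) / ?n)"
    using assms by (intro mult_mono Suc.IH y) (auto intro!: divide_nonneg_nonneg less_imp_le[OF Gamma_real_pos])
  also have "\<dots> = Gamma (real (Suc j) + \<alpha>) / fact (Suc j)"
  proof -
    have "real j + \<alpha> \<notin> \<int>\<^sub>\<le>\<^sub>0" using assms nonpos_Ints_nonpos[of "real j + \<alpha>"] by auto
    then have "Gamma (real j + \<alpha> + 1) = (real j + \<alpha>) * Gamma (real j + \<alpha>)" by (rule Gamma_plus1)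
    then show ?thesis by (simp add: add_ac mult_ac)
  qed
  finally show ?case .
qed

lemma eig_lower_bound:
  assumes "1 < \<alpha>" "\<alpha> < 2" and S: "0 < sin (pi * (\<alpha> - \<beta>)) + sin (pi * \<beta>)"
  shows "\<exists>c>0. \<forall>j. c * real (Suc j) powr (\<alpha> - 1) \<le> \<bar>eig \<alpha> \<beta> j\<bar>"
proof -
  let ?S = "sin (pi * (\<alpha> - \<beta>)) + sin (pi * \<beta>)"
  have sn: "sin (pi * \<alpha>) < 0" using assms by (intro sin_lt_zero) (auto simp: mult.commute[of pi])
  define c where "c = \<bar>sin (pi * \<alpha>) / ?S\<bar>"
  have c: "0 < c" using divide_neg_pos[OF sn S] unfolding c_def by linarith
  have "c * Gamma \<alpha> * real (Suc j) powr (\<alpha> - 1) \<le> \<bar>eig \<alpha> \<beta> j\<bar>" for j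
  proof -
    have "0 < Gamma (real j + \<alpha>)" using assms by (intro Gamma_real_pos) auto
    then have "\<bar>Gamma (real j + \<alpha>) / fact j\<bar> = Gamma (real j + \<alpha>) / fact j" by simp
    then have "\<bar>eig \<alpha> \<beta> j\<bar> = c * (Gamma (real j + \<alpha>) / fact j)"
      unfolding eig_def c_def abs_mult by simp
    then show ?thesis using mult_left_mono[OF Gamma_ratio_lower_bound[OF assms(1,2), of j], of c] c
      by (simp add: mult.assoc)
  qed
  moreover have "0 < c * Gamma \<alpha>" using c assms by (intro mult_pos_pos Gamma_real_pos) auto
  ultimately show ?thesis by blast
qed

text \<open>The reflection formula turns $\pi/(\Gamma(\alpha-1)\Gamma(2-\alpha))$ into $-\sin(\pi\alpha)$.\<close>

lemma abel_eig_eq_eig: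
  assumes "1 < \<alpha>" "\<alpha> < 2" and S: "0 < sin (pi * (\<alpha> - \<beta>)) + sin (pi * \<beta>)"
  shows "abel_eig \<beta> (\<alpha> - \<beta>) (Suc j) / ((sin (pi * (\<alpha> - \<beta>)) + sin (pi * \<beta>)) * Gamma (2 - \<alpha>))
     = - eig \<alpha> \<beta> j / real (Suc j)"
proof -
  have "\<alpha> - 1 \<notin> \<int>\<^sub>\<le>\<^sub>0" using assms nonpos_Ints_nonpos[of "\<alpha> - 1"] by auto
  then have "pochhammer (\<alpha> - 1) (Suc j) = Gamma (\<alpha> - 1 + real (Suc j)) / Gamma (\<alpha> - 1)"
    by (rule pochhammer_Gamma)
  then have P: "pochhammer (\<alpha> - 1) (Suc j) = Gamma (real j + \<alpha>) / Gamma (\<alpha> - 1)"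
    by (simp add: algebra_simps)
  have R: "sin (pi * (\<alpha> - 1)) * (Gamma (\<alpha> - 1) * Gamma (2 - \<alpha>)) = pi"
    using Gamma_reflection_real[of "\<alpha> - 1"] assms by simp
  have sn: "sin (pi * (\<alpha> - 1)) = - sin (pi * \<alpha>)" by (simp add: right_diff_distrib sin_diff)
  have pos: "0 < Gamma (\<alpha> - 1)" "0 < Gamma (2 - \<alpha>)" using assms by (auto intro: Gamma_real_pos)
  have "pi / (Gamma (\<alpha> - 1) * Gamma (2 - \<alpha>)) = - sin (pi * \<alpha>)"
    using R pos unfolding sn by (simp add: field_simps)
  then have E: "pi * (g / G1) / F / (S * G2) = (- sin (pi * \<alpha>)) * (g / (F * S))"
    if "G1 = Gamma (\<alpha> - 1)" "G2 = Gamma (2 - \<alpha>)" for g F S G1 G2 :: real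
  proof -
    have "pi * (g / G1) / F / (S * G2) = pi / (G1 * G2) * (g / (F * S))" by simp
    then show ?thesis using \<open>pi / _ = _\<close> that by simp
  qed
  have "abel_eig \<beta> (\<alpha> - \<beta>) (Suc j) = pi * (Gamma (real j + \<alpha>) / Gamma (\<alpha> - 1)) / fact (Suc j)"
    using P by (simp add: abel_eig_def)
  then show ?thesis
    by (simp only: E) (simp add: eig_def mult_ac)
qed

text \<open>The recursion \<open>jnorm_Suc\<close> is symmetric in the parameters and leads back to a Beta function.\<close>

lemma jnorm_sym: "-1 < a \<Longrightarrow> -1 < b \<Longrightarrow> jnorm n a b = jnorm n b a"
proof (induction n arbitrary: a b)
  case 0
  have "jnorm 0 a b = Beta (b + 1) (a + 1)" if "-1 < a" "-1 < b" for a b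
    unfolding jnorm_def using wgt_integrable(2)[OF that]
    by (subst jac_measure_integral) (auto simp: jpoly_def)
  then show ?case using 0 Beta_commute by metis
next
  case (Suc n)
  have "real (Suc n) * jnorm (Suc n) a b = real (Suc n) * jnorm (Suc n) b a"
    using jnorm_Suc[OF Suc.prems] jnorm_Suc[OF Suc.prems(2,1)] Suc.IH[of "a + 1" "b + 1"] Suc.prems
    by (simp add: add_ac)
  then show ?case by simp
qed

section \<open>The solution and its expansion\<close>

lemma AE_eq_continuous:
  fixes f g :: "real \<Rightarrow> real"
  assumes f: "continuous_on {0<..<1} f" and g: "continuous_on {0<..<1} g"
    and ae: "AE x in U01. f x = g x" and x: "0 < x" "x < 1"
  shows "f x = g x"
proof (rule ccontr)
  assume ne: "f x \<noteq> g x"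
  define S where "S = {0<..<1} \<inter> (\<lambda>x. f x - g x) -` (- {0})"
  have "open S" unfolding S_def
    by (intro continuous_open_preimage continuous_intros f g)
  moreover have "AE x in lebesgue. x \<notin> S"
    using ae unfolding unit_interval_AE_iff by eventually_elim (auto simp: S_def)
  then have "negligible S"
    using \<open>open S\<close> by (auto simp: negligible_iff_null_sets AE_iff_null_sets)
  ultimately have "S = {}" using open_not_negligible by blast
  then show False using ne x by (auto simp: S_def)
qed

text \<open>Below, \<open>v\<close> is the function whose Jacobi expansion is truncated, and the operator is \<open>- \<kappa>\<close> times the
  integral of \<open>Du\<close> against the kernel (\<open>frac_op_kernel\<close>).\<close>

locale fractional_problem =
  fixes \<alpha> \<beta> r A :: real and K f u :: "real \<Rightarrow> real" and Km KM :: real and s :: nat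
  assumes \<alpha>: "1 < \<alpha>" "\<alpha> < 2" and \<beta>: "\<alpha> - 1 \<le> \<beta>" "\<beta> \<le> 1"
    and r: "r = sin (pi * \<beta>) / (sin (pi * (\<alpha> - \<beta>)) + sin (pi * \<beta>))"
    and K: "0 < Km" "\<And>x. 0 < x \<Longrightarrow> x < 1 \<Longrightarrow> Km \<le> K x \<and> K x \<le> KM"
    and f: "in_wH s \<beta> (\<alpha> - \<beta>) f" and K_reg: "in_Winf (s + 1) (\<lambda>x. 1 / K x)"
    and sol: "is_solution \<alpha> r \<beta> K f u A"
begin

abbreviation \<gamma> where "\<gamma> \<equiv> \<alpha> - \<beta>"
abbreviation S where "S \<equiv> sin (pi * \<gamma>) + sin (pi * \<beta>)"
abbreviation \<kappa> where "\<kappa> \<equiv> 1 / (S * Gamma (2 - \<alpha>))"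
abbreviation Du where "Du \<equiv> weak_deriv 1 u"
abbreviation g where "g x \<equiv> rhs1 K f x - A * rhs2 K x"
abbreviation v where "v x \<equiv> u x / wgt \<gamma> \<beta> x"

lemma params: "0 < \<beta>" "\<beta> \<le> 1" "0 < \<gamma>" "\<gamma> \<le> 1" "-1 < \<beta> - 1" "-1 < \<gamma> - 1" "-1 < \<beta>" "-1 < \<gamma>"
  using \<alpha> \<beta> by auto

lemma adm: "admissible \<beta> \<gamma>"
  using params \<alpha> by (auto simp: admissible_def)

lemma S_pos: "0 < S"
proof -
  have 0: "0 \<le> sin (pi * \<beta>)" "0 \<le> sin (pi * \<gamma>)" using params by (auto intro: sin_pi_mult_nonneg)
  have "\<beta> < 1 \<or> \<gamma> < 1" using \<alpha> by linarith
  then have "0 < sin (pi * \<beta>) \<or> 0 < sin (pi * \<gamma>)"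
    using params by (auto intro!: sin_gt_zero)
  then show ?thesis using 0 by linarith
qed

lemma r': "1 - r = sin (pi * \<gamma>) / S" using S_pos r by (simp add: field_simps)

lemma u_continuous: "continuous_on {0..1} u" and u_0: "u 0 = 0" and u_1: "u 1 = 0"
  and u_sq: "sq_int (- \<gamma>) (- \<beta>) u"
  and u_eq: "AE x in U01. frac_op \<alpha> r u x = g x"
  using sol by (auto simp: is_solution_def in_wL2_iff)

text \<open>\<open>Du\<close> is the choice made by \<open>weak_deriv\<close>; uniqueness of the weak derivative transfers integrability to
  it, and continuity turns equality almost everywhere into equality.\<close>

lemma Du: "integrable U01 Du" "primitive u Du"
proof -
  obtain h where h: "has_weak_deriv 1 u h" "integrable U01 h"
    using sol by (auto simp: is_solution_def set_integrable_U01)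
  have w: "has_weak_deriv 1 u Du" by (rule has_weak_deriv_weak_deriv[OF h(1)])
  show "integrable U01 Du"
    using integrable_cong_AE[OF borel_measurable_integrable[OF h(2)]
        locally_integrable_measurable[OF has_weak_derivD(2)[OF w]] weak_deriv_unique[OF h(1) w]] h(2) by simp
  obtain V where V: "primitive V Du" "AE x in U01. u x = V x" using weak_deriv_primitive[OF w] by blast
  have "continuous_on {0<..<1} u" by (rule continuous_on_subset[OF u_continuous]) auto
  then have "V x = u x" if "0 < x" "x < 1" for x
    using AE_eq_continuous[OF _ primitive_continuous[OF V(1)] V(2) that] by simp
  then show "primitive u Du" by (rule primitive_cong[OF V(1)])
qed

lemma u_tendsto: "(u \<longlongrightarrow> 0) (at_right 0)" "(u \<longlongrightarrow> 0) (at_left 1)"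
proof -
  have c: "(u \<longlongrightarrow> u x) (at x within {0..1})" if "x \<in> {0..1}" for x
    using u_continuous that by (auto simp: continuous_on_def)
  have "at (0::real) within {0..1} = at_right 0" by (rule at_within_Icc_at_right) simp
  then show "(u \<longlongrightarrow> 0) (at_right 0)" using c[of 0] u_0 by simp
  have "at (1::real) within {0..1} = at_left 1" by (rule at_within_Icc_at_left) simp
  then show "(u \<longlongrightarrow> 0) (at_left 1)" using c[of 1] u_1 by simp
qed

lemma u_measurable: "u \<in> borel_measurable U01"
  using u_sq by (simp add: sq_int_def)

lemma integral_Du_poly: "(LINT t|U01. Du t * poly Q t) = - (LINT t|U01. u t * poly (pderiv Q) t)"
proof -
  have i1: "integrable U01 (\<lambda>t. Du t * poly Q t)"
  proof -
    obtain B where B: "\<And>t. 0 < t \<Longrightarrow> t < 1 \<Longrightarrow> \<bar>poly Q t\<bar> \<le> B" using poly_bounded by blast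
    show ?thesis
    proof (rule integrable_U01_bound)
      show "integrable U01 (\<lambda>t. B * \<bar>Du t\<bar>)" using Du by simp
      show "(\<lambda>t. Du t * poly Q t) \<in> borel_measurable U01"
        using Du poly_measurable_U01 by (intro borel_measurable_times) auto
      fix t :: real assume "0 < t" "t < 1"
      then have "\<bar>Du t * poly Q t\<bar> \<le> B * \<bar>Du t\<bar>"
        using mult_right_mono[OF B, of t "\<bar>Du t\<bar>"] by (simp add: abs_mult mult.commute)
      then show "\<bar>Du t * poly Q t\<bar> \<le> \<bar>B * \<bar>Du t\<bar>\<bar>" by linarith
    qed
  qed
  have i2: "integrable U01 (\<lambda>t. u t * poly (pderiv Q) t)"
  proof -
    have "set_integrable lebesgue {0..1} (\<lambda>t. u t * poly (pderiv Q) t)"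
      by (intro absolutely_integrable_continuous_real continuous_intros u_continuous)
    then have "set_integrable lebesgue {0<..<1} (\<lambda>t. u t * poly (pderiv Q) t)"
      by (rule set_integrable_subset) auto
    then show ?thesis by (simp add: set_integrable_U01)
  qed
  have pl: "(poly Q \<longlongrightarrow> poly Q c) (at c within T)" for c T
    by (intro tendsto_intros) 
  have "(LINT t:{0<..<1}|lebesgue. Du t * poly Q t + u t * poly (pderiv Q) t) = 0"
  proof (rule primitive_integral_boundary[OF primitive_mult[OF Du(2) primitive_poly]])
    show "set_integrable lebesgue {0<..<1} (\<lambda>t. Du t * poly Q t + u t * poly (pderiv Q) t)"
      unfolding set_integrable_U01 by (intro Bochner_Integration.integrable_add i1 i2)
    show "((\<lambda>x. u x * poly Q x) \<longlongrightarrow> 0) (at_right 0)" "((\<lambda>x. u x * poly Q x) \<longlongrightarrow> 0) (at_left 1)"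
      using tendsto_mult[OF u_tendsto(1) pl[of 0]] tendsto_mult[OF u_tendsto(2) pl[of 1]] by simp_all
  qed
  then show ?thesis using Bochner_Integration.integral_add[OF i1 i2] by (simp add: set_integral_U01)
qed

lemma frac_op_kernel: "AE x in U01. frac_op \<alpha> r u x = - \<kappa> * (LINT t|U01. abel_ker \<gamma> \<beta> x t * Du t)"
  using abel_swap(3)[OF adm Du(1)]
proof (rule AE_mp, intro AE_I2 impI)
  fix x assume "x \<in> space U01" and i: "integrable U01 (\<lambda>t. abel_ker \<gamma> \<beta> x t * Du t)"
  then have x: "0 < x" "x < 1" by auto
  let ?h = "\<lambda>t. abel_ker \<gamma> \<beta> x t * Du t"
  have sub: "{0<..<x} \<subseteq> {0<..<1}" "{x<..<1} \<subseteq> {0<..<1}" using x by auto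
  have ind: "integrable U01 (\<lambda>t. indicator T t * ?h t)" if "T \<in> sets borel" for T
  proof (rule integrable_U01_bound[OF i])
    show "(\<lambda>t. indicator T t * ?h t) \<in> borel_measurable U01"
      by (rule borel_measurable_times[OF borel_measurable_U01 borel_measurable_integrable[OF i]])
         (use that in simp)
  qed (auto simp: indicator_def)
  have "(LINT t|U01. ?h t) = (LINT t|U01. indicator {0<..<x} t * ?h t + indicator {x<..<1} t * ?h t)"
    by (rule integral_U01_cong) (auto simp: indicator_def abel_ker_def)
  also have "\<dots> = (LINT t:{0<..<x}|lebesgue. ?h t) + (LINT t:{x<..<1}|lebesgue. ?h t)"
    unfolding set_integrable_sub_U01(2)[OF sub(1)] set_integrable_sub_U01(2)[OF sub(2)]
    by (intro Bochner_Integration.integral_add ind) auto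
  also have "(LINT t:{0<..<x}|lebesgue. ?h t) = (LINT t:{0<..<x}|lebesgue. sin (pi * \<beta>) * (Du t * (x - t) powr (2 - \<alpha> - 1)))"
    unfolding set_lebesgue_integral_def
    by (rule Bochner_Integration.integral_cong) (auto simp: indicator_def abel_ker_def)
  also have "\<dots> = sin (pi * \<beta>) * (LINT t:{0<..<x}|lebesgue. Du t * (x - t) powr (2 - \<alpha> - 1))"
    by (rule set_integral_mult_right)
  also have "(LINT t:{x<..<1}|lebesgue. ?h t) = (LINT t:{x<..<1}|lebesgue. sin (pi * \<gamma>) * (Du t * (t - x) powr (2 - \<alpha> - 1)))"
    unfolding set_lebesgue_integral_def
    by (rule Bochner_Integration.integral_cong) (auto simp: indicator_def abel_ker_def)
  also have "\<dots> = sin (pi * \<gamma>) * (LINT t:{x<..<1}|lebesgue. Du t * (t - x) powr (2 - \<alpha> - 1))"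
    by (rule set_integral_mult_right)
  finally have E: "(LINT t|U01. ?h t) = sin (pi * \<beta>) * (LINT t:{0<..<x}|lebesgue. Du t * (x - t) powr (2 - \<alpha> - 1))
      + sin (pi * \<gamma>) * (LINT t:{x<..<1}|lebesgue. Du t * (t - x) powr (2 - \<alpha> - 1))" .
  show "frac_op \<alpha> r u x = - \<kappa> * (LINT t|U01. ?h t)"
    unfolding E frac_op_def frac_int_left_def frac_int_right_def r' by (subst r) (simp add: distrib_left)
qed

lemma g_properties:
  "\<exists>G. jsob (Suc s) (\<beta> - 1) (\<gamma> - 1) G \<and> (AE x in U01. G x = g x)"
  using rhs_jsob[OF params(1-4) f K_reg] .

lemma rhs_sq_int: "sq_int (\<beta> - 1) (\<gamma> - 1) (rhs1 K f)" "sq_int (\<beta> - 1) (\<gamma> - 1) (rhs2 K)"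
proof -
  obtain k where k: "bsob (s + 1) k" "AE x in U01. k x = 1 / K x"
    using in_Winf_representative[OF K_reg] by blast
  obtain h where "has_weak_deriv 0 (\<lambda>x. 1 / K x) h" using K_reg unfolding in_Winf_def by blast
  then have "(\<lambda>x. 1 / K x) \<in> borel_measurable U01"
    by (intro locally_integrable_measurable has_weak_derivD(1))
  then have b: "ess_bounded (\<lambda>x. 1 / K x)"
    by (rule ess_bounded_cong_AE[OF bsob_ess_bounded[OF k(1)] k(2)])
  have "sq_int (\<beta> - 1) (\<gamma> - 1) (antideriv f)"
    by (rule jsob_sq_int[OF antideriv_jsob[OF params(1-4) f]])
  from sq_int_mult_bounded[OF this b] show "sq_int (\<beta> - 1) (\<gamma> - 1) (rhs1 K f)"
    by (simp add: rhs1_def[abs_def] antideriv_def mult.commute)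
  from sq_int_mult_bounded[OF sq_int_const[of "\<beta> - 1" "\<gamma> - 1" 1] b] show "sq_int (\<beta> - 1) (\<gamma> - 1) (rhs2 K)"
    using params by (simp add: rhs2_def[abs_def])
qed

lemma g_sq_int: "sq_int (\<beta> - 1) (\<gamma> - 1) g"
proof -
  have "sq_int (\<beta> - 1) (\<gamma> - 1) (\<lambda>x. A * rhs2 K x)"
    using rhs_sq_int(2) by (auto simp: sq_int_def power_mult_distrib intro: borel_measurable_times)
  then show ?thesis using sq_int_diff[OF rhs_sq_int(1)] by blast
qed

text \<open>Test the equation with $\omega^{(\beta-1,\gamma-1)}G_m^{(\beta-1,\gamma-1)}$, move the kernel to this
  function and integrate by parts, using the boundary conditions.\<close>

lemma jinner_g: "jinner m (\<beta> - 1) (\<gamma> - 1) g = \<kappa> * abel_eig \<beta> \<gamma> m * (LINT t|U01. u t * poly (pderiv (jpoly m (\<gamma> - 1) (\<beta> - 1))) t)"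
proof -
  let ?P = "jpoly m (\<beta> - 1) (\<gamma> - 1)" and ?w = "wgt (\<beta> - 1) (\<gamma> - 1)"
  have gm: "g \<in> borel_measurable U01" using g_sq_int by (simp add: sq_int_def)
  let ?T = "\<lambda>x. LINT t|U01. abel_ker \<gamma> \<beta> x t * Du t"
  have ae: "AE x in U01. g x = - \<kappa> * ?T x" using u_eq frac_op_kernel by eventually_elim simp
  have Tm: "(\<lambda>x. ?w x * poly ?P x * ?T x) \<in> borel_measurable U01"
    using abel_swap(1)[OF adm Du(1), of ?P] by auto
  have "jinner m (\<beta> - 1) (\<gamma> - 1) g = (LINT x|U01. ?w x * (g x * poly ?P x))"
    unfolding jinner_def by (rule jac_measure_integral) (intro borel_measurable_times gm poly_measurable_U01)
  also have "\<dots> = (LINT x|U01. - \<kappa> * (?w x * poly ?P x * ?T x))"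
  proof (rule integral_cong_AE)
    show "(\<lambda>x. ?w x * (g x * poly ?P x)) \<in> borel_measurable U01"
      by (intro borel_measurable_times gm poly_measurable_U01 borel_measurable_U01 wgt_measurable)
    show "(\<lambda>x. - \<kappa> * (?w x * poly ?P x * ?T x)) \<in> borel_measurable U01"
      by (intro borel_measurable_times Tm) simp
    show "AE x in U01. ?w x * (g x * poly ?P x) = - \<kappa> * (?w x * poly ?P x * ?T x)"
      using ae by eventually_elim (simp only: mult_ac)
  qed
  also have "\<dots> = - \<kappa> * (LINT x|U01. ?w x * poly ?P x * ?T x)" by (rule integral_mult_right_zero)
  also have "(LINT x|U01. ?w x * poly ?P x * ?T x) = (LINT t|U01. Du t * abel_transform \<beta> \<gamma> ?P t)"
    by (rule abel_swap(2)[OF adm Du(1)])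
  also have "\<dots> = (LINT t|U01. abel_eig \<beta> \<gamma> m * (Du t * poly (jpoly m (\<gamma> - 1) (\<beta> - 1)) t))"
    by (rule integral_U01_cong) (simp add: abel_transform_jpoly[OF adm])
  also have "\<dots> = abel_eig \<beta> \<gamma> m * (LINT t|U01. Du t * poly (jpoly m (\<gamma> - 1) (\<beta> - 1)) t)"
    by (rule integral_mult_right_zero)
  also have "(LINT t|U01. Du t * poly (jpoly m (\<gamma> - 1) (\<beta> - 1)) t) = - (LINT t|U01. u t * poly (pderiv (jpoly m (\<gamma> - 1) (\<beta> - 1))) t)"
    by (rule integral_Du_poly)
  finally show ?thesis by simp
qed

lemma v_sq_int: "sq_int \<gamma> \<beta> v"
proof -
  have w: "wgt \<gamma> \<beta> \<in> borel_measurable U01" by (rule borel_measurable_U01[OF wgt_measurable])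
  have vm: "v \<in> borel_measurable U01" by (intro borel_measurable_divide u_measurable w)
  have um: "(\<lambda>x. (u x)\<^sup>2) \<in> borel_measurable U01" by (intro borel_measurable_power u_measurable)
  have "integrable U01 (\<lambda>x. wgt (- \<gamma>) (- \<beta>) x * (u x)\<^sup>2)"
    using u_sq um by (simp add: sq_int_def jac_measure_integrable)
  moreover have "wgt (- \<gamma>) (- \<beta>) x * (u x)\<^sup>2 = wgt \<gamma> \<beta> x * (v x)\<^sup>2" if "0 < x" "x < 1" for x
  proof -
    have "wgt \<gamma> \<beta> x * wgt (- \<gamma>) (- \<beta>) x = 1" unfolding wgt_add using that by (simp add: wgt_def)
    then have "wgt (- \<gamma>) (- \<beta>) x = 1 / wgt \<gamma> \<beta> x" using wgt_pos[OF that, of \<gamma> \<beta>] by (simp add: field_simps)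
    then show ?thesis using wgt_pos[OF that, of \<gamma> \<beta>] by (simp add: power_divide power2_eq_square)
  qed
  ultimately have "integrable U01 (\<lambda>x. wgt \<gamma> \<beta> x * (v x)\<^sup>2)" by (subst integrable_U01_cong[symmetric]) auto
  then show ?thesis using vm by (simp add: sq_int_def jac_measure_integrable[OF borel_measurable_power[OF vm]])
qed

lemma jinner_v: "jinner j \<gamma> \<beta> v = (LINT t|U01. u t * poly (jpoly j \<gamma> \<beta>) t)"
proof -
  have "v \<in> borel_measurable U01" using v_sq_int by (simp add: sq_int_def)
  then have "jinner j \<gamma> \<beta> v = (LINT t|U01. wgt \<gamma> \<beta> t * (v t * poly (jpoly j \<gamma> \<beta>) t))"
    unfolding jinner_def by (intro jac_measure_integral borel_measurable_times poly_measurable_U01)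
  also have "\<dots> = (LINT t|U01. u t * poly (jpoly j \<gamma> \<beta>) t)"
    using wgt_pos by (intro integral_U01_cong) (simp add: less_imp_neq[THEN not_sym])
  finally show ?thesis .
qed

lemma jinner_g_Suc:
  "jinner (Suc j) (\<beta> - 1) (\<gamma> - 1) g = - eig \<alpha> \<beta> j / real (Suc j) * (real j + \<alpha>) * jinner j \<gamma> \<beta> v"
proof -
  have "pderiv (jpoly (Suc j) (\<gamma> - 1) (\<beta> - 1)) = smult (real j + \<alpha>) (jpoly j \<gamma> \<beta>)"
    using pderiv_jpoly[of j "\<gamma> - 1" "\<beta> - 1"] by simp
  then have "(LINT t|U01. u t * poly (pderiv (jpoly (Suc j) (\<gamma> - 1) (\<beta> - 1))) t) = (LINT t|U01. (real j + \<alpha>) * (u t * poly (jpoly j \<gamma> \<beta>) t))"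
    by (simp add: mult_ac)
  also have "\<dots> = (real j + \<alpha>) * jinner j \<gamma> \<beta> v" unfolding jinner_v by (rule integral_mult_right_zero)
  finally show ?thesis
    using jinner_g[of "Suc j"] abel_eig_eq_eig[OF \<alpha> S_pos, of j] by (simp add: mult.assoc)
qed

text \<open>For $m=0$ the Jacobi polynomial is constant, so that the right-hand side of \<open>jinner_g\<close> is 0.\<close>

lemma A_eq: "const_A \<alpha> \<beta> K f = A"
proof -
  let ?J = "jac_measure (\<beta> - 1) (\<gamma> - 1)"
  have i: "integrable ?J (rhs1 K f)" "integrable ?J (rhs2 K)"
    using rhs_sq_int params by (auto intro: sq_int_integrable)
  have "jpoly 0 a b = 1" for a b by (simp add: jpoly_def)
  then have "(LINT x|?J. g x) = 0"
    using jinner_g[of 0] by (simp add: jinner_def)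
  then have E: "(LINT x|?J. rhs1 K f x) = A * (LINT x|?J. rhs2 K x)"
    using i by (simp add: Bochner_Integration.integral_diff)
  have m: "rhs1 K f \<in> borel_measurable U01" "rhs2 K \<in> borel_measurable U01"
    using rhs_sq_int by (auto simp: sq_int_def)
  have W: "wip (\<beta> - 1) (\<gamma> - 1) (rhs1 K f) (\<lambda>_. 1) = (LINT x|?J. rhs1 K f x)"
    "wip (\<beta> - 1) (\<gamma> - 1) (rhs2 K) (\<lambda>_. 1) = (LINT x|?J. rhs2 K x)"
    by (simp_all add: wip_eq m)
  have KM: "0 < KM" using K(1) K(2)[of "1/2"] by auto
  have "0 < 1 / KM * Beta (\<gamma> - 1 + 1) (\<beta> - 1 + 1)"
    using KM params by (auto simp: Beta_def intro!: divide_pos_pos mult_pos_pos Gamma_real_pos)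
  also have "\<dots> = (LINT x|U01. 1 / KM * wgt (\<beta> - 1) (\<gamma> - 1) x)"
    using wgt_integrable(2)[OF params(5,6)] by simp
  also have "\<dots> \<le> (LINT x|U01. wgt (\<beta> - 1) (\<gamma> - 1) x * rhs2 K x)"
  proof (rule integral_mono)
    show "integrable U01 (\<lambda>x. 1 / KM * wgt (\<beta> - 1) (\<gamma> - 1) x)"
      by (intro integrable_mult_right wgt_integrable params)
    show "integrable U01 (\<lambda>x. wgt (\<beta> - 1) (\<gamma> - 1) x * rhs2 K x)"
      using i(2) jac_measure_integrable[OF m(2)] by simp
    fix x assume "x \<in> space U01"
    then have x: "0 < x" "x < 1" by auto
    have "1 / KM \<le> rhs2 K x" unfolding rhs2_def using K(2)[OF x] K(1) KM by (intro divide_left_mono mult_pos_pos) auto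
    then show "1 / KM * wgt (\<beta> - 1) (\<gamma> - 1) x \<le> wgt (\<beta> - 1) (\<gamma> - 1) x * rhs2 K x"
      using mult_right_mono[OF _ wgt_nonneg[of "\<beta> - 1" "\<gamma> - 1" x], of "1 / KM" "rhs2 K x"]
      by (simp add: mult.commute)
  qed
  also have "\<dots> = (LINT x|?J. rhs2 K x)" by (rule jac_measure_integral[OF m(2), symmetric])
  finally show ?thesis unfolding const_A_def W E by simp
qed

lemma eig_nonzero: "eig \<alpha> \<beta> j \<noteq> 0"
proof -
  obtain c where c: "0 < c" "\<And>j. c * real (Suc j) powr (\<alpha> - 1) \<le> \<bar>eig \<alpha> \<beta> j\<bar>"
    using eig_lower_bound[OF \<alpha> S_pos] by blast
  have "0 < c * real (Suc j) powr (\<alpha> - 1)" using c(1) by simp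
  then show ?thesis using c(2)[of j] by auto
qed

lemma sol_coeff_eq: "sol_coeff \<alpha> \<beta> K f j = jinner j \<gamma> \<beta> v / jnorm j \<gamma> \<beta>"
proof -
  let ?J = "jac_measure (\<beta> - 1) (\<gamma> - 1)" and ?P = "jpoly (Suc j) (\<beta> - 1) (\<gamma> - 1)"
  have m: "rhs1 K f \<in> borel_measurable U01" "rhs2 K \<in> borel_measurable U01"
    using rhs_sq_int by (auto simp: sq_int_def)
  have coeff: "jac_coeff (\<beta> - 1) (\<gamma> - 1) h n = jinner n (\<beta> - 1) (\<gamma> - 1) h / jnorm n (\<beta> - 1) (\<gamma> - 1)"
    if "h \<in> borel_measurable U01" for h n
    unfolding jac_coeff_def jacobi01_eq jinner_def jnorm_def
    using that by (simp add: wip_eq wnorm_eq poly_measurable_U01)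
  have "jinner (Suc j) (\<beta> - 1) (\<gamma> - 1) g = (LINT x|?J. rhs1 K f x * poly ?P x - A * (rhs2 K x * poly ?P x))"
    unfolding jinner_def by (simp add: left_diff_distrib mult.assoc)
  also have "\<dots> = jinner (Suc j) (\<beta> - 1) (\<gamma> - 1) (rhs1 K f) - A * jinner (Suc j) (\<beta> - 1) (\<gamma> - 1) (rhs2 K)"
    unfolding jinner_def
    using integrable_times_poly[OF sq_int_integrable[OF rhs_sq_int(1) params(5,6)]]
      integrable_times_poly[OF sq_int_integrable[OF rhs_sq_int(2) params(5,6)]]
    by (subst Bochner_Integration.integral_diff) auto
  finally have "sol_coeff \<alpha> \<beta> K f j = - (jinner (Suc j) (\<beta> - 1) (\<gamma> - 1) g / jnorm (Suc j) (\<beta> - 1) (\<gamma> - 1)) / eig \<alpha> \<beta> j"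
    unfolding sol_coeff_def A_eq by (simp add: coeff m diff_divide_distrib)
  also have "\<dots> = (real j + \<alpha>) * jinner j \<gamma> \<beta> v / (real (Suc j) * jnorm (Suc j) (\<beta> - 1) (\<gamma> - 1))"
    unfolding jinner_g_Suc using eig_nonzero[of j] by (simp del: of_nat_Suc)
  also have "real (Suc j) * jnorm (Suc j) (\<beta> - 1) (\<gamma> - 1) = (real j + \<alpha>) * jnorm j \<gamma> \<beta>"
    using jnorm_Suc[OF params(5,6), of j] jnorm_sym[of \<beta> \<gamma> j] params by simp
  finally show ?thesis using \<alpha> by simp
qed

text \<open>The spectral approximation is \<open>wgt\<close> times the orthogonal projection of $u/\omega^{(\gamma,\beta)}$.\<close>

lemma spectral_approx_eq: "spectral_approx \<alpha> \<beta> K f N x = wgt \<gamma> \<beta> x * poly (jsum N \<gamma> \<beta> v) x"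
  unfolding spectral_approx_def jsum_def sol_coeff_eq jacobi01_eq by (simp add: poly_sum)

text \<open>The exact quotient of the energies is $\lambda_j^2\,(j+\alpha)/(j+1)$, and $\alpha > 1$.\<close>

lemma energy_v: "energy j \<gamma> \<beta> v \<le> energy (Suc j) (\<beta> - 1) (\<gamma> - 1) g / (eig \<alpha> \<beta> j)\<^sup>2"
proof -
  define n a X h e where "n = real (Suc j)" and "a = real j + \<alpha>" and "X = jinner j \<gamma> \<beta> v"
    and "h = jnorm j \<gamma> \<beta>" and "e = eig \<alpha> \<beta> j"
  have pos: "0 < n" "n \<le> a" "0 < h" "e \<noteq> 0"
    using \<alpha> jnorm_pos[OF params(8,7), of j] eig_nonzero by (auto simp: n_def a_def h_def e_def)
  have "n * jnorm (Suc j) (\<beta> - 1) (\<gamma> - 1) = a * h"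
    using jnorm_Suc[OF params(5,6), of j] jnorm_sym[of \<beta> \<gamma> j] params by (simp add: n_def a_def h_def)
  then have H: "jnorm (Suc j) (\<beta> - 1) (\<gamma> - 1) = a * h / n" using pos by (simp add: field_simps)
  have "energy (Suc j) (\<beta> - 1) (\<gamma> - 1) g / e\<^sup>2 = (- e / n * a * X)\<^sup>2 / (a * h / n) / e\<^sup>2"
    unfolding energy_def H jinner_g_Suc n_def a_def X_def e_def ..
  also have "\<dots> = (a / n) * (X\<^sup>2 / h)"
    using pos by (simp add: power2_eq_square)
  also have "\<dots> \<ge> 1 * (X\<^sup>2 / h)"
    using pos by (intro mult_right_mono) auto
  finally show ?thesis unfolding energy_def[of j] X_def h_def e_def by simp
qed

lemma energy_g_tail: "\<exists>C\<ge>0. \<forall>N M. (\<Sum>m=N..M. energy m (\<beta> - 1) (\<gamma> - 1) g) \<le> C / real (N + 1) ^ (2 * Suc s)"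
proof -
  obtain G where G: "jsob (Suc s) (\<beta> - 1) (\<gamma> - 1) G" "AE x in U01. G x = g x" using g_properties by blast
  have "jinner m (\<beta> - 1) (\<gamma> - 1) G = jinner m (\<beta> - 1) (\<gamma> - 1) g" for m
    unfolding jinner_def
  proof (rule integral_cong_AE)
    have m: "(\<lambda>x. h x * poly q x) \<in> borel_measurable (jac_measure (\<beta> - 1) (\<gamma> - 1))"
      if "sq_int (\<beta> - 1) (\<gamma> - 1) h" for h q
      unfolding jac_measure_measurable
      using that poly_measurable_U01 by (auto simp: sq_int_def intro: borel_measurable_times)
    show "(\<lambda>x. G x * poly (jpoly m (\<beta> - 1) (\<gamma> - 1)) x) \<in> borel_measurable (jac_measure (\<beta> - 1) (\<gamma> - 1))"
      by (rule m[OF jsob_sq_int[OF G(1)]])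
    show "(\<lambda>x. g x * poly (jpoly m (\<beta> - 1) (\<gamma> - 1)) x) \<in> borel_measurable (jac_measure (\<beta> - 1) (\<gamma> - 1))"
      by (rule m[OF g_sq_int])
    show "AE x in jac_measure (\<beta> - 1) (\<gamma> - 1). G x * poly (jpoly m (\<beta> - 1) (\<gamma> - 1)) x = g x * poly (jpoly m (\<beta> - 1) (\<gamma> - 1)) x"
      using jac_measure_AE[OF G(2)] by eventually_elim simp
  qed
  then have "energy m (\<beta> - 1) (\<gamma> - 1) G = energy m (\<beta> - 1) (\<gamma> - 1) g" for m by (simp add: energy_def)
  then show ?thesis using energy_tail[OF params(5,6) _ G(1)] \<alpha> by simp
qed

lemma energy_v_tail: "\<exists>C\<ge>0. \<forall>N M. (\<Sum>j=Suc N..M. energy j \<gamma> \<beta> v) \<le> C / (real N + 1) powr (2 * (\<alpha> + real s))"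
proof -
  obtain C where C: "0 \<le> C" "\<And>N M. (\<Sum>m=N..M. energy m (\<beta> - 1) (\<gamma> - 1) g) \<le> C / real (N + 1) ^ (2 * Suc s)"
    using energy_g_tail by blast
  obtain c where c: "0 < c" "\<And>j. c * real (Suc j) powr (\<alpha> - 1) \<le> \<bar>eig \<alpha> \<beta> j\<bar>"
    using eig_lower_bound[OF \<alpha> S_pos] by blast
  have "(\<Sum>j=Suc N..M. energy j \<gamma> \<beta> v) \<le> (C / c\<^sup>2) / (real N + 1) powr (2 * (\<alpha> + real s))" for N M
  proof -
    define n where "n = real N + 1"
    have n: "1 \<le> n" by (simp add: n_def)
    have "(\<Sum>j=Suc N..M. energy j \<gamma> \<beta> v) \<le> (\<Sum>j=Suc N..M. energy (Suc j) (\<beta> - 1) (\<gamma> - 1) g / (c * n powr (\<alpha> - 1))\<^sup>2)"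
    proof (rule sum_mono)
      fix j assume j: "j \<in> {Suc N..M}"
      have "c * n powr (\<alpha> - 1) \<le> c * real (Suc j) powr (\<alpha> - 1)"
        using c(1) \<alpha> j n by (intro mult_left_mono powr_mono2) (auto simp: n_def)
      also have "\<dots> \<le> \<bar>eig \<alpha> \<beta> j\<bar>" by (rule c(2))
      finally have "(c * n powr (\<alpha> - 1))\<^sup>2 \<le> (eig \<alpha> \<beta> j)\<^sup>2"
        using c(1) n by (metis abs_ge_zero abs_of_nonneg mult_nonneg_nonneg less_imp_le powr_ge_zero power2_abs power_mono)
      then have "energy (Suc j) (\<beta> - 1) (\<gamma> - 1) g / (eig \<alpha> \<beta> j)\<^sup>2 \<le> energy (Suc j) (\<beta> - 1) (\<gamma> - 1) g / (c * n powr (\<alpha> - 1))\<^sup>2"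
        using c(1) n energy_nonneg[OF params(5,6)] eig_nonzero[of j]
        by (intro divide_left_mono mult_pos_pos) auto
      then show "energy j \<gamma> \<beta> v \<le> energy (Suc j) (\<beta> - 1) (\<gamma> - 1) g / (c * n powr (\<alpha> - 1))\<^sup>2"
        using energy_v[of j] by linarith
    qed
    also have "\<dots> = (\<Sum>j=Suc N..M. energy (Suc j) (\<beta> - 1) (\<gamma> - 1) g) / (c * n powr (\<alpha> - 1))\<^sup>2"
      by (rule sum_divide_distrib[symmetric])
    also have "(\<Sum>j=Suc N..M. energy (Suc j) (\<beta> - 1) (\<gamma> - 1) g) = (\<Sum>m=Suc (Suc N)..Suc M. energy m (\<beta> - 1) (\<gamma> - 1) g)"
      by (rule sum.shift_bounds_cl_Suc_ivl[symmetric])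
    also have "\<dots> / (c * n powr (\<alpha> - 1))\<^sup>2 \<le> C / real (Suc (Suc N) + 1) ^ (2 * Suc s) / (c * n powr (\<alpha> - 1))\<^sup>2"
      by (intro divide_right_mono C) auto
    also have "\<dots> \<le> C / n ^ (2 * Suc s) / (c * n powr (\<alpha> - 1))\<^sup>2"
      using C(1) n by (intro divide_right_mono divide_left_mono power_mono mult_pos_pos zero_less_power) (auto simp: n_def)
    also have "\<dots> = (C / c\<^sup>2) / (n ^ (2 * Suc s) * (n powr (\<alpha> - 1))\<^sup>2)"
      by (simp add: power_mult_distrib mult_ac)
    also have "n ^ (2 * Suc s) * (n powr (\<alpha> - 1))\<^sup>2 = n powr (2 * (\<alpha> + real s))"
    proof -
      have "n ^ (2 * Suc s) = n powr (real (2 * Suc s))" using n by (subst powr_realpow) auto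
      moreover have "(n powr (\<alpha> - 1))\<^sup>2 = n powr (2 * (\<alpha> - 1))" using n by (simp add: power2_eq_square powr_add[symmetric])
      ultimately show ?thesis by (simp add: powr_add[symmetric] algebra_simps)
    qed
    finally show ?thesis by (simp add: n_def)
  qed
  then show ?thesis using C(1) c(1) by (intro exI[of _ "C / c\<^sup>2"]) auto
qed

text \<open>Both exponents of $\omega^{(\gamma,\beta)}$ are positive, so $(\omega z)^2 \le \omega z^2$.\<close>

lemma error_le_residual:
  "(LINT x:{0<..<1}|lebesgue. (u x - spectral_approx \<alpha> \<beta> K f N x)\<^sup>2)
     \<le> (LINT x|jac_measure \<gamma> \<beta>. (v x - poly (jsum N \<gamma> \<beta> v) x)\<^sup>2)"
proof -
  let ?z = "\<lambda>x. v x - poly (jsum N \<gamma> \<beta> v) x" and ?w = "wgt \<gamma> \<beta>"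
  have z: "sq_int \<gamma> \<beta> ?z" using params by (intro sq_int_diff v_sq_int sq_int_poly)
  then have zm: "?z \<in> borel_measurable U01" and zi: "integrable U01 (\<lambda>x. ?w x * (?z x)\<^sup>2)"
    using jac_measure_integrable[OF borel_measurable_power, of ?z \<gamma> \<beta> 2] by (auto simp: sq_int_def)
  have w1: "?w x \<le> 1" if "0 < x" "x < 1" for x
    unfolding wgt_def using that params by (intro mult_le_one powr_le1) auto
  have le: "(?w x * ?z x)\<^sup>2 \<le> ?w x * (?z x)\<^sup>2" if "0 < x" "x < 1" for x
  proof -
    have "(?w x * ?z x)\<^sup>2 = ?w x * (?w x * (?z x)\<^sup>2)" by (simp add: power2_eq_square)
    also have "\<dots> \<le> 1 * (?w x * (?z x)\<^sup>2)" by (intro mult_right_mono w1 that mult_nonneg_nonneg wgt_nonneg) auto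
    finally show ?thesis by simp
  qed
  have wzi: "integrable U01 (\<lambda>x. (?w x * ?z x)\<^sup>2)"
  proof (rule integrable_U01_bound[OF zi])
    show "(\<lambda>x. (?w x * ?z x)\<^sup>2) \<in> borel_measurable U01"
      by (intro borel_measurable_power borel_measurable_times zm borel_measurable_U01 wgt_measurable)
    fix x :: real assume "0 < x" "x < 1"
    from le[OF this] show "\<bar>(?w x * ?z x)\<^sup>2\<bar> \<le> \<bar>?w x * (?z x)\<^sup>2\<bar>" by simp
  qed
  have "(LINT x:{0<..<1}|lebesgue. (u x - spectral_approx \<alpha> \<beta> K f N x)\<^sup>2) = (LINT x|U01. (?w x * ?z x)\<^sup>2)"
    unfolding set_integral_U01
  proof (rule integral_U01_cong)
    fix x :: real assume x: "0 < x" "x < 1"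
    have "u x - spectral_approx \<alpha> \<beta> K f N x = ?w x * ?z x"
      using wgt_pos[OF x, of \<gamma> \<beta>] by (simp add: spectral_approx_eq right_diff_distrib)
    then show "(u x - spectral_approx \<alpha> \<beta> K f N x)\<^sup>2 = (?w x * ?z x)\<^sup>2" by simp
  qed
  also have "\<dots> \<le> (LINT x|U01. ?w x * (?z x)\<^sup>2)"
    by (rule integral_mono[OF wzi zi]) (use le in auto)
  also have "\<dots> = (LINT x|jac_measure \<gamma> \<beta>. (?z x)\<^sup>2)"
    by (rule jac_measure_integral[symmetric]) (intro borel_measurable_power zm)
  finally show ?thesis .
qed

lemma error_decay: "\<exists>C\<ge>0. \<forall>N. L2_norm (\<lambda>x. u x - spectral_approx \<alpha> \<beta> K f N x) \<le> C / (real N + 1) powr (\<alpha> + real s)"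
proof -
  obtain C where C: "0 \<le> C" "\<And>N M. (\<Sum>j=Suc N..M. energy j \<gamma> \<beta> v) \<le> C / (real N + 1) powr (2 * (\<alpha> + real s))"
    using energy_v_tail by blast
  have "L2_norm (\<lambda>x. u x - spectral_approx \<alpha> \<beta> K f N x) \<le> sqrt C / (real N + 1) powr (\<alpha> + real s)" for N
  proof -
    have "(LINT x:{0<..<1}|lebesgue. (u x - spectral_approx \<alpha> \<beta> K f N x)\<^sup>2) \<le> C / (real N + 1) powr (2 * (\<alpha> + real s))"
      using error_le_residual[of N] residual_le_tail[OF params(3,1) u_continuous v_sq_int C(2), of N] by linarith
    also have "(real N + 1) powr (2 * (\<alpha> + real s)) = ((real N + 1) powr (\<alpha> + real s))\<^sup>2"
      by (simp add: power2_eq_square powr_add[symmetric])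
    finally have "L2_norm (\<lambda>x. u x - spectral_approx \<alpha> \<beta> K f N x) \<le> sqrt (C / ((real N + 1) powr (\<alpha> + real s))\<^sup>2)"
      unfolding L2_norm_def by (rule real_sqrt_le_mono)
    then show ?thesis by (simp add: real_sqrt_divide)
  qed
  then show ?thesis using C(1) by (intro exI[of _ "sqrt C"]) auto
qed

lemma Winf_pos: "0 < Winf_norm (s + 1) (\<lambda>x. 1 / K x)"
proof -
  have KM: "0 < KM" using K(1) K(2)[of "1/2"] by auto
  show ?thesis
  proof (rule Winf_norm_pos[OF K_reg])
    show "1 / KM \<le> 1 / K x" if "0 < x" "x < 1" for x
      using K(2)[OF that] K(1) KM by (intro divide_left_mono mult_pos_pos) auto
  qed (use KM in simp)
qed

end

theorem corollary4p1:
  fixes \<alpha> r \<beta> Km KM A :: real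
    and K f u :: "real \<Rightarrow> real"
    and s :: nat
  assumes "1 < \<alpha>" and "\<alpha> < 2"
    and "0 \<le> r" and "r \<le> 1"
    and "\<alpha> - 1 \<le> \<beta>" and "\<beta> \<le> 1"
    and "r = sin (pi * \<beta>) / (sin (pi * (\<alpha> - \<beta>)) + sin (pi * \<beta>))"
    and "0 < Km"
    and "\<And>x. 0 < x \<Longrightarrow> x < 1 \<Longrightarrow> Km \<le> K x \<and> K x \<le> KM"
    and "in_wH s \<beta> (\<alpha> - \<beta>) f"
    and "in_Winf (s + 1) (\<lambda>x. 1 / K x)"
    and "is_solution \<alpha> r \<beta> K f u A"
  shows "\<exists>C>0. \<forall>N::nat.
           L2_norm (\<lambda>x. u x - spectral_approx \<alpha> \<beta> K f N x)
             \<le> C * Winf_norm (s + 1) (\<lambda>x. 1 / K x) / (real N + 1) powr (\<alpha> + real s)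
                 * (wH_norm s \<beta> (\<alpha> - \<beta>) f + 1)"
proof -
  interpret fractional_problem \<alpha> \<beta> r A K f u Km KM s
    by (rule fractional_problem.intro) (fact assms)+
  define W where "W = Winf_norm (s + 1) (\<lambda>x. 1 / K x)"
  define F where "F = wH_norm s \<beta> (\<alpha> - \<beta>) f + 1"
  have W: "0 < W" unfolding W_def by (rule Winf_pos)
  have F: "1 \<le> F" unfolding F_def wH_norm_def by (simp add: sum_nonneg)
  obtain C where C: "0 \<le> C" "\<And>N. L2_norm (\<lambda>x. u x - spectral_approx \<alpha> \<beta> K f N x) \<le> C / (real N + 1) powr (\<alpha> + real s)"
    using error_decay by blast
  have "L2_norm (\<lambda>x. u x - spectral_approx \<alpha> \<beta> K f N x) \<le> (C + 1) / W * W / (real N + 1) powr (\<alpha> + real s) * F" for N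
  proof -
    have "L2_norm (\<lambda>x. u x - spectral_approx \<alpha> \<beta> K f N x) \<le> C / (real N + 1) powr (\<alpha> + real s)" by (rule C(2))
    also have "\<dots> \<le> (C + 1) / (real N + 1) powr (\<alpha> + real s) * 1" by (simp add: divide_right_mono)
    also have "\<dots> \<le> (C + 1) / (real N + 1) powr (\<alpha> + real s) * F" using F C(1) by (intro mult_left_mono) auto
    finally show ?thesis using W by simp
  qed
  then show ?thesis unfolding W_def[symmetric] F_def[symmetric]
    using W C(1) by (intro exI[of _ "(C + 1) / W"]) auto
qed

end
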